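(* Let $\mathcal{G}$ be a compact Lie group and let $P(\mathcal{G})$ denote the class of regular probability measures on $\mathcal{G}$. Then $\mu \in P(\mathcal{G})$ is regular (as an element of the convolution semigroup $P(\mathcal{G})$) if and only if $\hat{\mu}^{\dagger}$ is Lo-Ng positive, where $\hat{\mu}^{\dagger}(\pi)$ is the Moore-Penrose inverse of the matrix $\hat{\mu}(\pi)$ for each $\pi \in \widehat{\mathcal{G}}$.
   Context: $P(\mathcal{G})$ is a semigroup under convolution $(\mu\star\nu)(A) = \int_{\mathcal{G}} \mu(Ax^{-1})\,d\nu(x)$ for Borel sets $A$. An element $\mu\in P(\mathcal{G})$ is (algebraically) regular if there is $\nu\in P(\mathcal{G})$ with $\mu\star\nu\star\mu=\mu$. $\widehat{\mathcal{G}}$ is the unitary dual: the set of irreducible unitary representations $\pi:\mathcal{G}\to B(H_\pi)$ up to unitary equivalence; each $H_\pi$ has finite dimension $d_\pi$, and $B(H_\pi)$ is identified with the algebra $M_{d_\pi}(\mathbb{C})$ of $d_\pi\times d_\pi$ complex matrices. The Fourier transform of $\mu\in P(\mathcal{G})$ is $\hat{\mu}(\pi)\psi=\int_{\mathcal{G}} \pi(g^{-1})\psi\,\mu(dg)$ for $\pi\in\widehat{\mathcal{G}}$, $\psi\in H_\pi$. A map $\gamma:\widehat{\mathcal{G}}\to\bigcup_{\pi}M_{d_\pi}(\mathbb{C})$ is compatible if $\gamma(\pi)\in M_{d_\pi}(\mathbb{C})$ for each $\pi$. A compatible $\gamma$ is Lo-Ng positive if, for every finite subset $\Omega\subset\widehat{\mathcal{G}}$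 and all matrices $B(\pi)\in M_{d_\pi}(\mathbb{C})$ ($\pi\in\Omega$), one has $\sum_{\pi\in\Omega} d_\pi\,\mathrm{tr}(\pi(g)\gamma(\pi)B(\pi))\ge 0$ for all $g\in\mathcal{G}$ whenever $\sum_{\pi\in\Omega} d_\pi\,\mathrm{tr}(\pi(g)B(\pi))\ge 0$ for all $g\in\mathcal{G}$. (Here "$\ge 0$" means real and nonnegative.) The Moore-Penrose inverse of a complex square matrix $A$ is the unique matrix $A^{\dagger}$ with $AA^{\dagger}A=A$, $A^{\dagger}AA^{\dagger}=A^{\dagger}$, and $AA^{\dagger}$, $A^{\dagger}A$ orthogonal projections. *)

theory Defs
  imports
    "HOL-Probability.Probability"
    "HOL-Analysis.Abstract_Euclidean_Space"
    "Jordan_Normal_Form.Schur_Decomposition"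
begin

section \<open>Compact Lie groups\<close>

text \<open>
  Groups are types of class \<^class>\<open>topological_group_add\<close>. Despite the additive notation this
  class does not assume commutativity: \<open>x + y\<close>, \<open>- x\<close>, \<open>0\<close>, \<open>x - y\<close> stand for
  \<open>xy\<close>, \<open>x\<^sup>-\<^sup>1\<close>, the unit and \<open>xy\<^sup>-\<^sup>1\<close>.

  The model spaces are the library's \<open>Euclidean_space n\<close> (sequences vanishing from index
  \<open>n\<close> on) and not Euclidean types, so that the dimension is a natural number and may be 0; finite
  groups are compact Lie groups.
\<close>

text \<open>\<open>k\<close>-fold continuous differentiability of a real function on an open subset \<open>V\<close> of
  \<open>\<real>\<^sup>n\<close>, by iterated partial derivatives.\<close>

primrec C_k_on :: "nat \<Rightarrow> nat \<Rightarrow> (nat \<Rightarrow> real) set \<Rightarrow> ((nat \<Rightarrow> real) \<Rightarrow> real) \<Rightarrow> bool" where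
  "C_k_on 0 n V f \<longleftrightarrow> continuous_map (subtopology (Euclidean_space n) V) euclideanreal f"
| "C_k_on (Suc k) n V f \<longleftrightarrow>
     continuous_map (subtopology (Euclidean_space n) V) euclideanreal f \<and>
     (\<forall>i<n. \<exists>D. (\<forall>x\<in>V. ((\<lambda>t. f (x(i := t))) has_real_derivative D x) (at (x i))) \<and>
                C_k_on k n V D)"

definition C_infinity_on :: "nat \<Rightarrow> (nat \<Rightarrow> real) set \<Rightarrow> ((nat \<Rightarrow> real) \<Rightarrow> real) \<Rightarrow> bool" where
  "C_infinity_on n V f \<longleftrightarrow> (\<forall>k. C_k_on k n V f)"

type_synonym 'g chart = "'g set \<times> ('g \<Rightarrow> nat \<Rightarrow> real)"

definition is_chart :: "nat \<Rightarrow> 'g::topological_space chart \<Rightarrow> bool" where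
  "is_chart n = (\<lambda>(U, \<phi>). open U \<and> openin (Euclidean_space n) (\<phi> ` U) \<and>
     homeomorphic_map (top_of_set U) (subtopology (Euclidean_space n) (\<phi> ` U)) \<phi>)"

definition smooth_atlas :: "nat \<Rightarrow> 'g::topological_space chart set \<Rightarrow> bool" where
  "smooth_atlas n \<A> \<longleftrightarrow>
     (\<forall>c\<in>\<A>. is_chart n c) \<and> (\<Union>(U, \<phi>)\<in>\<A>. U) = UNIV \<and>
     (\<forall>(U, \<phi>)\<in>\<A>. \<forall>(V, \<psi>)\<in>\<A>. \<forall>i<n.
        C_infinity_on n (\<phi> ` (U \<inter> V)) (\<lambda>x. \<psi> (inv_into U \<phi> x) i))"

text \<open>A point of \<open>\<real>\<^sup>2\<^sup>n\<close> encodes a pair of points of \<open>\<real>\<^sup>n\<close>; this yields the product charts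
  on the square of the group.\<close>

definition fst_block :: "nat \<Rightarrow> (nat \<Rightarrow> real) \<Rightarrow> nat \<Rightarrow> real" where
  "fst_block n z = (\<lambda>i. if i < n then z i else 0)"

definition snd_block :: "nat \<Rightarrow> (nat \<Rightarrow> real) \<Rightarrow> nat \<Rightarrow> real" where
  "snd_block n z = (\<lambda>i. if i < n then z (n + i) else 0)"

definition smooth_group_mult :: "nat \<Rightarrow> 'g::topological_group_add chart set \<Rightarrow> bool" where
  "smooth_group_mult n \<A> \<longleftrightarrow>
     (\<forall>(U, \<phi>)\<in>\<A>. \<forall>(V, \<psi>)\<in>\<A>. \<forall>(W, \<theta>)\<in>\<A>. \<forall>i<n.
        C_infinity_on (n + n)
          {z \<in> topspace (Euclidean_space (n + n)).
             fst_block n z \<in> \<phi> ` U \<and> snd_block n z \<in> \<psi> ` V \<and>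
             inv_into U \<phi> (fst_block n z) + inv_into V \<psi> (snd_block n z) \<in> W}
          (\<lambda>z. \<theta> (inv_into U \<phi> (fst_block n z) + inv_into V \<psi> (snd_block n z)) i))"

definition smooth_group_inverse :: "nat \<Rightarrow> 'g::topological_group_add chart set \<Rightarrow> bool" where
  "smooth_group_inverse n \<A> \<longleftrightarrow>
     (\<forall>(U, \<phi>)\<in>\<A>. \<forall>(V, \<psi>)\<in>\<A>. \<forall>i<n.
        C_infinity_on n {x \<in> \<phi> ` U. - inv_into U \<phi> x \<in> V} (\<lambda>x. \<psi> (- inv_into U \<phi> x) i))"

text \<open>The sorts \<^class>\<open>t2_space\<close> and \<^class>\<open>second_countable_topology\<close> are part of the definition of
  a manifold.\<close>

definition compact_Lie_group ::
  "nat \<Rightarrow> 'g::{topological_group_add, t2_space, second_countable_topology} chart set \<Rightarrow> bool" where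
  "compact_Lie_group n \<A> \<longleftrightarrow>
     smooth_atlas n \<A> \<and> smooth_group_mult n \<A> \<and> smooth_group_inverse n \<A> \<and>
     compact (UNIV :: 'g set)"


section \<open>The convolution semigroup of regular probability measures\<close>

definition regular_prob_measures :: "'g::topological_space measure set" where
  "regular_prob_measures = {\<mu>. prob_space \<mu> \<and> sets \<mu> = sets borel \<and>
     (\<forall>A\<in>sets borel.
        emeasure \<mu> A = (SUP K\<in>{K. compact K \<and> K \<subseteq> A}. emeasure \<mu> K) \<and>
        emeasure \<mu> A = (INF U\<in>{U. open U \<and> A \<subseteq> U}. emeasure \<mu> U))}"

text \<open>The set \<open>(\<lambda>a. a - x) ` A\<close> is \<open>Ax\<^sup>-\<^sup>1\<close>.\<close>

definition group_convolution ::
  "'g::topological_group_add measure \<Rightarrow> 'g measure \<Rightarrow> 'g measure" where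
  "group_convolution \<mu> \<nu> =
     measure_of UNIV (sets borel) (\<lambda>A. \<integral>\<^sup>+x. emeasure \<mu> ((\<lambda>a. a - x) ` A) \<partial>\<nu>)"

definition convolution_regular :: "'g::topological_group_add measure \<Rightarrow> bool" where
  "convolution_regular \<mu> \<longleftrightarrow>
     (\<exists>\<nu>\<in>regular_prob_measures. group_convolution (group_convolution \<mu> \<nu>) \<mu> = \<mu>)"


section \<open>The unitary dual and the Fourier transform\<close>

definition unitary_mat :: "nat \<Rightarrow> complex mat \<Rightarrow> bool" where
  "unitary_mat d U \<longleftrightarrow>
     U \<in> carrier_mat d d \<and> U * mat_adjoint U = 1\<^sub>m d \<and> mat_adjoint U * U = 1\<^sub>m d"

text \<open>Irreducible unitary representations of a compact group are finite dimensional; they are taken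
  in matrix form, on \<open>\<complex>\<^sup>d\<close>. The dimension is read off from the matrix at the unit element.\<close>

definition rep_dim :: "('g::zero \<Rightarrow> complex mat) \<Rightarrow> nat" where
  "rep_dim \<pi> = dim_row (\<pi> 0)"

definition unitary_rep :: "('g::topological_group_add \<Rightarrow> complex mat) \<Rightarrow> bool" where
  "unitary_rep \<pi> \<longleftrightarrow>
     (\<forall>g. unitary_mat (rep_dim \<pi>) (\<pi> g)) \<and> \<pi> 0 = 1\<^sub>m (rep_dim \<pi>) \<and>
     (\<forall>g h. \<pi> (g + h) = \<pi> g * \<pi> h) \<and>
     (\<forall>i<rep_dim \<pi>. \<forall>j<rep_dim \<pi>. continuous_on UNIV (\<lambda>g. \<pi> g $$ (i, j)))"

definition irreducible_unitary_rep :: "('g::topological_group_add \<Rightarrow> complex mat) \<Rightarrow> bool" where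
  "irreducible_unitary_rep \<pi> \<longleftrightarrow>
     unitary_rep \<pi> \<and> 0 < rep_dim \<pi> \<and>
     (\<forall>W. VectorSpace.subspace class_ring W (module_vec TYPE(complex) (rep_dim \<pi>)) \<and>
          (\<forall>g. \<forall>w\<in>W. \<pi> g *\<^sub>v w \<in> W) \<longrightarrow>
          W = {0\<^sub>v (rep_dim \<pi>)} \<or> W = carrier_vec (rep_dim \<pi>))"

definition unitarily_equivalent ::
  "('g::topological_group_add \<Rightarrow> complex mat) \<Rightarrow> ('g \<Rightarrow> complex mat) \<Rightarrow> bool" where
  "unitarily_equivalent \<pi> \<rho> \<longleftrightarrow> rep_dim \<pi> = rep_dim \<rho> \<and>
     (\<exists>U. unitary_mat (rep_dim \<pi>) U \<and> (\<forall>g. U * \<pi> g = \<rho> g * U))"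

text \<open>A unitary dual is a choice of one representative from each unitary equivalence class of
  irreducible unitary representations.\<close>

definition is_unitary_dual :: "('g::topological_group_add \<Rightarrow> complex mat) set \<Rightarrow> bool" where
  "is_unitary_dual \<G> \<longleftrightarrow>
     (\<forall>\<pi>\<in>\<G>. irreducible_unitary_rep \<pi>) \<and>
     (\<forall>\<rho>. irreducible_unitary_rep \<rho> \<longrightarrow> (\<exists>!\<pi>. \<pi> \<in> \<G> \<and> unitarily_equivalent \<rho> \<pi>))"

lemma mat_adjoint_index:
  assumes "i < dim_col A" "j < dim_row A"
  shows "mat_adjoint A $$ (i, j) = conjugate (A $$ (j, i))"
  using assms by (simp add: mat_adjoint_def mat_of_rows_index)

lemma dim_mat_adjoint [simp]:
  "dim_row (mat_adjoint A) = dim_col A" "dim_col (mat_adjoint A) = dim_row A"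
  by (simp_all add: mat_adjoint_def)

lemma mat_adjoint_mat_adjoint: "mat_adjoint (mat_adjoint A) = A" for A :: "complex mat"
  by (rule eq_matI) (simp_all add: mat_adjoint_index)

lemma mat_adjoint_mult:
  fixes A B :: "complex mat"
  assumes "dim_col A = dim_row B"
  shows "mat_adjoint (A * B) = mat_adjoint B * mat_adjoint A"
  by (rule eq_matI)
    (use assms in \<open>auto simp: mat_adjoint_index scalar_prod_def mult.commute\<close>)

lemma unitary_mat_adjoint: "unitary_mat d U \<Longrightarrow> unitary_mat d (mat_adjoint U)"
  by (auto simp: unitary_mat_def mat_adjoint_mat_adjoint)

lemma unitary_mat_mult:
  assumes "unitary_mat d U" "unitary_mat d V"
  shows "unitary_mat d (U * V)"
proof -
  have U: "U \<in> carrier_mat d d" "mat_adjoint U \<in> carrier_mat d d"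
    and V: "V \<in> carrier_mat d d" "mat_adjoint V \<in> carrier_mat d d"
    using assms by (auto simp: unitary_mat_def)
  have *: "mat_adjoint (U * V) = mat_adjoint V * mat_adjoint U"
    using U V by (intro mat_adjoint_mult) auto
  have "U * V * (mat_adjoint V * mat_adjoint U) = U * (V * mat_adjoint V) * mat_adjoint U"
    using U V by (simp add: assoc_mult_mat[of _ d d _ d _ d])
  moreover have "mat_adjoint V * mat_adjoint U * (U * V) = mat_adjoint V * (mat_adjoint U * U) * V"
    using U V by (simp add: assoc_mult_mat[of _ d d _ d _ d])
  ultimately show ?thesis
    using assms U V by (simp add: unitary_mat_def *)
qed

lemma unitary_rep_carrier: "unitary_rep \<pi> \<Longrightarrow> \<pi> g \<in> carrier_mat (rep_dim \<pi>) (rep_dim \<pi>)"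
  by (simp add: unitary_rep_def unitary_mat_def)

lemma unitarily_equivalentE:
  assumes "unitarily_equivalent \<pi> \<rho>"
  obtains U where "rep_dim \<rho> = rep_dim \<pi>" "unitary_mat (rep_dim \<pi>) U" "\<And>g. U * \<pi> g = \<rho> g * U"
  using assms unfolding unitarily_equivalent_def by metis

lemma unitarily_equivalent_refl:
  assumes "unitary_rep \<pi>" shows "unitarily_equivalent \<pi> \<pi>"
proof -
  have "unitary_mat (rep_dim \<pi>) (1\<^sub>m (rep_dim \<pi>))"
    using assms by (metis unitary_rep_def)
  moreover have "1\<^sub>m (rep_dim \<pi>) * \<pi> g = \<pi> g * 1\<^sub>m (rep_dim \<pi>)" for g
    using unitary_rep_carrier[OF assms, of g] by simp
  ultimately show ?thesis
    unfolding unitarily_equivalent_def by blast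
qed

lemma unitarily_equivalent_sym:
  assumes "unitary_rep \<pi>" "unitary_rep \<rho>" "unitarily_equivalent \<pi> \<rho>"
  shows "unitarily_equivalent \<rho> \<pi>"
proof -
  obtain U where d: "rep_dim \<rho> = rep_dim \<pi>" and U: "unitary_mat (rep_dim \<pi>) U"
    and eq: "\<And>g. U * \<pi> g = \<rho> g * U"
    using unitarily_equivalentE[OF assms(3)] by metis
  let ?d = "rep_dim \<pi>" and ?V = "mat_adjoint U"
  have V: "unitary_mat ?d ?V" by (rule unitary_mat_adjoint[OF U])
  have c: "U \<in> carrier_mat ?d ?d" "?V \<in> carrier_mat ?d ?d"
    and UV: "U * ?V = 1\<^sub>m ?d" "?V * U = 1\<^sub>m ?d"
    using U V unfolding unitary_mat_def by blast+
  have "?V * \<rho> g = \<pi> g * ?V" for g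
  proof -
    have p: "\<pi> g \<in> carrier_mat ?d ?d" and r: "\<rho> g \<in> carrier_mat ?d ?d"
      using unitary_rep_carrier[OF assms(1)] unitary_rep_carrier[OF assms(2)] d by metis+
    have "?V * \<rho> g = ?V * \<rho> g * (U * ?V)"
      unfolding UV by (rule right_mult_one_mat[symmetric]) (rule mult_carrier_mat[OF c(2) r])
    also have "\<dots> = ?V * \<rho> g * U * ?V"
      by (rule assoc_mult_mat[OF mult_carrier_mat[OF c(2) r] c, symmetric])
    also have "\<dots> = ?V * (U * \<pi> g) * ?V"
      unfolding eq assoc_mult_mat[OF c(2) r c(1)] ..
    also have "\<dots> = ?V * U * \<pi> g * ?V"
      unfolding assoc_mult_mat[OF c(2) c(1) p] ..
    also have "\<dots> = \<pi> g * ?V"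
      unfolding UV left_mult_one_mat[OF p] ..
    finally show ?thesis .
  qed
  then show ?thesis
    using V d unfolding unitarily_equivalent_def by metis
qed

lemma unitarily_equivalent_trans:
  assumes "unitary_rep \<pi>" "unitary_rep \<rho>" "unitary_rep \<sigma>"
    and "unitarily_equivalent \<pi> \<rho>" "unitarily_equivalent \<rho> \<sigma>"
  shows "unitarily_equivalent \<pi> \<sigma>"
proof -
  let ?d = "rep_dim \<pi>"
  obtain U where d1: "rep_dim \<rho> = ?d" and U: "unitary_mat ?d U"
    and eq1: "\<And>g. U * \<pi> g = \<rho> g * U"
    using unitarily_equivalentE[OF assms(4)] by metis
  obtain V where d2: "rep_dim \<sigma> = ?d" and V: "unitary_mat ?d V"
    and eq2: "\<And>g. V * \<rho> g = \<sigma> g * V"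
    using unitarily_equivalentE[OF assms(5)] d1 by metis
  have c: "U \<in> carrier_mat ?d ?d" "V \<in> carrier_mat ?d ?d"
    using U V unfolding unitary_mat_def by blast+
  have "(V * U) * \<pi> g = \<sigma> g * (V * U)" for g
  proof -
    have p: "\<pi> g \<in> carrier_mat ?d ?d" and r: "\<rho> g \<in> carrier_mat ?d ?d"
      and s: "\<sigma> g \<in> carrier_mat ?d ?d"
      using unitary_rep_carrier[OF assms(1)] unitary_rep_carrier[OF assms(2)]
        unitary_rep_carrier[OF assms(3)] d1 d2 by metis+
    have "(V * U) * \<pi> g = V * (\<rho> g * U)"
      unfolding assoc_mult_mat[OF c(2) c(1) p] eq1 ..
    also have "\<dots> = (\<sigma> g * V) * U"
      unfolding assoc_mult_mat[OF c(2) r c(1), symmetric] eq2 ..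
    also have "\<dots> = \<sigma> g * (V * U)"
      by (rule assoc_mult_mat[OF s c(2) c(1)])
    finally show ?thesis .
  qed
  then show ?thesis
    using unitary_mat_mult[OF V U] d2 unfolding unitarily_equivalent_def by metis
qed

lemma ex_unitary_dual: "\<exists>\<G> :: ('g::topological_group_add \<Rightarrow> complex mat) set. is_unitary_dual \<G>"
proof -
  let ?I = "irreducible_unitary_rep :: ('g \<Rightarrow> complex mat) \<Rightarrow> bool"
  define r where "r \<pi> = (SOME \<sigma>. ?I \<sigma> \<and> unitarily_equivalent \<pi> \<sigma>)" for \<pi>
  have un: "?I \<pi> \<Longrightarrow> unitary_rep \<pi>" for \<pi>
    by (simp add: irreducible_unitary_rep_def)
  have r: "?I (r \<pi>) \<and> unitarily_equivalent \<pi> (r \<pi>)" if "?I \<pi>" for \<pi>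
    unfolding r_def
    by (rule someI[of _ \<pi>]) (use that un[of \<pi>] unitarily_equivalent_refl[of \<pi>] in blast)
  have r_eq: "r \<pi> = r \<rho>" if "?I \<pi>" "?I \<rho>" "unitarily_equivalent \<pi> \<rho>" for \<pi> \<rho>
  proof -
    have "(?I \<sigma> \<and> unitarily_equivalent \<pi> \<sigma>) = (?I \<sigma> \<and> unitarily_equivalent \<rho> \<sigma>)" for \<sigma>
      using that un[of \<pi>] un[of \<rho>] un[of \<sigma>] unitarily_equivalent_sym[of \<pi> \<rho>]
        unitarily_equivalent_trans[of \<pi> \<rho> \<sigma>] unitarily_equivalent_trans[of \<rho> \<pi> \<sigma>] by blast
    then show ?thesis by (simp add: r_def)
  qed
  have "is_unitary_dual (r ` Collect ?I)"
    unfolding is_unitary_dual_def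
  proof (intro conjI ballI allI impI)
    fix \<pi> assume "\<pi> \<in> r ` Collect ?I"
    then show "?I \<pi>" using r by auto
  next
    fix \<rho> assume \<rho>: "?I \<rho>"
    show "\<exists>!\<pi>. \<pi> \<in> r ` Collect ?I \<and> unitarily_equivalent \<rho> \<pi>"
    proof (rule ex1I[of _ "r \<rho>"])
      show "r \<rho> \<in> r ` Collect ?I \<and> unitarily_equivalent \<rho> (r \<rho>)"
        using r \<rho> by auto
      fix \<sigma> assume \<sigma>: "\<sigma> \<in> r ` Collect ?I \<and> unitarily_equivalent \<rho> \<sigma>"
      then obtain \<tau> where \<tau>: "?I \<tau>" "\<sigma> = r \<tau>" by auto
      have "unitarily_equivalent \<tau> \<rho>"
        using \<tau> \<sigma> \<rho> r[of \<tau>] un[of \<tau>] un[of \<rho>] un[of \<sigma>] unitarily_equivalent_sym[of \<rho> \<sigma>]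
          unitarily_equivalent_trans[of \<tau> \<sigma> \<rho>] by blast
      then show "\<sigma> = r \<rho>" using r_eq \<tau> \<rho> by auto
    qed
  qed
  then show ?thesis by blast
qed

text \<open>The weak integral of the operators \<open>\<pi>(g\<^sup>-\<^sup>1)\<close> in matrix form, i.e. entry by entry.\<close>

definition fourier_transform ::
  "'g::topological_group_add measure \<Rightarrow> ('g \<Rightarrow> complex mat) \<Rightarrow> complex mat" where
  "fourier_transform \<mu> \<pi> =
     mat (rep_dim \<pi>) (rep_dim \<pi>) (\<lambda>(i, j). \<integral>g. \<pi> (- g) $$ (i, j) \<partial>\<mu>)"


section \<open>Lo-Ng positivity and the Moore-Penrose inverse\<close>

definition mat_trace :: "complex mat \<Rightarrow> complex" where
  "mat_trace A = (\<Sum>i<dim_row A. A $$ (i, i))"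

definition compatible ::
  "('g::topological_group_add \<Rightarrow> complex mat) set \<Rightarrow> (('g \<Rightarrow> complex mat) \<Rightarrow> complex mat) \<Rightarrow> bool" where
  "compatible \<G> \<gamma> \<longleftrightarrow> (\<forall>\<pi>\<in>\<G>. \<gamma> \<pi> \<in> carrier_mat (rep_dim \<pi>) (rep_dim \<pi>))"

definition lo_ng_positive ::
  "('g::topological_group_add \<Rightarrow> complex mat) set \<Rightarrow> (('g \<Rightarrow> complex mat) \<Rightarrow> complex mat) \<Rightarrow> bool" where
  "lo_ng_positive \<G> \<gamma> \<longleftrightarrow> compatible \<G> \<gamma> \<and>
     (\<forall>\<Omega> B. finite \<Omega> \<and> \<Omega> \<subseteq> \<G> \<and> (\<forall>\<pi>\<in>\<Omega>. B \<pi> \<in> carrier_mat (rep_dim \<pi>) (rep_dim \<pi>)) \<and>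
        (\<forall>g. (\<Sum>\<pi>\<in>\<Omega>. of_nat (rep_dim \<pi>) * mat_trace (\<pi> g * B \<pi>)) \<in> \<real>\<^sub>\<ge>\<^sub>0) \<longrightarrow>
        (\<forall>g. (\<Sum>\<pi>\<in>\<Omega>. of_nat (rep_dim \<pi>) * mat_trace (\<pi> g * \<gamma> \<pi> * B \<pi>)) \<in> \<real>\<^sub>\<ge>\<^sub>0))"

definition orthogonal_projection_mat :: "complex mat \<Rightarrow> bool" where
  "orthogonal_projection_mat P \<longleftrightarrow> square_mat P \<and> P * P = P \<and> mat_adjoint P = P"

definition is_moore_penrose_inverse :: "complex mat \<Rightarrow> complex mat \<Rightarrow> bool" where
  "is_moore_penrose_inverse A X \<longleftrightarrow> X \<in> carrier_mat (dim_col A) (dim_row A) \<and>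
     A * X * A = A \<and> X * A * X = X \<and>
     orthogonal_projection_mat (A * X) \<and> orthogonal_projection_mat (X * A)"

definition moore_penrose_inverse :: "complex mat \<Rightarrow> complex mat" where
  "moore_penrose_inverse A = (THE X. is_moore_penrose_inverse A X)"

end

theory Submission
  imports Defs "HOL-Complex_Analysis.Great_Picard" "HOL-Library.Function_Algebras"
begin

text \<open>
  For contractions \<open>A\<close> and \<open>X\<close> with \<open>AXA = A\<close> the idempotents \<open>AX\<close> and \<open>XA\<close> are contractive, hence orthogonal
  projections. Fourier transforms of probability measures are Lo-Ng positive, and a Lo-Ng positive
  \<open>\<gamma>\<close> with value 1 at the trivial representation consists of contractions. So if \<open>\<mu> \<star> \<nu> \<star> \<mu> = \<mu>\<close>, the
  Moore-Penrose inverse of the transform of \<open>\<mu>\<close> is the transform of \<open>\<nu> \<star> \<mu> \<star> \<nu>\<close>.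
  Conversely, a contraction whose Moore-Penrose inverse is a contraction is a partial isometry,
  \<open>AA\<^sup>*A = A\<close>. As \<open>A\<^sup>*\<close> is the transform of the image \<open>\<mu>~\<close> of \<open>\<mu>\<close> under inversion, the measures \<open>\<mu> \<star> \<mu>~ \<star> \<mu>\<close>
  and \<open>\<mu>\<close> have the same Fourier transform.

  They are equal by the Peter-Weyl argument: let \<open>\<sigma>\<close> be the difference of two measures with equal transforms,
  \<open>K\<close> the operator with kernel \<open>k(x\<^sup>-\<^sup>1y)\<close> for a symmetric bump function \<open>k\<close>, and
  \<open>F(y) = \<integral> k(x\<^sup>-\<^sup>1y) d\<sigma>(x)\<close>. If \<open>KF \<noteq> 0\<close>, then \<open>K\<^sup>2\<close> has a finite-dimensional eigenspace not orthogonal to \<open>KF\<close>,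
  and a minimal translation-invariant subspace of it with this property affords an irreducible
  representation on which the transform of \<open>\<sigma>\<close> cannot vanish. So \<open>KF = 0\<close>, whence
  \<open>\<parallel>F\<parallel>\<^sup>2 = \<integral> KF d\<sigma> = 0\<close> and \<open>\<integral> Kf d\<sigma> = 0\<close> for all continuous \<open>f\<close>; let \<open>k\<close> concentrate at the unit.
\<close>

section \<open>Matrices\<close>

text \<open>No measure is ever recovered from a Lo-Ng positive function: one direction starts from a
  given \<open>\<nu>\<close>, and the other uses positivity only to bound the Moore-Penrose inverse,
  after which the reflected measure is an explicit \<open>\<nu>\<close>. The bound is phrased as
  \<open>|A V| \<le> |V|\<close> in the Frobenius norm for all square \<open>V\<close>. This is
  equivalent to operator norm at most 1, and it speaks the language of traces in which Lo-Ng
  positivity is stated.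

  The analytic half works with functionals on continuous functions: an invariant mean plays the role
  of Haar measure. The resulting inner product space is not complete in general, so compactness of
  \<open>K\<close> enters through Arzela-Ascoli: \<open>K\<close> sends mean-square bounded families
  to equicontinuous ones, and eigenfunctions arise as uniform limits, hence continuous.
  \<open>K\<close> may have eigenvalues of both signs, for which its iterates need not settle; this
  is why \<open>K\<close> is squared. A kernel depending on \<open>- x + y\<close> only makes
  \<open>K\<close> commute with left translations, so that its eigenspaces carry
  representations.\<close>

lemma mat_trace_comm:
  assumes "A \<in> carrier_mat n m" "B \<in> carrier_mat m n"
  shows "mat_trace (A * B) = mat_trace (B * A)"
proof -
  have "mat_trace (A * B) = (\<Sum>i<n. \<Sum>j<m. A $$ (i, j) * B $$ (j, i))"
    using assms by (simp add: mat_trace_def scalar_prod_def atLeast0LessThan)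
  also have "\<dots> = (\<Sum>j<m. \<Sum>i<n. B $$ (j, i) * A $$ (i, j))"
    by (subst sum.swap) (simp add: mult.commute)
  also have "\<dots> = mat_trace (B * A)"
    using assms by (simp add: mat_trace_def scalar_prod_def atLeast0LessThan)
  finally show ?thesis .
qed

lemma mat_trace_add:
  assumes "A \<in> carrier_mat n n" "B \<in> carrier_mat n n"
  shows "mat_trace (A + B) = mat_trace A + mat_trace B"
  using assms by (simp add: mat_trace_def sum.distrib)

lemma mat_trace_minus:
  assumes "A \<in> carrier_mat n n" "B \<in> carrier_mat n n"
  shows "mat_trace (A - B) = mat_trace A - mat_trace B"
  using assms by (simp add: mat_trace_def sum_subtractf)

lemma mat_trace_smult: "A \<in> carrier_mat n n \<Longrightarrow> mat_trace (c \<cdot>\<^sub>m A) = c * mat_trace A"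
  by (simp add: mat_trace_def sum_distrib_left)

lemma mat_trace_zero [simp]: "mat_trace (0\<^sub>m n n) = 0"
  by (simp add: mat_trace_def)

lemma mat_trace_adjoint: "A \<in> carrier_mat n n \<Longrightarrow> mat_trace (mat_adjoint A) = cnj (mat_trace A)"
  by (auto simp add: mat_trace_def mat_adjoint_index)

lemma mat_adjoint_carrier [simp]: "mat_adjoint A \<in> carrier_mat n m \<longleftrightarrow> A \<in> carrier_mat m n"
  by (metis carrier_matD carrier_matI dim_mat_adjoint)

lemma mat_adjoint_minus:
  assumes "A \<in> carrier_mat n m" "B \<in> carrier_mat n m"
  shows "mat_adjoint (A - B) = mat_adjoint A - mat_adjoint (B :: complex mat)"
  by (rule eq_matI) (use assms in \<open>auto simp: mat_adjoint_index\<close>)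

lemma mat_adjoint_smult: "mat_adjoint (c \<cdot>\<^sub>m A) = cnj c \<cdot>\<^sub>m mat_adjoint A"
  by (rule eq_matI) (auto simp: mat_adjoint_index)

lemma mat_adjoint_one [simp]: "mat_adjoint (1\<^sub>m n :: complex mat) = 1\<^sub>m n"
  by (rule eq_matI) (auto simp: mat_adjoint_index)

lemma mat_adjoint_mult':
  fixes A B :: "complex mat"
  assumes "A \<in> carrier_mat n m" "B \<in> carrier_mat m k"
  shows "mat_adjoint (A * B) = mat_adjoint B * mat_adjoint A"
  using assms by (intro mat_adjoint_mult) auto

section \<open>The Frobenius inner product\<close>

definition frob_ip :: "complex mat \<Rightarrow> complex mat \<Rightarrow> complex" where
  "frob_ip A B = mat_trace (A * mat_adjoint B)"

text \<open>The entrywise form makes nonnegativity and definiteness immediate;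
  \<open>frob_ip_self\<close> links it to the trace form, in which the algebra is done.\<close>

definition frob_sq :: "complex mat \<Rightarrow> real" where
  "frob_sq A = (\<Sum>i<dim_row A. \<Sum>j<dim_col A. (cmod (A $$ (i, j)))\<^sup>2)"

lemma frob_ip_self: "frob_ip A A = of_real (frob_sq A)"
proof -
  have "frob_ip A A = (\<Sum>i<dim_row A. \<Sum>j<dim_col A. A $$ (i, j) * cnj (A $$ (i, j)))"
    by (simp add: frob_ip_def mat_trace_def scalar_prod_def atLeast0LessThan mat_adjoint_index)
  also have "\<dots> = of_real (frob_sq A)"
    by (simp only: complex_norm_square[symmetric] frob_sq_def of_real_sum of_real_power)
  finally show ?thesis .
qed

lemma frob_sq_nonneg [simp]: "0 \<le> frob_sq A"
  by (simp add: frob_sq_def sum_nonneg)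

lemma frob_sq_eq_0D:
  assumes "frob_sq A = 0" "A \<in> carrier_mat n m" shows "A = 0\<^sub>m n m"
proof (rule eq_matI)
  fix i j assume "i < dim_row (0\<^sub>m n m)" "j < dim_col (0\<^sub>m n m)"
  moreover have "\<forall>i\<in>{..<dim_row A}. (\<Sum>j<dim_col A. (cmod (A $$ (i, j)))\<^sup>2) = 0"
    using assms(1) unfolding frob_sq_def by (subst (asm) sum_nonneg_eq_0_iff) (auto intro: sum_nonneg)
  then have "\<forall>i\<in>{..<dim_row A}. \<forall>j\<in>{..<dim_col A}. (cmod (A $$ (i, j)))\<^sup>2 = 0"
    by (subst (asm) sum_nonneg_eq_0_iff) auto
  ultimately show "A $$ (i, j) = 0\<^sub>m n m $$ (i, j)" using assms(2) by auto
qed (use assms in auto)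

lemma frob_ip_cnj:
  assumes "A \<in> carrier_mat n n" "B \<in> carrier_mat n n"
  shows "frob_ip B A = cnj (frob_ip A B)"
proof -
  have "mat_adjoint (A * mat_adjoint B) = B * mat_adjoint A"
    using assms by (simp add: mat_adjoint_mult'[of _ n n _ n] mat_adjoint_mat_adjoint)
  then show ?thesis
    using assms mat_trace_adjoint[of "A * mat_adjoint B" n] by (simp add: frob_ip_def)
qed

lemma frob_sq_minus:
  assumes A: "A \<in> carrier_mat n n" and B: "B \<in> carrier_mat n n"
  shows "frob_sq (A - B) = frob_sq A - 2 * Re (frob_ip A B) + frob_sq B"
proof -
  have "complex_of_real (frob_sq (A - B)) = frob_ip (A - B) (A - B)"
    by (simp add: frob_ip_self)
  also have "\<dots> = frob_ip A A - frob_ip A B - (frob_ip B A - frob_ip B B)"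
  proof -
    have "(A - B) * mat_adjoint (A - B) =
        A * mat_adjoint A - A * mat_adjoint B - (B * mat_adjoint A - B * mat_adjoint B)"
      using A B minus_carrier_mat[of "mat_adjoint B" n n "mat_adjoint A"]
      by (simp add: mat_adjoint_minus[of _ n n] minus_mult_distrib_mat[of A n n B _ n]
        mult_minus_distrib_mat[of _ n n _ n])
    then show ?thesis
      using A B minus_carrier_mat[of "A * mat_adjoint B" n n] minus_carrier_mat[of "B * mat_adjoint B" n n]
      by (simp add: frob_ip_def mat_trace_minus[of _ n])
  qed
  also have "\<dots> = of_real (frob_sq A - 2 * Re (frob_ip A B) + frob_sq B)"
    by (simp add: frob_ip_cnj[OF A B] frob_ip_self complex_eq_iff)
  finally show ?thesis by (simp only: of_real_eq_iff)
qed

lemma frob_sq_smult: "frob_sq (c \<cdot>\<^sub>m A) = (cmod c)\<^sup>2 * frob_sq A"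
  by (simp add: frob_sq_def sum_distrib_left norm_mult power_mult_distrib)

lemma frob_sq_unitary:
  assumes U: "unitary_mat n U" and A: "A \<in> carrier_mat n n"
  shows "frob_sq (U * A) = frob_sq A"
proof -
  have c: "U \<in> carrier_mat n n" "mat_adjoint U * U = 1\<^sub>m n" using U by (auto simp: unitary_mat_def)
  have "complex_of_real (frob_sq (U * A)) = mat_trace (U * A * (mat_adjoint A * mat_adjoint U))"
    using c A by (simp add: frob_ip_self[symmetric] frob_ip_def mat_adjoint_mult'[of _ n n _ n])
  also have "\<dots> = mat_trace (mat_adjoint A * mat_adjoint U * (U * A))"
    by (rule mat_trace_comm[of _ n n]) (use A c in auto)
  also have "mat_adjoint A * mat_adjoint U * (U * A) = mat_adjoint A * (mat_adjoint U * U) * A"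
    using A c(1) by (simp add: assoc_mult_mat[of _ n n _ n _ n])
  also have "mat_trace \<dots> = mat_trace (A * mat_adjoint A)"
    unfolding c(2) using A by (subst mat_trace_comm[of _ n n]) auto
  finally show ?thesis
    using frob_ip_self[of A] by (simp add: frob_ip_def)
qed

text \<open>Every \<open>P - t M\<close> with \<open>P M = 0\<close> is mapped to \<open>P\<close>,
  so contractivity makes \<open>P\<close> the shortest matrix on this line. The first-order term in
  \<open>t\<close> must vanish: \<open>P\<close> is Frobenius orthogonal to \<open>M\<close>. A
  suitable \<open>M\<close> turns this into \<open>P' (1 - P) = 0\<close> for the adjoint
  \<open>P'\<close>, whence \<open>P' = P' P\<close> is self-adjoint.\<close>

lemma contractive_idempotent_orthogonal_projection:
  assumes P: "P \<in> carrier_mat n n" and idem: "P * P = P"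
    and contr: "\<And>V. V \<in> carrier_mat n n \<Longrightarrow> frob_sq (P * V) \<le> frob_sq V"
  shows "orthogonal_projection_mat P"
proof -
  define Q where "Q = 1\<^sub>m n - P"
  define Z where "Z = mat_adjoint P * Q"
  \<comment> \<open>The factor \<open>Q\<close> puts the range of \<open>M\<close> into the kernel
    of \<open>P\<close>; the factor \<open>mat_adjoint Z\<close> makes the inner product of
    \<open>P\<close> and \<open>M\<close> equal to the squared norm of \<open>Z\<close>, the defect
    to be shown zero.\<close>
  define M where "M = Q * mat_adjoint Z"
  have c: "Q \<in> carrier_mat n n" "Z \<in> carrier_mat n n" "M \<in> carrier_mat n n"
    using P by (auto simp: Q_def Z_def M_def)
  have PQ: "P * Q = 0\<^sub>m n n"
    using P by (simp add: Q_def mult_minus_distrib_mat[of _ n n _ n] idem)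
  have PM: "P * M = 0\<^sub>m n n"
    unfolding M_def using P c by (simp add: assoc_mult_mat[of _ n n _ n _ n, symmetric] PQ)
  have ip: "frob_ip P M = of_real (frob_sq Z)"
  proof -
    have "frob_ip P M = mat_trace (P * (Z * mat_adjoint Q))"
      unfolding frob_ip_def M_def using P c
      by (simp add: mat_adjoint_mult'[of _ n n _ n] mat_adjoint_mat_adjoint)
    also have "\<dots> = mat_trace (Z * mat_adjoint Q * P)"
      by (rule mat_trace_comm[of _ n n]) (use P c in auto)
    also have "Z * mat_adjoint Q * P = Z * mat_adjoint Z"
      using P c by (simp add: Z_def mat_adjoint_mult'[of _ n n _ n] mat_adjoint_mat_adjoint
          assoc_mult_mat[of _ n n _ n _ n])
    finally show ?thesis by (simp add: frob_ip_self[symmetric] frob_ip_def)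
  qed
  have le: "2 * frob_sq Z \<le> t * frob_sq M" if t: "t > 0" for t :: real
  proof -
    let ?tM = "complex_of_real t \<cdot>\<^sub>m M"
    have tM: "?tM \<in> carrier_mat n n" using c by simp
    have "P * (P - ?tM) = P"
      using P c by (simp add: mult_minus_distrib_mat[of _ n n _ n] idem mult_smult_distrib[of _ n n _ n] PM)
        (auto intro!: eq_matI)
    then have "frob_sq P \<le> frob_sq (P - ?tM)"
      using contr[of "P - ?tM"] minus_carrier_mat[OF tM, of P] by simp
    also have "\<dots> = frob_sq P - 2 * Re (frob_ip P ?tM) + frob_sq ?tM"
      by (rule frob_sq_minus[OF P tM])
    also have "frob_ip P ?tM = of_real t * frob_ip P M"
      unfolding frob_ip_def using P c
      by (simp add: mat_adjoint_smult mult_smult_distrib[of _ n n _ n] mat_trace_smult[of _ n])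
    finally have "2 * t * frob_sq Z \<le> t\<^sup>2 * frob_sq M"
      by (simp add: ip frob_sq_smult)
    then have "t * (2 * frob_sq Z) \<le> t * (t * frob_sq M)" by (simp add: power2_eq_square algebra_simps)
    then show ?thesis using t by simp
  qed
  have "frob_sq Z = 0"
  proof (rule ccontr)
    assume "frob_sq Z \<noteq> 0"
    then have pos: "frob_sq Z > 0" using frob_sq_nonneg[of Z] by linarith
    \<comment> \<open>This value of \<open>t\<close> contradicts \<open>le\<close>; the summand 1
      keeps the denominator positive when \<open>M\<close> vanishes.\<close>
    have "frob_sq Z / (1 + frob_sq M) * frob_sq M \<le> frob_sq Z"
      using pos frob_sq_nonneg[of M] by (simp add: divide_le_eq algebra_simps add_pos_nonneg)
    moreover have "frob_sq Z / (1 + frob_sq M) > 0"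
      using pos frob_sq_nonneg[of M] by (intro divide_pos_pos) linarith+
    ultimately show False using le[of "frob_sq Z / (1 + frob_sq M)"] pos by linarith
  qed
  then have "Z = 0\<^sub>m n n" using c by (intro frob_sq_eq_0D)
  then have eq: "mat_adjoint P - mat_adjoint P * P = 0\<^sub>m n n"
    using P by (simp add: Z_def Q_def mult_minus_distrib_mat[of _ n n _ n])
  have "mat_adjoint P = mat_adjoint P * P"
  proof (rule eq_matI)
    fix i j assume ij: "i < dim_row (mat_adjoint P * P)" "j < dim_col (mat_adjoint P * P)"
    have "(mat_adjoint P - mat_adjoint P * P) $$ (i, j) = 0" using ij P unfolding eq by simp
    then show "mat_adjoint P $$ (i, j) = (mat_adjoint P * P) $$ (i, j)" using ij P by simp
  qed (use P in auto)
  moreover have "mat_adjoint (mat_adjoint P * P) = mat_adjoint P * P"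
    using P by (simp add: mat_adjoint_mult'[of _ n n _ n] mat_adjoint_mat_adjoint)
  ultimately have "mat_adjoint P = P" by (metis mat_adjoint_mat_adjoint)
  then show ?thesis using P idem by (auto simp: orthogonal_projection_mat_def)
qed

section \<open>Generalized and Moore-Penrose inverses\<close>

lemma moore_penrose_inverse_unique:
  assumes A: "A \<in> carrier_mat n n"
    and X: "is_moore_penrose_inverse A X" and Y: "is_moore_penrose_inverse A Y"
  shows "X = Y"
proof -
  have c: "X \<in> carrier_mat n n" "Y \<in> carrier_mat n n"
    using A X Y by (auto simp: is_moore_penrose_inverse_def)
  have x: "A * X * A = A" "X * A * X = X" "mat_adjoint (A * X) = A * X" "mat_adjoint (X * A) = X * A"
    and y: "A * Y * A = A" "Y * A * Y = Y" "mat_adjoint (A * Y) = A * Y" "mat_adjoint (Y * A) = Y * A"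
    using X Y by (auto simp: is_moore_penrose_inverse_def orthogonal_projection_mat_def)
  have m: "A * X \<in> carrier_mat n n" "A * Y \<in> carrier_mat n n" "X * A \<in> carrier_mat n n" "Y * A \<in> carrier_mat n n"
    using A c by auto
  \<comment> \<open>\<open>A X\<close> and \<open>A Y\<close> are orthogonal projections with the
    same range. Taking adjoints in \<open>A X = (A Y) (A X)\<close> swaps the two factors, and
    \<open>A X A = A\<close> then collapses the product to \<open>A Y\<close>.\<close>
  have "A * X = A * Y * A * X" unfolding y ..
  also have "\<dots> = A * Y * (A * X)" by (rule assoc_mult_mat[OF m(2) A c(1)])
  finally have "mat_adjoint (A * X) = mat_adjoint (A * Y * (A * X))" by (rule arg_cong)
  also have "\<dots> = A * X * (A * Y)" unfolding mat_adjoint_mult'[OF m(2,1)] x y ..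
  also have "\<dots> = A * X * A * Y" by (rule assoc_mult_mat[OF m(1) A c(2), symmetric])
  also have "\<dots> = A * Y" unfolding x ..
  finally have 1: "A * X = A * Y" unfolding x .
  have "X * A = X * (A * Y * A)" unfolding y ..
  also have "\<dots> = X * A * (Y * A)"
    unfolding assoc_mult_mat[OF A c(2) A] by (rule assoc_mult_mat[OF c(1) A m(4), symmetric])
  finally have "mat_adjoint (X * A) = mat_adjoint (X * A * (Y * A))" by (rule arg_cong)
  also have "\<dots> = Y * A * (X * A)" unfolding mat_adjoint_mult'[OF m(3,4)] x y ..
  also have "\<dots> = Y * (A * X * A)"
    unfolding assoc_mult_mat[OF A c(1) A] by (rule assoc_mult_mat[OF c(2) A m(3)])
  also have "\<dots> = Y * A" unfolding x ..
  finally have 2: "X * A = Y * A" unfolding x .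
  have "X = Y * A * X" unfolding 2[symmetric] x ..
  also have "\<dots> = Y * (A * Y)" unfolding assoc_mult_mat[OF c(2) A c(1)] 1 ..
  also have "\<dots> = Y" unfolding assoc_mult_mat[OF c(2) A c(2), symmetric] y ..
  finally show ?thesis .
qed

lemma moore_penrose_inverse_eq:
  assumes "A \<in> carrier_mat n n" "is_moore_penrose_inverse A X"
  shows "moore_penrose_inverse A = X"
  unfolding moore_penrose_inverse_def
  by (rule the_equality) (use assms moore_penrose_inverse_unique in blast)+

text \<open>A linear map has a linear right inverse on its range, and its values at the unit vectors
  are the columns of \<open>G\<close>. To have a vector space that is a whole type, \<open>A\<close>
  acts on all sequences: it reads the first \<open>m\<close> entries and returns 0 from index
  \<open>n\<close> on.\<close>

lemma ex_generalized_inverse: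
  fixes A :: "'a::field mat"
  assumes A: "A \<in> carrier_mat n m"
  obtains G where "G \<in> carrier_mat m n" "A * G * A = A"
proof -
  have sum_apply: "(\<Sum>l<n. h l) i = (\<Sum>l<n. h l i)" for n i and h :: "nat \<Rightarrow> nat \<Rightarrow> 'a"
    by (induction n) auto
  define s where "s c f i = c * f i" for c :: 'a and f :: "nat \<Rightarrow> 'a" and i
  define \<delta> where "\<delta> j i = (if i = j then 1 else 0 :: 'a)" for j i :: nat
  interpret vector_space s by unfold_locales (auto simp: s_def fun_eq_iff algebra_simps)
  interpret vector_space_pair s s ..
  define f where "f v i = (if i < n then \<Sum>j<m. A $$ (i, j) * v j else 0)" for v i
  have "Vector_Spaces.linear s s f"
    by unfold_locales
      (auto simp: f_def s_def fun_eq_iff algebra_simps sum.distrib sum_distrib_left intro!: sum.cong)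
  from linear_exists_right_inverse_on[OF this subspace_UNIV]
  obtain g where g: "Vector_Spaces.linear s s g" "\<And>v. f (g (f v)) = f v" by auto
  define G where "G = mat m n (\<lambda>(i, j). g (\<delta> j) i)"
  have G: "G \<in> carrier_mat m n" by (simp add: G_def)
  have "A * G * A = A"
  proof (rule eq_matI)
    fix i k assume "i < dim_row A" "k < dim_col A"
    then have ik: "i < n" "k < m" using A by auto
    have "f (\<delta> k) = (\<lambda>i. if i < n then A $$ (i, k) else 0)"
      using ik by (auto simp: f_def \<delta>_def fun_eq_iff if_distrib cong: if_cong)
    also have "\<dots> = (\<Sum>l<n. s (A $$ (l, k)) (\<delta> l))"
      by (auto simp: fun_eq_iff sum_apply s_def \<delta>_def if_distrib cong: if_cong)
    finally have *: "f (\<delta> k) = (\<Sum>l<n. s (A $$ (l, k)) (\<delta> l))" .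
    have "g (f (\<delta> k)) j = (\<Sum>l<n. A $$ (l, k) * g (\<delta> l) j)" for j
      unfolding * linear_sum[OF g(1)] linear_scale[OF g(1)] sum_apply by (simp add: s_def)
    then have "f (g (f (\<delta> k))) i = (\<Sum>j<m. A $$ (i, j) * (\<Sum>l<n. A $$ (l, k) * g (\<delta> l) j))"
      using ik by (simp add: f_def)
    also have "\<dots> = (\<Sum>l<n. (\<Sum>j<m. A $$ (i, j) * g (\<delta> l) j) * A $$ (l, k))"
      unfolding sum_distrib_left sum_distrib_right by (subst sum.swap) (simp add: mult_ac)
    also have "\<dots> = (A * G * A) $$ (i, k)"
      using ik A by (simp add: G_def scalar_prod_def atLeast0LessThan)
    also have "f (g (f (\<delta> k))) i = A $$ (i, k)"
      unfolding g(2) using ik by (simp add: f_def \<delta>_def if_distrib cong: if_cong)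
    finally show "(A * G * A) $$ (i, k) = A $$ (i, k)" ..
  qed (use A in auto)
  with G show thesis using that by blast
qed

text \<open>The adjoint of \<open>A\<close> is injective on the range of \<open>A\<close>, so one
  adjoint factor can be cancelled in the hypothesis; this is \<open>A E = 0\<close> below and
  amounts to \<open>P A = A\<close>. As the adjoint of \<open>P\<close> also starts with the factor
  \<open>A\<close>, multiplying it by \<open>P\<close> changes nothing, which forces
  \<open>P\<close> to be self-adjoint although \<open>G\<close> need not be.\<close>

lemma range_projection_generalized_inverse:
  fixes A G :: "complex mat"
  assumes A: "A \<in> carrier_mat n n" and G: "G \<in> carrier_mat n n"
    and eq: "mat_adjoint A * A * G * (mat_adjoint A * A) = mat_adjoint A * A"
  defines "P \<equiv> A * G * mat_adjoint A"
  shows "P * A = A" "orthogonal_projection_mat P"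
proof -
  note assoc = assoc_mult_mat[of _ n n _ n _ n]
  let ?A = "mat_adjoint A"
  have P: "P \<in> carrier_mat n n" and A': "?A \<in> carrier_mat n n" using A G by (auto simp: P_def)
  define E where "E = G * (?A * A) - 1\<^sub>m n"
  have E: "E \<in> carrier_mat n n" using A G by (auto simp: E_def)
  have "?A * (A * E) = ?A * A * G * (?A * A) - ?A * A"
    using A G A' by (simp add: E_def mult_minus_distrib_mat[of _ n n _ n] assoc)
  also have "\<dots> = 0\<^sub>m n n" unfolding eq using A by auto
  finally have "mat_adjoint E * (?A * (A * E)) = 0\<^sub>m n n" using E by simp
  then have "mat_adjoint (A * E) * (A * E) = 0\<^sub>m n n"
    using A A' E by (simp add: mat_adjoint_mult'[of _ n n _ n] assoc)
  then have "mat_trace (A * E * mat_adjoint (A * E)) = 0"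
    using A E by (subst mat_trace_comm[of _ n n]) auto
  then have "complex_of_real (frob_sq (A * E)) = 0"
    unfolding frob_ip_self[symmetric] frob_ip_def .
  then have "A * E = 0\<^sub>m n n" using A E by (intro frob_sq_eq_0D) auto
  then have 0: "P * A - A = 0\<^sub>m n n"
    using A A' G by (simp add: E_def P_def mult_minus_distrib_mat[of _ n n _ n] assoc)
  show PA: "P * A = A"
  proof (rule eq_matI)
    fix i j assume ij: "i < dim_row A" "j < dim_col A"
    have "(P * A - A) $$ (i, j) = 0" unfolding 0 using ij A by simp
    then show "(P * A) $$ (i, j) = A $$ (i, j)" using ij P A by simp
  qed (use A P in auto)
  have P': "mat_adjoint P = A * (mat_adjoint G * ?A)"
    unfolding P_def using A A' G by (simp add: mat_adjoint_mult'[of _ n n _ n] mat_adjoint_mat_adjoint)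
  have "P * mat_adjoint P = P * A * (mat_adjoint G * ?A)"
    unfolding P' using P A A' G by (intro assoc[symmetric]) auto
  then have 1: "P * mat_adjoint P = mat_adjoint P" unfolding PA P' .
  have "mat_adjoint (P * mat_adjoint P) = P * mat_adjoint P"
    using P by (simp add: mat_adjoint_mult'[of _ n n _ n] mat_adjoint_mat_adjoint)
  then have "mat_adjoint P = P" using 1 by (metis mat_adjoint_mat_adjoint)
  with 1 P show "orthogonal_projection_mat P" by (auto simp: orthogonal_projection_mat_def)
qed

text \<open>\<open>P\<close> and \<open>Q\<close> project onto the ranges of \<open>A\<close> and of
  its adjoint \<open>A'\<close>, and the inverse is \<open>A' K A G A'\<close>. Read as
  \<open>Q\<close> times \<open>G A'\<close> it gives \<open>A X = P\<close>; read as
  \<open>A' K\<close> times \<open>P\<close> it gives \<open>X A = Q\<close>. The defining equations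
  then follow from the two projections.\<close>

lemma ex_moore_penrose_inverse:
  assumes A: "A \<in> carrier_mat n n"
  obtains X where "is_moore_penrose_inverse A X"
proof -
  note assoc = assoc_mult_mat[of _ n n _ n _ n]
  let ?A = "mat_adjoint A"
  have A': "?A \<in> carrier_mat n n" using A by simp
  obtain G where G: "G \<in> carrier_mat n n" "?A * A * G * (?A * A) = ?A * A"
    using ex_generalized_inverse[of "?A * A" n n] A A' by (metis mult_carrier_mat)
  obtain K where K: "K \<in> carrier_mat n n" "A * ?A * K * (A * ?A) = A * ?A"
    using ex_generalized_inverse[of "A * ?A" n n] A A' by (metis mult_carrier_mat)
  define P where "P = A * G * ?A"
  define Q where "Q = ?A * K * A"
  have PQ: "P \<in> carrier_mat n n" "Q \<in> carrier_mat n n" using A G K by (auto simp: P_def Q_def)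
  have P: "P * A = A" "orthogonal_projection_mat P"
    using range_projection_generalized_inverse[OF A G] by (simp_all add: P_def)
  have Q: "Q * ?A = ?A" "orthogonal_projection_mat Q"
    using range_projection_generalized_inverse[OF A' K(1)] K(2)
    by (simp_all add: Q_def mat_adjoint_mat_adjoint)
  have "A * Q = A"
    using arg_cong[OF Q(1), of mat_adjoint] Q(2) PQ A' A
    by (simp add: mat_adjoint_mult'[of _ n n _ n] mat_adjoint_mat_adjoint orthogonal_projection_mat_def)
  define X where "X = Q * (G * ?A)"
  have X: "X \<in> carrier_mat n n" using PQ G A by (auto simp: X_def)
  have "X = ?A * K * (A * G * ?A)"
    unfolding X_def Q_def using A A' G K by (simp add: assoc)
  then have X2: "X = ?A * K * P" by (simp add: P_def)
  have AX: "A * X = P"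
  proof -
    have "A * X = A * Q * (G * ?A)" unfolding X_def using A PQ G by (intro assoc[symmetric]) auto
    also have "\<dots> = P" unfolding \<open>A * Q = A\<close> P_def using A G by (intro assoc[symmetric]) auto
    finally show ?thesis .
  qed
  have XA: "X * A = Q"
  proof -
    have "X * A = ?A * K * (P * A)" unfolding X2 using A PQ K by (intro assoc) auto
    then show ?thesis unfolding P Q_def .
  qed
  have "Q * X = Q * Q * (G * ?A)" unfolding X_def using A PQ G by (intro assoc[symmetric]) auto
  also have "\<dots> = X" using Q(2) by (simp add: X_def orthogonal_projection_mat_def)
  finally have "Q * X = X" .
  then have "is_moore_penrose_inverse A X"
    unfolding is_moore_penrose_inverse_def AX XA using A X P Q by auto
  then show thesis by (rule that)
qed

lemma moore_penrose_inverse_is_inverse: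
  assumes "A \<in> carrier_mat n n"
  shows "is_moore_penrose_inverse A (moore_penrose_inverse A)"
  using ex_moore_penrose_inverse[OF assms] moore_penrose_inverse_eq[OF assms] by metis

text \<open>With \<open>P = XA\<close> one has \<open>\<parallel>A\<^sup>*A - P\<parallel>\<^sup>2 = \<parallel>A\<^sup>*A\<parallel>\<^sup>2 - 2\<parallel>A\<parallel>\<^sup>2 + \<parallel>P\<parallel>\<^sup>2 \<le> 0\<close>.\<close>

lemma partial_isometry_if_contractive:
  assumes A: "A \<in> carrier_mat n n" and X: "is_moore_penrose_inverse A X"
    and contr_X: "\<And>V. V \<in> carrier_mat n n \<Longrightarrow> frob_sq (X * V) \<le> frob_sq V"
    and contr_A: "\<And>V. V \<in> carrier_mat n n \<Longrightarrow> frob_sq (mat_adjoint A * V) \<le> frob_sq V"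
  shows "A * mat_adjoint A * A = A"
proof -
  note assoc = assoc_mult_mat[of _ n n _ n _ n]
  let ?A = "mat_adjoint A"
  have c: "X \<in> carrier_mat n n" "?A \<in> carrier_mat n n" "?A * A \<in> carrier_mat n n" "X * A \<in> carrier_mat n n"
    using A X by (auto simp: is_moore_penrose_inverse_def)
  have AXA: "A * X * A = A" and P: "mat_adjoint (X * A) = X * A" and APA: "A * (X * A) = A"
    using X A c by (auto simp: is_moore_penrose_inverse_def orthogonal_projection_mat_def assoc)
  have "frob_ip (?A * A) (X * A) = mat_trace (?A * (A * (X * A)))"
    unfolding frob_ip_def P using A c by (simp add: assoc)
  also have "\<dots> = of_real (frob_sq A)"
    unfolding APA frob_ip_self[symmetric] frob_ip_def by (rule mat_trace_comm[OF c(2) A])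
  finally have "frob_sq (?A * A - X * A) = frob_sq (?A * A) - 2 * frob_sq A + frob_sq (X * A)"
    using frob_sq_minus[OF c(3,4)] by simp
  then have "frob_sq (?A * A - X * A) = 0"
    using contr_X[OF A] contr_A[OF A] frob_sq_nonneg[of "?A * A - X * A"] by linarith
  then have 0: "?A * A - X * A = 0\<^sub>m n n" using minus_carrier_mat[OF c(4)] frob_sq_eq_0D by blast
  have "?A * A = X * A"
  proof (rule eq_matI)
    fix i j assume ij: "i < dim_row (X * A)" "j < dim_col (X * A)"
    have "(?A * A - X * A) $$ (i, j) = 0" unfolding 0 using ij c A by simp
    then show "(?A * A) $$ (i, j) = (X * A) $$ (i, j)" using ij c(1) A by simp
  qed (use c A in auto)
  then show ?thesis using APA A c by (simp add: assoc)
qed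

section \<open>Lo-Ng positive maps on the dual\<close>

lemma lo_ng_positive_cong:
  assumes "\<And>\<pi>. \<pi> \<in> \<G> \<Longrightarrow> \<gamma> \<pi> = \<delta> \<pi>"
  shows "lo_ng_positive \<G> \<gamma> \<longleftrightarrow> lo_ng_positive \<G> \<delta>"
proof -
  have "(\<Sum>\<pi>\<in>\<Omega>. of_nat (rep_dim \<pi>) * mat_trace (\<pi> g * \<gamma> \<pi> * B \<pi>)) =
      (\<Sum>\<pi>\<in>\<Omega>. of_nat (rep_dim \<pi>) * mat_trace (\<pi> g * \<delta> \<pi> * B \<pi>))" if "\<Omega> \<subseteq> \<G>" for \<Omega> B g
    using that assms by (intro sum.cong) auto
  then show ?thesis
    unfolding lo_ng_positive_def compatible_def using assms by (simp cong: conj_cong)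
qed

lemma lo_ng_positiveD:
  assumes "lo_ng_positive \<G> \<gamma>" "finite \<Omega>" "\<Omega> \<subseteq> \<G>"
    and "\<And>\<pi>. \<pi> \<in> \<Omega> \<Longrightarrow> B \<pi> \<in> carrier_mat (rep_dim \<pi>) (rep_dim \<pi>)"
    and "\<And>g. (\<Sum>\<pi>\<in>\<Omega>. of_nat (rep_dim \<pi>) * mat_trace (\<pi> g * B \<pi>)) \<in> \<real>\<^sub>\<ge>\<^sub>0"
  shows "(\<Sum>\<pi>\<in>\<Omega>. of_nat (rep_dim \<pi>) * mat_trace (\<pi> g * \<gamma> \<pi> * B \<pi>)) \<in> \<real>\<^sub>\<ge>\<^sub>0"
  using assms unfolding lo_ng_positive_def by blast

lemma lo_ng_positive_carrier:
  "lo_ng_positive \<G> \<gamma> \<Longrightarrow> \<pi> \<in> \<G> \<Longrightarrow> \<gamma> \<pi> \<in> carrier_mat (rep_dim \<pi>) (rep_dim \<pi>)"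
  by (simp add: lo_ng_positive_def compatible_def)

lemma lo_ng_positiveI:
  assumes "\<And>\<pi>. \<pi> \<in> \<G> \<Longrightarrow> \<gamma> \<pi> \<in> carrier_mat (rep_dim \<pi>) (rep_dim \<pi>)"
    and "\<And>\<Omega> B g. finite \<Omega> \<Longrightarrow> \<Omega> \<subseteq> \<G> \<Longrightarrow>
      (\<And>\<pi>. \<pi> \<in> \<Omega> \<Longrightarrow> B \<pi> \<in> carrier_mat (rep_dim \<pi>) (rep_dim \<pi>)) \<Longrightarrow>
      (\<And>g. (\<Sum>\<pi>\<in>\<Omega>. of_nat (rep_dim \<pi>) * mat_trace (\<pi> g * B \<pi>)) \<in> \<real>\<^sub>\<ge>\<^sub>0) \<Longrightarrow>
      (\<Sum>\<pi>\<in>\<Omega>. of_nat (rep_dim \<pi>) * mat_trace (\<pi> g * \<gamma> \<pi> * B \<pi>)) \<in> \<real>\<^sub>\<ge>\<^sub>0"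
  shows "lo_ng_positive \<G> \<gamma>"
  unfolding lo_ng_positive_def compatible_def using assms by blast

text \<open>Positivity of \<open>\<delta>\<close> turns admissible coefficients \<open>B\<close>
  into admissible coefficients \<open>\<delta> B\<close>, to which positivity of
  \<open>\<gamma>\<close> then applies.\<close>

lemma lo_ng_positive_mult:
  assumes G: "\<And>\<pi>. \<pi> \<in> \<G> \<Longrightarrow> unitary_rep \<pi>"
    and \<gamma>: "lo_ng_positive \<G> \<gamma>" and \<delta>: "lo_ng_positive \<G> \<delta>"
  shows "lo_ng_positive \<G> (\<lambda>\<pi>. \<gamma> \<pi> * \<delta> \<pi>)"
proof (rule lo_ng_positiveI)
  note c = lo_ng_positive_carrier[OF \<gamma>] lo_ng_positive_carrier[OF \<delta>]
  show "\<gamma> \<pi> * \<delta> \<pi> \<in> carrier_mat (rep_dim \<pi>) (rep_dim \<pi>)" if "\<pi> \<in> \<G>" for \<pi>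
    by (rule mult_carrier_mat) (rule c that)+
  fix \<Omega> B and g :: 'a
  assume \<Omega>: "finite \<Omega>" "\<Omega> \<subseteq> \<G>"
    and B: "\<And>\<pi>. \<pi> \<in> \<Omega> \<Longrightarrow> B \<pi> \<in> carrier_mat (rep_dim \<pi>) (rep_dim \<pi>)"
    and pos: "\<And>g. (\<Sum>\<pi>\<in>\<Omega>. of_nat (rep_dim \<pi>) * mat_trace (\<pi> g * B \<pi>)) \<in> \<real>\<^sub>\<ge>\<^sub>0"
  have assoc: "X \<pi> * \<delta> \<pi> * B \<pi> = X \<pi> * (\<delta> \<pi> * B \<pi>)"
    if "\<pi> \<in> \<Omega>" "X \<pi> \<in> carrier_mat (rep_dim \<pi>) (rep_dim \<pi>)" for \<pi> X
    by (rule assoc_mult_mat) (use that c(2) B \<Omega> in blast)+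
  have \<pi>c: "\<pi> g \<in> carrier_mat (rep_dim \<pi>) (rep_dim \<pi>)" if "\<pi> \<in> \<Omega>" for \<pi> g
    using that \<Omega> unitary_rep_carrier[OF G] by blast
  have eq1: "(\<Sum>\<pi>\<in>\<Omega>. of_nat (rep_dim \<pi>) * mat_trace (\<pi> g * (\<delta> \<pi> * B \<pi>))) =
      (\<Sum>\<pi>\<in>\<Omega>. of_nat (rep_dim \<pi>) * mat_trace (\<pi> g * \<delta> \<pi> * B \<pi>))" for g
  proof (rule sum.cong[OF refl])
    fix \<pi> assume "\<pi> \<in> \<Omega>"
    show "of_nat (rep_dim \<pi>) * mat_trace (\<pi> g * (\<delta> \<pi> * B \<pi>)) =
      of_nat (rep_dim \<pi>) * mat_trace (\<pi> g * \<delta> \<pi> * B \<pi>)"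
      using assoc[OF \<open>\<pi> \<in> \<Omega>\<close>, of "\<lambda>\<pi>. \<pi> g"] \<pi>c[OF \<open>\<pi> \<in> \<Omega>\<close>, of g] by simp
  qed
  have eq2: "(\<Sum>\<pi>\<in>\<Omega>. of_nat (rep_dim \<pi>) * mat_trace (\<pi> g * (\<gamma> \<pi> * \<delta> \<pi>) * B \<pi>)) =
        (\<Sum>\<pi>\<in>\<Omega>. of_nat (rep_dim \<pi>) * mat_trace (\<pi> g * \<gamma> \<pi> * (\<delta> \<pi> * B \<pi>)))"
  proof (rule sum.cong[OF refl])
    fix \<pi> assume \<pi>: "\<pi> \<in> \<Omega>"
    then have "\<pi> \<in> \<G>" using \<Omega> by blast
    have "\<pi> g * (\<gamma> \<pi> * \<delta> \<pi>) = \<pi> g * \<gamma> \<pi> * \<delta> \<pi>"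
      by (rule assoc_mult_mat[OF \<pi>c[OF \<pi>] c[OF \<open>\<pi> \<in> \<G>\<close>], symmetric])
    moreover have "\<pi> g * \<gamma> \<pi> \<in> carrier_mat (rep_dim \<pi>) (rep_dim \<pi>)"
      by (rule mult_carrier_mat[OF \<pi>c[OF \<pi>] c(1)[OF \<open>\<pi> \<in> \<G>\<close>]])
    ultimately show "of_nat (rep_dim \<pi>) * mat_trace (\<pi> g * (\<gamma> \<pi> * \<delta> \<pi>) * B \<pi>) =
        of_nat (rep_dim \<pi>) * mat_trace (\<pi> g * \<gamma> \<pi> * (\<delta> \<pi> * B \<pi>))"
      using assoc[OF \<pi>, of "\<lambda>\<pi>. \<pi> g * \<gamma> \<pi>"] by simp
  qed
  show "(\<Sum>\<pi>\<in>\<Omega>. of_nat (rep_dim \<pi>) * mat_trace (\<pi> g * (\<gamma> \<pi> * \<delta> \<pi>) * B \<pi>)) \<in> \<real>\<^sub>\<ge>\<^sub>0"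
    unfolding eq2
  proof (rule lo_ng_positiveD[OF \<gamma> \<Omega>, of "\<lambda>\<pi>. \<delta> \<pi> * B \<pi>"])
    show "\<delta> \<pi> * B \<pi> \<in> carrier_mat (rep_dim \<pi>) (rep_dim \<pi>)" if "\<pi> \<in> \<Omega>" for \<pi>
      by (rule mult_carrier_mat) (use that c(2) B \<Omega> in blast)+
    show "(\<Sum>\<pi>\<in>\<Omega>. of_nat (rep_dim \<pi>) * mat_trace (\<pi> g * (\<delta> \<pi> * B \<pi>))) \<in> \<real>\<^sub>\<ge>\<^sub>0" for g
      unfolding eq1 by (rule lo_ng_positiveD[OF \<delta> \<Omega> B pos])
  qed
qed

section \<open>Conjugate and trivial representations\<close>

lemma subspace_module_vec_iff:
  fixes W :: "complex vec set"
  shows "VectorSpace.subspace class_ring W (module_vec TYPE(complex) d) \<longleftrightarrow>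
    W \<subseteq> carrier_vec d \<and> 0\<^sub>v d \<in> W \<and> (\<forall>v\<in>W. \<forall>w\<in>W. v + w \<in> W) \<and> (\<forall>c. \<forall>v\<in>W. c \<cdot>\<^sub>v v \<in> W)"
proof
  assume "VectorSpace.subspace class_ring W (module_vec TYPE(complex) d)"
  then have "submodule class_ring W (module_vec TYPE(complex) d)"
    by (simp add: VectorSpace.subspace_def)
  from submodule.m_closed[OF this] submodule.zero_closed[OF this] submodule.smult_closed[OF this]
    submodule.subset[OF this]
  show "W \<subseteq> carrier_vec d \<and> 0\<^sub>v d \<in> W \<and> (\<forall>v\<in>W. \<forall>w\<in>W. v + w \<in> W) \<and> (\<forall>c. \<forall>v\<in>W. c \<cdot>\<^sub>v v \<in> W)"
    by (auto simp: module_vec_simps class_ring_simps)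
next
  have "vectorspace class_ring (module_vec TYPE(complex) d)" by (rule vec_vs)
  moreover from this have "module class_ring (module_vec TYPE(complex) d)"
    by (simp add: vectorspace_def)
  moreover assume "W \<subseteq> carrier_vec d \<and> 0\<^sub>v d \<in> W \<and> (\<forall>v\<in>W. \<forall>w\<in>W. v + w \<in> W) \<and> (\<forall>c. \<forall>v\<in>W. c \<cdot>\<^sub>v v \<in> W)"
  ultimately show "VectorSpace.subspace class_ring W (module_vec TYPE(complex) d)"
    unfolding VectorSpace.subspace_def submodule_def
    by (auto simp: module_vec_simps class_ring_simps)
qed

text \<open>Its matrix coefficients are the complex conjugates of those of \<open>\<pi>\<close>,
  which brings real parts of trigonometric polynomials within the reach of Lo-Ng positivity.\<close>

definition conj_rep :: "('g \<Rightarrow> complex mat) \<Rightarrow> 'g \<Rightarrow> complex mat" where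
  "conj_rep \<pi> g = map_mat cnj (\<pi> g)"

lemma map_mat_cnj_mult:
  assumes "A \<in> carrier_mat n m" "B \<in> carrier_mat m k"
  shows "map_mat cnj (A * B) = map_mat cnj A * map_mat cnj B"
  by (rule eq_matI) (use assms in \<open>auto simp: scalar_prod_def\<close>)

lemma map_mat_cnj_adjoint: "map_mat cnj (mat_adjoint A) = mat_adjoint (map_mat cnj A)"
  by (rule eq_matI) (auto simp: mat_adjoint_index)

lemma map_mat_cnj_one: "map_mat cnj (1\<^sub>m n) = 1\<^sub>m n"
  by (rule eq_matI) auto

lemma mat_trace_cnj: "A \<in> carrier_mat n n \<Longrightarrow> mat_trace (map_mat cnj A) = cnj (mat_trace A)"
  by (auto simp: mat_trace_def)

lemma rep_dim_conj_rep [simp]: "rep_dim (conj_rep \<pi>) = rep_dim \<pi>"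
  by (simp add: rep_dim_def conj_rep_def)

lemma unitary_rep_conj_rep:
  assumes \<pi>: "unitary_rep \<pi>" shows "unitary_rep (conj_rep \<pi>)"
proof -
  let ?d = "rep_dim \<pi>"
  have c: "\<pi> g \<in> carrier_mat ?d ?d" "mat_adjoint (\<pi> g) \<in> carrier_mat ?d ?d" for g
    using unitary_rep_carrier[OF \<pi>] by auto
  have "unitary_mat ?d (map_mat cnj (\<pi> g))" for g
  proof -
    have "unitary_mat ?d (\<pi> g)" using \<pi> by (auto simp: unitary_rep_def)
    then show ?thesis
      unfolding unitary_mat_def map_mat_cnj_adjoint[symmetric]
        map_mat_cnj_mult[OF c(1) c(2), symmetric] map_mat_cnj_mult[OF c(2) c(1), symmetric]
      by (simp add: map_mat_cnj_one)
  qed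
  moreover have "map_mat cnj (\<pi> (g + h)) = map_mat cnj (\<pi> g) * map_mat cnj (\<pi> h)" for g h
    using \<pi> map_mat_cnj_mult[OF c(1)[of g] c(1)[of h]] by (simp add: unitary_rep_def)
  moreover have "continuous_on UNIV (\<lambda>g. map_mat cnj (\<pi> g) $$ (i, j))" if "i < ?d" "j < ?d" for i j
  proof -
    have "map_mat cnj (\<pi> g) $$ (i, j) = cnj (\<pi> g $$ (i, j))" for g using c(1)[of g] that by simp
    then show ?thesis using \<pi> that by (auto simp: unitary_rep_def intro!: continuous_on_cnj)
  qed
  ultimately show ?thesis
    using \<pi> unfolding unitary_rep_def rep_dim_conj_rep
    by (simp add: conj_rep_def map_mat_cnj_one)
qed

text \<open>Entrywise conjugation of vectors sends subspaces invariant under the conjugate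
  representation to subspaces invariant under \<open>\<pi>\<close>. It is only semilinear, but a
  scalar \<open>c\<close> can be absorbed as \<open>cnj c\<close>.\<close>

lemma irreducible_conj_rep:
  assumes \<pi>: "irreducible_unitary_rep \<pi>" shows "irreducible_unitary_rep (conj_rep \<pi>)"
proof -
  let ?d = "rep_dim \<pi>"
  have u: "unitary_rep \<pi>" using \<pi> by (simp add: irreducible_unitary_rep_def)
  have "W = {0\<^sub>v ?d} \<or> W = carrier_vec ?d"
    if W: "VectorSpace.subspace class_ring W (module_vec TYPE(complex) ?d)"
      and inv: "\<And>g w. w \<in> W \<Longrightarrow> conj_rep \<pi> g *\<^sub>v w \<in> W" for W
  proof -
    have W': "W \<subseteq> carrier_vec ?d" "0\<^sub>v ?d \<in> W" "\<And>v w. v \<in> W \<Longrightarrow> w \<in> W \<Longrightarrow> v + w \<in> W"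
      "\<And>c v. v \<in> W \<Longrightarrow> c \<cdot>\<^sub>v v \<in> W"
      using W by (auto simp: subspace_module_vec_iff)
    have "VectorSpace.subspace class_ring (conjugate ` W) (module_vec TYPE(complex) ?d)"
      unfolding subspace_module_vec_iff
    proof (intro conjI ballI allI)
      show "conjugate ` W \<subseteq> carrier_vec ?d" using W'(1) by auto
      show "0\<^sub>v ?d \<in> conjugate ` W" using W'(2) by (force simp: image_iff)
      fix v assume "v \<in> conjugate ` W"
      then obtain v' where v': "v' \<in> W" "v = conjugate v'" by (blast elim: imageE)
      have "c \<cdot>\<^sub>v v = conjugate (cnj c \<cdot>\<^sub>v v')" for c
        using v' by (simp add: conjugate_smult_vec)
      then show "c \<cdot>\<^sub>v v \<in> conjugate ` W" for c
        using v' W'(4) by blast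
      fix w assume "w \<in> conjugate ` W"
      then obtain w' where w': "w' \<in> W" "w = conjugate w'" by (blast elim: imageE)
      have "v + w = conjugate (v' + w')"
        using v' w' W'(1) conjugate_add_vec[of v' ?d w'] by (simp add: subset_iff)
      then show "v + w \<in> conjugate ` W" using v' w' W'(3) by blast
    qed
    moreover have "\<pi> g *\<^sub>v w \<in> conjugate ` W" if wW: "w \<in> conjugate ` W" for g w
    proof -
      obtain w' where w': "w' \<in> W" "w = conjugate w'" using wW by (blast elim: imageE)
      have "\<pi> g *\<^sub>v conjugate w' = conjugate (conj_rep \<pi> g *\<^sub>v w')"
      proof (rule eq_vecI)
        fix i assume "i < dim_vec (conjugate (conj_rep \<pi> g *\<^sub>v w'))"
        then have i: "i < ?d" using unitary_rep_carrier[OF u, of g] by (simp add: conj_rep_def)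
        have "w' \<in> carrier_vec ?d" using w' W'(1) by auto
        then show "(\<pi> g *\<^sub>v conjugate w') $ i = conjugate (conj_rep \<pi> g *\<^sub>v w') $ i"
          using i unitary_rep_carrier[OF u, of g] by (auto simp: conj_rep_def scalar_prod_def)
      qed (simp add: conj_rep_def)
      then show ?thesis using w' inv by auto
    qed
    ultimately have alt: "conjugate ` W = {0\<^sub>v ?d} \<or> conjugate ` W = carrier_vec ?d"
      using \<pi> unfolding irreducible_unitary_rep_def by blast
    have cc: "conjugate ` conjugate ` W = W" by (simp add: image_image)
    from alt show ?thesis
    proof
      assume "conjugate ` W = {0\<^sub>v ?d}"
      then have "conjugate ` conjugate ` W = {0\<^sub>v ?d}" by simp
      then show ?thesis using cc by simp
    next
      assume eq: "conjugate ` W = carrier_vec ?d"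
      have "carrier_vec ?d \<subseteq> W"
      proof
        fix v :: "complex vec" assume "v \<in> carrier_vec ?d"
        then have "conjugate v \<in> conjugate ` W" unfolding eq by simp
        then show "v \<in> W" by (metis (no_types, lifting) conjugate_id image_iff)
      qed
      then show ?thesis using W'(1) by auto
    qed
  qed
  then show ?thesis
    using \<pi> unitary_rep_conj_rep[OF u] unfolding irreducible_unitary_rep_def rep_dim_conj_rep by blast
qed

definition trivial_rep :: "'g \<Rightarrow> complex mat" where
  "trivial_rep = (\<lambda>g. 1\<^sub>m 1)"

lemma irreducible_trivial_rep: "irreducible_unitary_rep (trivial_rep :: 'g::topological_group_add \<Rightarrow> _)"
proof -
  have "W = {0\<^sub>v 1} \<or> W = carrier_vec 1"
    if W: "VectorSpace.subspace class_ring W (module_vec TYPE(complex) 1)" for W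
  proof (cases "W = {0\<^sub>v 1}")
    case False
    have W': "W \<subseteq> carrier_vec 1" "0\<^sub>v 1 \<in> W" "\<And>c v. v \<in> W \<Longrightarrow> c \<cdot>\<^sub>v v \<in> W"
      using W by (auto simp: subspace_module_vec_iff)
    then obtain w where w: "w \<in> W" "w \<noteq> 0\<^sub>v 1" "w \<in> carrier_vec 1" using False by blast
    then have w0: "w $ 0 \<noteq> 0" by (auto simp: vec_eq_iff)
    have "v \<in> W" if "v \<in> carrier_vec 1" for v
    proof -
      have "v = (v $ 0 / w $ 0) \<cdot>\<^sub>v w"
        using that w w0 by (intro eq_vecI) auto
      then show ?thesis using W'(3)[OF w(1)] by metis
    qed
    then show ?thesis using W'(1) by auto
  qed auto
  then show ?thesis
    by (auto simp: irreducible_unitary_rep_def unitary_rep_def trivial_rep_def rep_dim_def unitary_mat_def)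
qed

text \<open>A unitary conjugate of the trivial representation is the trivial representation itself,
  so its equivalence class is a singleton and every choice of representatives contains it.\<close>

lemma trivial_rep_in_dual:
  assumes "is_unitary_dual \<G>" shows "trivial_rep \<in> \<G>"
proof -
  obtain \<tau> where \<tau>: "\<tau> \<in> \<G>" "unitarily_equivalent trivial_rep \<tau>"
    using assms irreducible_trivial_rep unfolding is_unitary_dual_def by blast
  then obtain U where U: "rep_dim \<tau> = 1" "unitary_mat 1 U" "\<And>g. U * trivial_rep g = \<tau> g * U"
    using unitarily_equivalentE[OF \<tau>(2)] by (auto simp: rep_dim_def trivial_rep_def)
  have "unitary_rep \<tau>" using \<tau>(1) assms by (auto simp: is_unitary_dual_def irreducible_unitary_rep_def)
  then have c: "\<tau> g \<in> carrier_mat 1 1" for g using unitary_rep_carrier U(1) by metis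
  have U': "U \<in> carrier_mat 1 1" "mat_adjoint U \<in> carrier_mat 1 1" "U * mat_adjoint U = 1\<^sub>m 1"
    using U by (auto simp: unitary_mat_def)
  have "\<tau> g = 1\<^sub>m 1" for g
  proof -
    have "\<tau> g = \<tau> g * (U * mat_adjoint U)" using U' c[of g] by simp
    also have "\<dots> = \<tau> g * U * mat_adjoint U" using U' c[of g] by (intro assoc_mult_mat[symmetric])
    also have "\<dots> = 1\<^sub>m 1" unfolding U(3)[symmetric] using U' by (simp add: trivial_rep_def)
    finally show ?thesis .
  qed
  then have "\<tau> = trivial_rep" by (auto simp: trivial_rep_def)
  with \<tau> show ?thesis by simp
qed

text \<open>The three representations may coincide, for instance when \<open>\<pi>\<close> is
  trivial or equivalent to its conjugate. The coefficient at \<open>\<sigma>\<close> is therefore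
  the sum of all \<open>B\<close> belonging to \<open>\<sigma>\<close>, and each sum over
  \<open>\<Omega>\<close> still splits into three terms. The conclusion is positivity at the
  unit.\<close>

lemma lo_ng_positive_three:
  assumes LN: "lo_ng_positive \<G> \<gamma>" and un: "\<And>\<sigma>. \<sigma> \<in> \<G> \<Longrightarrow> unitary_rep \<sigma>"
    and G: "\<pi>\<^sub>1 \<in> \<G>" "\<pi>\<^sub>2 \<in> \<G>" "\<pi>\<^sub>3 \<in> \<G>"
    and B: "B\<^sub>1 \<in> carrier_mat (rep_dim \<pi>\<^sub>1) (rep_dim \<pi>\<^sub>1)" "B\<^sub>2 \<in> carrier_mat (rep_dim \<pi>\<^sub>2) (rep_dim \<pi>\<^sub>2)"
      "B\<^sub>3 \<in> carrier_mat (rep_dim \<pi>\<^sub>3) (rep_dim \<pi>\<^sub>3)"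
    and pos: "\<And>g. of_nat (rep_dim \<pi>\<^sub>1) * mat_trace (\<pi>\<^sub>1 g * B\<^sub>1) + of_nat (rep_dim \<pi>\<^sub>2) * mat_trace (\<pi>\<^sub>2 g * B\<^sub>2)
      + of_nat (rep_dim \<pi>\<^sub>3) * mat_trace (\<pi>\<^sub>3 g * B\<^sub>3) \<in> \<real>\<^sub>\<ge>\<^sub>0"
  shows "of_nat (rep_dim \<pi>\<^sub>1) * mat_trace (\<gamma> \<pi>\<^sub>1 * B\<^sub>1) + of_nat (rep_dim \<pi>\<^sub>2) * mat_trace (\<gamma> \<pi>\<^sub>2 * B\<^sub>2)
      + of_nat (rep_dim \<pi>\<^sub>3) * mat_trace (\<gamma> \<pi>\<^sub>3 * B\<^sub>3) \<in> \<real>\<^sub>\<ge>\<^sub>0"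
proof -
  define \<Omega> where "\<Omega> = {\<pi>\<^sub>1, \<pi>\<^sub>2, \<pi>\<^sub>3}"
  define Z where "Z \<sigma> = (0\<^sub>m (rep_dim \<sigma>) (rep_dim \<sigma>) :: complex mat)" for \<sigma> :: "'a \<Rightarrow> complex mat"
  define B where "B \<sigma> = (if \<sigma> = \<pi>\<^sub>1 then B\<^sub>1 else Z \<sigma>) + (if \<sigma> = \<pi>\<^sub>2 then B\<^sub>2 else Z \<sigma>)
    + (if \<sigma> = \<pi>\<^sub>3 then B\<^sub>3 else Z \<sigma>)" for \<sigma>
  have Bc: "B \<sigma> \<in> carrier_mat (rep_dim \<sigma>) (rep_dim \<sigma>)" for \<sigma>
    using B by (auto simp: B_def Z_def)
  have eq: "(\<Sum>\<sigma>\<in>\<Omega>. of_nat (rep_dim \<sigma>) * mat_trace (X \<sigma> * B \<sigma>)) =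
     of_nat (rep_dim \<pi>\<^sub>1) * mat_trace (X \<pi>\<^sub>1 * B\<^sub>1) + of_nat (rep_dim \<pi>\<^sub>2) * mat_trace (X \<pi>\<^sub>2 * B\<^sub>2)
      + of_nat (rep_dim \<pi>\<^sub>3) * mat_trace (X \<pi>\<^sub>3 * B\<^sub>3)"
    if X: "\<And>\<sigma>. \<sigma> \<in> \<Omega> \<Longrightarrow> X \<sigma> \<in> carrier_mat (rep_dim \<sigma>) (rep_dim \<sigma>)" for X
  proof -
    have "of_nat (rep_dim \<sigma>) * mat_trace (X \<sigma> * B \<sigma>) =
      (if \<sigma> = \<pi>\<^sub>1 then of_nat (rep_dim \<sigma>) * mat_trace (X \<sigma> * B\<^sub>1) else 0) +
      (if \<sigma> = \<pi>\<^sub>2 then of_nat (rep_dim \<sigma>) * mat_trace (X \<sigma> * B\<^sub>2) else 0) +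
      (if \<sigma> = \<pi>\<^sub>3 then of_nat (rep_dim \<sigma>) * mat_trace (X \<sigma> * B\<^sub>3) else 0)" if "\<sigma> \<in> \<Omega>" for \<sigma>
    proof -
      let ?d = "rep_dim \<sigma>"
      have tr: "mat_trace (X \<sigma> * (C + D + E)) = mat_trace (X \<sigma> * C) + mat_trace (X \<sigma> * D) + mat_trace (X \<sigma> * E)"
        if "C \<in> carrier_mat ?d ?d" "D \<in> carrier_mat ?d ?d" "E \<in> carrier_mat ?d ?d" for C D E
        using that X[OF \<open>\<sigma> \<in> \<Omega>\<close>]
        by (simp add: mult_add_distrib_mat[of _ ?d ?d _ ?d] mat_trace_add[of _ ?d])
      have tr0: "mat_trace (X \<sigma> * Z \<sigma>) = 0" using X[OF that] by (simp add: Z_def)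
      have "of_nat ?d * mat_trace (X \<sigma> * B \<sigma>) =
        of_nat ?d * (mat_trace (X \<sigma> * (if \<sigma> = \<pi>\<^sub>1 then B\<^sub>1 else Z \<sigma>)) +
        mat_trace (X \<sigma> * (if \<sigma> = \<pi>\<^sub>2 then B\<^sub>2 else Z \<sigma>)) + mat_trace (X \<sigma> * (if \<sigma> = \<pi>\<^sub>3 then B\<^sub>3 else Z \<sigma>)))"
        unfolding B_def by (subst tr) (use B in \<open>auto simp: Z_def\<close>)
      moreover have "mat_trace (X \<sigma> * (if b then C else Z \<sigma>)) = (if b then mat_trace (X \<sigma> * C) else 0)" for b C
        by (simp add: tr0)
      ultimately show ?thesis by (simp only: distrib_left) simp
    qed
    then have "(\<Sum>\<sigma>\<in>\<Omega>. of_nat (rep_dim \<sigma>) * mat_trace (X \<sigma> * B \<sigma>)) = (\<Sum>\<sigma>\<in>\<Omega>.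
      (if \<sigma> = \<pi>\<^sub>1 then of_nat (rep_dim \<sigma>) * mat_trace (X \<sigma> * B\<^sub>1) else 0) +
      (if \<sigma> = \<pi>\<^sub>2 then of_nat (rep_dim \<sigma>) * mat_trace (X \<sigma> * B\<^sub>2) else 0) +
      (if \<sigma> = \<pi>\<^sub>3 then of_nat (rep_dim \<sigma>) * mat_trace (X \<sigma> * B\<^sub>3) else 0))"
      by (rule sum.cong[OF refl])
    then show ?thesis by (simp add: sum.distrib \<Omega>_def del: sum.insert)
  qed
  have \<Omega>: "finite \<Omega>" "\<Omega> \<subseteq> \<G>" using G by (auto simp: \<Omega>_def)
  have \<gamma>c: "\<gamma> \<sigma> \<in> carrier_mat (rep_dim \<sigma>) (rep_dim \<sigma>)" if "\<sigma> \<in> \<Omega>" for \<sigma>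
    using LN \<Omega> that by (auto simp: lo_ng_positive_def compatible_def)
  have \<pi>c: "\<sigma> g \<in> carrier_mat (rep_dim \<sigma>) (rep_dim \<sigma>)" if "\<sigma> \<in> \<Omega>" for \<sigma> g
    using un \<Omega> that unitary_rep_carrier by blast
  have "finite \<Omega> \<and> \<Omega> \<subseteq> \<G> \<and> (\<forall>\<sigma>\<in>\<Omega>. B \<sigma> \<in> carrier_mat (rep_dim \<sigma>) (rep_dim \<sigma>)) \<and>
        (\<forall>g. (\<Sum>\<sigma>\<in>\<Omega>. of_nat (rep_dim \<sigma>) * mat_trace (\<sigma> g * B \<sigma>)) \<in> \<real>\<^sub>\<ge>\<^sub>0)"
    using \<Omega> Bc pos eq[OF \<pi>c] by simp
  then have "\<forall>g. (\<Sum>\<sigma>\<in>\<Omega>. of_nat (rep_dim \<sigma>) * mat_trace (\<sigma> g * \<gamma> \<sigma> * B \<sigma>)) \<in> \<real>\<^sub>\<ge>\<^sub>0"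
    using LN unfolding lo_ng_positive_def by blast
  moreover have "\<sigma> 0 * \<gamma> \<sigma> = \<gamma> \<sigma>" if "\<sigma> \<in> \<Omega>" for \<sigma>
  proof -
    have "\<sigma> 0 = 1\<^sub>m (rep_dim \<sigma>)" using un \<Omega> that by (auto simp: unitary_rep_def)
    then show ?thesis using \<gamma>c[OF that] by simp
  qed
  ultimately have "(\<Sum>\<sigma>\<in>\<Omega>. of_nat (rep_dim \<sigma>) * mat_trace (\<gamma> \<sigma> * B \<sigma>)) \<in> \<real>\<^sub>\<ge>\<^sub>0"
    by (metis (no_types, lifting) sum.cong)
  then show ?thesis using eq[OF \<gamma>c] by simp
qed

text \<open>Expand the squared norm of \<open>U V - W\<close>, where \<open>U V\<close> is as long
  as \<open>V\<close>. The bound is uniform in \<open>U\<close>, hence valid along a whole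
  representation.\<close>

lemma Re_trace_unitary_le:
  assumes U: "unitary_mat d U" and V: "V \<in> carrier_mat d d" and W: "W \<in> carrier_mat d d"
  shows "2 * Re (mat_trace (U * (V * mat_adjoint W))) \<le> frob_sq V + frob_sq W"
proof -
  have c: "U \<in> carrier_mat d d" using U by (simp add: unitary_mat_def)
  then have "0 \<le> frob_sq (U * V) - 2 * Re (frob_ip (U * V) W) + frob_sq W"
    using frob_sq_minus[of "U * V" d W] V W frob_sq_nonneg[of "U * V - W"] by simp
  moreover have "frob_ip (U * V) W = mat_trace (U * (V * mat_adjoint W))"
    unfolding frob_ip_def using c V W by (simp add: assoc_mult_mat[of _ d d _ d _ d])
  ultimately show ?thesis using frob_sq_unitary[OF U V] by simp
qed

text \<open>For \<open>f(g) = tr(\<pi>(g)VW\<^sup>*)\<close> the function \<open>\<parallel>V\<parallel>\<^sup>2 + \<parallel>W\<parallel>\<^sup>2 - 2 Re f\<close> is a nonnegative trigonometric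
  polynomial; evaluate its image at the unit and take \<open>W = \<gamma>(\<pi>)V\<close>. That the image of \<open>Re f\<close> is
  the real part of the image of \<open>f\<close> follows from the reality of the images for \<open>V\<close> and \<open>\<i>V\<close>.\<close>

lemma lo_ng_positive_contractive:
  assumes dual: "is_unitary_dual \<G>" and LN: "lo_ng_positive \<G> \<gamma>" and \<gamma>1: "\<gamma> trivial_rep = 1\<^sub>m 1"
    and \<pi>: "\<pi> \<in> \<G>" and V: "V \<in> carrier_mat (rep_dim \<pi>) (rep_dim \<pi>)"
  shows "frob_sq (\<gamma> \<pi> * V) \<le> frob_sq V"
proof -
  define d where "d = rep_dim \<pi>"
  have un: "unitary_rep \<sigma>" if "\<sigma> \<in> \<G>" for \<sigma>
    using that dual by (auto simp: is_unitary_dual_def irreducible_unitary_rep_def)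
  have irr: "irreducible_unitary_rep \<pi>" using dual \<pi> by (auto simp: is_unitary_dual_def)
  then have d0: "d > 0" by (simp add: d_def irreducible_unitary_rep_def)
  obtain \<rho> where \<rho>: "\<rho> \<in> \<G>" "unitarily_equivalent (conj_rep \<pi>) \<rho>"
    using dual irreducible_conj_rep[OF irr] unfolding is_unitary_dual_def by blast
  obtain U where U: "rep_dim \<rho> = d" "unitary_mat d U" "\<And>g. U * conj_rep \<pi> g = \<rho> g * U"
    using unitarily_equivalentE[OF \<rho>(2)] unfolding d_def rep_dim_conj_rep by metis
  let ?U = "mat_adjoint U"
  have Uc: "U \<in> carrier_mat d d" "?U \<in> carrier_mat d d" "?U * U = 1\<^sub>m d" using U(2) by (auto simp: unitary_mat_def)
  have \<pi>c: "\<pi> g \<in> carrier_mat d d" and \<rho>c: "\<rho> g \<in> carrier_mat d d" for g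
    using unitary_rep_carrier[OF un] \<pi> \<rho>(1) U(1) d_def by metis+
  have \<pi>u: "unitary_mat d (\<pi> g)" for g using un[OF \<pi>] by (simp add: unitary_rep_def d_def)
  have \<gamma>c: "\<gamma> \<pi> \<in> carrier_mat d d" "\<gamma> \<rho> \<in> carrier_mat d d"
    using LN \<pi> \<rho>(1) U(1) d_def by (auto simp: lo_ng_positive_def compatible_def)
  note assoc = assoc_mult_mat[of _ d d _ d _ d]
  \<comment> \<open>Coefficients at \<open>\<rho>\<close> whose trace function is the conjugate of
    that of \<open>B\<close> at \<open>\<pi>\<close>. The dual contains only some representative
    \<open>\<rho>\<close> of the conjugate class, so \<open>U\<close> has to transport the
    conjugated matrix.\<close>
  define C where "C B = U * map_mat cnj B * ?U" for B
  have Cc: "C B \<in> carrier_mat d d" if "B \<in> carrier_mat d d" for B using that Uc by (auto simp: C_def)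
  have C_tr: "mat_trace (\<rho> g * C B) = cnj (mat_trace (\<pi> g * B))" if B: "B \<in> carrier_mat d d" for B g
  proof -
    have Bc: "map_mat cnj B \<in> carrier_mat d d" using B by simp
    have \<pi>g: "conj_rep \<pi> g \<in> carrier_mat d d" using \<pi>c[of g] by (simp add: conj_rep_def)
    have "\<rho> g * C B = \<rho> g * U * map_mat cnj B * ?U"
      unfolding C_def using \<rho>c[of g] Uc Bc by (simp add: assoc)
    also have "\<dots> = U * (conj_rep \<pi> g * map_mat cnj B) * ?U"
      unfolding U(3)[symmetric] using \<pi>g Uc Bc by (simp add: assoc)
    also have "conj_rep \<pi> g * map_mat cnj B = map_mat cnj (\<pi> g * B)"
      using map_mat_cnj_mult[OF \<pi>c B] by (simp add: conj_rep_def)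
    finally have "mat_trace (\<rho> g * C B) = mat_trace (U * (map_mat cnj (\<pi> g * B) * ?U))"
      using Uc \<pi>c[of g] B by (simp add: assoc)
    also have "\<dots> = mat_trace (map_mat cnj (\<pi> g * B) * ?U * U)"
      by (rule mat_trace_comm[of _ d d]) (use Uc \<pi>c[of g] B in auto)
    also have "\<dots> = cnj (mat_trace (\<pi> g * B))"
      using Uc \<pi>c[of g] B by (simp add: assoc mat_trace_cnj[of _ d])
    finally show ?thesis .
  qed
  define z where "z B = mat_trace (\<gamma> \<pi> * B)" for B
  define z' where "z' B = mat_trace (\<gamma> \<rho> * C B)" for B
  \<comment> \<open>The constant \<open>c\<close> is a coefficient at the trivial representation,
    where \<open>\<gamma>\<close> is 1, so it survives unchanged; the real part is spread over
    \<open>\<pi>\<close> and \<open>\<rho>\<close>.\<close>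
  have pos: "complex_of_real c - of_nat d * (z B + z' B) \<in> \<real>\<^sub>\<ge>\<^sub>0"
    if B: "B \<in> carrier_mat d d" and c: "\<And>g. 2 * d * Re (mat_trace (\<pi> g * B)) \<le> c" for B c
  proof -
    let ?B1 = "complex_of_real c \<cdot>\<^sub>m 1\<^sub>m 1"
    have neg: "mat_trace (X * (-1 \<cdot>\<^sub>m Y)) = - mat_trace (X * Y)"
      if "X \<in> carrier_mat d d" "Y \<in> carrier_mat d d" for X Y :: "complex mat"
      using that by (simp add: mult_smult_distrib[of _ d d _ d] mat_trace_smult[of _ d])
    have tr1: "mat_trace (1\<^sub>m 1 * ?B1) = complex_of_real c" by (simp add: mat_trace_def)
    have "of_nat (rep_dim (trivial_rep :: 'a \<Rightarrow> _)) * mat_trace (\<gamma> trivial_rep * ?B1) +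
      of_nat (rep_dim \<pi>) * mat_trace (\<gamma> \<pi> * (-1 \<cdot>\<^sub>m B)) + of_nat (rep_dim \<rho>) * mat_trace (\<gamma> \<rho> * (-1 \<cdot>\<^sub>m C B)) \<in> \<real>\<^sub>\<ge>\<^sub>0"
    proof (rule lo_ng_positive_three[OF LN un trivial_rep_in_dual[OF dual] \<pi> \<rho>(1)])
      fix g :: 'a
      have "of_nat (rep_dim (trivial_rep :: 'a \<Rightarrow> _)) * mat_trace (trivial_rep g * ?B1) +
        of_nat (rep_dim \<pi>) * mat_trace (\<pi> g * (-1 \<cdot>\<^sub>m B)) + of_nat (rep_dim \<rho>) * mat_trace (\<rho> g * (-1 \<cdot>\<^sub>m C B))
        = complex_of_real c - of_nat d * (mat_trace (\<pi> g * B) + cnj (mat_trace (\<pi> g * B)))"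
        unfolding neg[OF \<pi>c B] neg[OF \<rho>c Cc[OF B]] C_tr[OF B] U(1) d_def[symmetric]
        using tr1 by (simp add: trivial_rep_def rep_dim_def algebra_simps)
      also have "\<dots> = complex_of_real (c - 2 * d * Re (mat_trace (\<pi> g * B)))"
        by (simp add: complex_add_cnj)
      finally show "of_nat (rep_dim (trivial_rep :: 'a \<Rightarrow> _)) * mat_trace (trivial_rep g * ?B1) +
        of_nat (rep_dim \<pi>) * mat_trace (\<pi> g * (-1 \<cdot>\<^sub>m B)) + of_nat (rep_dim \<rho>) * mat_trace (\<rho> g * (-1 \<cdot>\<^sub>m C B)) \<in> \<real>\<^sub>\<ge>\<^sub>0"
        using c[of g] by (simp only:) (simp add: complex_nonneg_Reals_iff)
    qed (use B Cc U(1) in \<open>auto simp: rep_dim_def trivial_rep_def d_def\<close>)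
    then show ?thesis
      unfolding \<gamma>1 neg[OF \<gamma>c(1) B] neg[OF \<gamma>c(2) Cc[OF B]] U(1) d_def[symmetric] z_def z'_def
      using tr1 by (simp add: trivial_rep_def rep_dim_def algebra_simps)
  qed
  \<comment> \<open>Nothing relates \<open>\<gamma> \<rho>\<close> to \<open>\<gamma> \<pi>\<close>
    beforehand. But every \<open>B\<close> admits some bound \<open>c\<close>, here from comparison
    with the identity, and \<open>pos\<close> then makes the image real.\<close>
  have real: "Im (z B + z' B) = 0" if B: "B \<in> carrier_mat d d" for B
  proof -
    have "2 * d * Re (mat_trace (\<pi> g * B)) \<le> d * (frob_sq B + frob_sq (1\<^sub>m d))" for g
      using Re_trace_unitary_le[OF \<pi>u B, of "1\<^sub>m d"] B d0 mult_left_mono[of "2 * Re (mat_trace (\<pi> g * B))" _ "real d"]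
      by (simp add: mult_ac)
    from pos[OF B this] show ?thesis using d0 by (auto simp: complex_nonneg_Reals_iff)
  qed
  have z': "Re (z' B) = Re (z B)" if B: "B \<in> carrier_mat d d" for B
  proof -
    have "C (\<i> \<cdot>\<^sub>m B) = - \<i> \<cdot>\<^sub>m C B"
    proof -
      have "map_mat cnj (\<i> \<cdot>\<^sub>m B) = - \<i> \<cdot>\<^sub>m map_mat cnj B" by (rule eq_matI) auto
      then show ?thesis unfolding C_def using Uc B
        by (simp add: mult_smult_distrib[of _ d d _ d] mult_smult_assoc_mat[of _ d d _ d])
    qed
    then have "z' (\<i> \<cdot>\<^sub>m B) = - \<i> * z' B" "z (\<i> \<cdot>\<^sub>m B) = \<i> * z B"
      unfolding z'_def z_def using \<gamma>c B Cc[OF B]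
      by (simp_all add: mult_smult_distrib[of _ d d _ d] mat_trace_smult[of _ d])
    then show ?thesis using real[of "\<i> \<cdot>\<^sub>m B"] B by simp
  qed
  define W where "W = \<gamma> \<pi> * V"
  have Vd: "V \<in> carrier_mat d d" using V by (simp add: d_def)
  have W: "W \<in> carrier_mat d d" using \<gamma>c Vd by (simp add: W_def)
  have B: "V * mat_adjoint W \<in> carrier_mat d d" using Vd W by auto
  have zW: "z (V * mat_adjoint W) = of_real (frob_sq W)"
    unfolding z_def frob_ip_self[symmetric] frob_ip_def using \<gamma>c Vd W by (simp add: W_def assoc)
  have "2 * d * Re (mat_trace (\<pi> g * (V * mat_adjoint W))) \<le> d * (frob_sq V + frob_sq W)" for g
    using mult_left_mono[OF Re_trace_unitary_le[OF \<pi>u Vd W, of g], of "real d"] by (simp add: mult_ac)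
  from pos[OF B this] have "d * (2 * frob_sq W) \<le> d * (frob_sq V + frob_sq W)"
    using z'[OF B] by (simp add: complex_nonneg_Reals_iff zW)
  then show ?thesis using d0 by (simp add: W_def)
qed

section \<open>Means on compact spaces and groups\<close>

text \<open>A diagonal subsequence converges on a countable dense set, and a finite cover by sets of
  small oscillation upgrades this to uniform convergence. Equicontinuity is phrased by open sets
  because the domain carries only a topology.\<close>

lemma Arzela_Ascoli_sequence:
  fixes f :: "nat \<Rightarrow> 'a::second_countable_topology \<Rightarrow> 'b::{real_normed_vector, heine_borel}"
  assumes cpt: "compact (UNIV :: 'a set)"
    and cont: "\<And>n. continuous_on UNIV (f n)"
    and bdd: "\<And>n x. norm (f n x) \<le> C"
    and equi: "\<And>x e. e > 0 \<Longrightarrow> \<exists>U. open U \<and> x \<in> U \<and> (\<forall>y\<in>U. \<forall>n. dist (f n y) (f n x) \<le> e)"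
  obtains g r where "strict_mono (r :: nat \<Rightarrow> nat)" "continuous_on UNIV g"
    "uniform_limit UNIV (\<lambda>n. f (r n)) g sequentially"
proof -
  obtain D :: "'a set" where D: "countable D" "\<And>X. open X \<Longrightarrow> X \<noteq> {} \<Longrightarrow> \<exists>d\<in>D. d \<in> X"
    by (rule countable_dense_setE) blast
  obtain r where r: "strict_mono (r :: nat \<Rightarrow> nat)" "\<And>x. x \<in> D \<Longrightarrow> \<exists>l. (\<lambda>n. f (r n) x) \<longlonglongrightarrow> l"
    using function_convergent_subsequence[OF D(1), of f C] bdd by metis
  have "uniformly_Cauchy_on UNIV (\<lambda>n. f (r n))"
  proof (rule uniformly_Cauchy_onI)
    fix e :: real assume e: "e > 0"
    \<comment> \<open>A point \<open>y\<close> and the dense point \<open>d x\<close> are compared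
      through the centre \<open>x\<close>, at cost \<open>e/3\<close> for each of two indices; with
      \<open>e/6\<close> for the values at \<open>d x\<close> this leaves
      \<open>5e/6\<close>.\<close>
    obtain U where U: "\<And>x. open (U x)" "\<And>x. x \<in> U x" "\<And>x y n. y \<in> U x \<Longrightarrow> dist (f n y) (f n x) \<le> e/6"
      using equi[of "e/6"] e by (metis divide_pos_pos zero_less_numeral)
    obtain T where T: "finite T" "UNIV \<subseteq> (\<Union>x\<in>T. U x)"
      using compactE_image[OF cpt, of UNIV U] U by (metis UNIV_I UN_I subsetI)
    have "\<forall>x. \<exists>d\<in>D. d \<in> U x" using D(2)[OF U(1)] U(2) by blast
    then obtain d where d: "\<And>x. d x \<in> D" "\<And>x. d x \<in> U x" by metis
    have "\<exists>N. \<forall>m\<ge>N. \<forall>n\<ge>N. dist (f (r m) (d x)) (f (r n) (d x)) < e/6" for x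
    proof -
      have "Cauchy (\<lambda>n. f (r n) (d x))" using r(2)[OF d(1)] by (blast intro: LIMSEQ_imp_Cauchy)
      then show ?thesis using e unfolding Cauchy_def by (metis divide_pos_pos zero_less_numeral)
    qed
    then obtain N where N: "\<And>x m n. m \<ge> N x \<Longrightarrow> n \<ge> N x \<Longrightarrow> dist (f (r m) (d x)) (f (r n) (d x)) < e/6"
      by metis
    define M where "M = Max (N ` T)"
    show "\<exists>M. \<forall>x\<in>UNIV. \<forall>m\<ge>M. \<forall>n\<ge>M. dist (f (r m) x) (f (r n) x) < e"
    proof (intro exI[of _ M] ballI allI impI)
      fix y m n assume mn: "m \<ge> M" "n \<ge> M"
      obtain x where x: "x \<in> T" "y \<in> U x" using T by blast
      have "N x \<le> M" using x T by (simp add: M_def)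
      then have "dist (f (r m) (d x)) (f (r n) (d x)) < e/6" using mn N by (meson le_trans)
      moreover have "dist (f k y) (f k (d x)) \<le> e/3" for k
        using U(3)[OF x(2), of k] U(3)[OF d(2), of k x] dist_triangle2[of "f k y" "f k (d x)" "f k x"] by simp
      from this[of "r m"] this[of "r n"]
      have "dist (f (r m) y) (f (r m) (d x)) \<le> e/3" "dist (f (r n) y) (f (r n) (d x)) \<le> e/3" .
      moreover have "dist (f (r m) y) (f (r n) y) \<le> dist (f (r m) y) (f (r m) (d x))
        + dist (f (r m) (d x)) (f (r n) (d x)) + dist (f (r n) (d x)) (f (r n) y)"
        using dist_triangle[of "f (r m) y" "f (r n) y" "f (r m) (d x)"]
          dist_triangle[of "f (r m) (d x)" "f (r n) y" "f (r n) (d x)"] by linarith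
      ultimately show "dist (f (r m) y) (f (r n) y) < e"
        using e by (simp add: dist_commute[of "f (r n) (d x)"])
    qed
  qed
  then obtain g where g: "uniform_limit UNIV (\<lambda>n. f (r n)) g sequentially"
    using Cauchy_uniformly_convergent uniformly_convergent_on_def by blast
  have "continuous_on UNIV g"
    by (rule uniform_limit_theorem[OF _ g]) (auto simp: cont)
  with r(1) g show thesis using that by blast
qed

section \<open>Means as positive normalised functionals on continuous functions\<close>

abbreviation cont :: "('a::topological_space \<Rightarrow> 'b::topological_space) \<Rightarrow> bool" where
  "cont f \<equiv> continuous_on UNIV f"

text \<open>On a compact Hausdorff space this is a Radon probability measure in its Riesz form.
  Values at discontinuous functions are left unconstrained, which is why continuity must be checked
  at every use.\<close>

definition mean :: "(('a::topological_space \<Rightarrow> real) \<Rightarrow> real) \<Rightarrow> bool" where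
  "mean M \<longleftrightarrow> (\<forall>f g. cont f \<longrightarrow> cont g \<longrightarrow> M (\<lambda>x. f x + g x) = M f + M g) \<and>
     (\<forall>c f. cont f \<longrightarrow> M (\<lambda>x. c * f x) = c * M f) \<and>
     (\<forall>f. cont f \<longrightarrow> (\<forall>x. 0 \<le> f x) \<longrightarrow> 0 \<le> M f) \<and> M (\<lambda>x. 1) = 1"

lemma mean_add: "mean M \<Longrightarrow> cont f \<Longrightarrow> cont g \<Longrightarrow> M (\<lambda>x. f x + g x) = M f + M g"
  and mean_cmult: "mean M \<Longrightarrow> cont f \<Longrightarrow> M (\<lambda>x. c * f x) = c * M f"
  and mean_nonneg: "mean M \<Longrightarrow> cont f \<Longrightarrow> (\<And>x. 0 \<le> f x) \<Longrightarrow> 0 \<le> M f"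
  and mean_one: "mean M \<Longrightarrow> M (\<lambda>x. 1) = 1"
  by (auto simp: mean_def)

lemma mean_const [simp]: "mean M \<Longrightarrow> M (\<lambda>x. c) = c"
  using mean_cmult[of M "\<lambda>x. 1" c] mean_one[of M] by simp

lemma mean_diff:
  assumes "mean M" "cont f" "cont g" shows "M (\<lambda>x. f x - g x) = M f - M g"
  using mean_add[OF assms(1,2), of "\<lambda>x. - 1 * g x"] mean_cmult[OF assms(1,3), of "-1"] assms
  by (simp add: continuous_intros)

lemma mean_mono:
  assumes "mean M" "cont f" "cont g" "\<And>x. f x \<le> g x" shows "M f \<le> M g"
  using mean_nonneg[OF assms(1), of "\<lambda>x. g x - f x"] mean_diff[OF assms(1,3,2)] assms
  by (simp add: continuous_intros)

lemma mean_abs_diff_le: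
  assumes "mean M" "cont f" "cont g" "\<And>x. \<bar>f x - g x\<bar> \<le> e" shows "\<bar>M f - M g\<bar> \<le> e"
proof -
  have "M f - M g \<le> e"
    using mean_mono[OF assms(1), of "\<lambda>x. f x - g x" "\<lambda>x. e"] assms mean_diff[OF assms(1-3)]
    by (force simp: abs_le_iff continuous_intros)
  moreover have "M g - M f \<le> e"
    using mean_mono[OF assms(1), of "\<lambda>x. g x - f x" "\<lambda>x. e"] assms mean_diff[OF assms(1,3,2)]
    by (force simp: abs_le_iff continuous_intros)
  ultimately show ?thesis by linarith
qed

text \<open>Compactness makes \<open>\<phi> (y, x)\<close> continuous in \<open>y\<close> uniformly
  in \<open>x\<close>, and a mean does not increase uniform distances.\<close>

lemma mean_continuous:
  fixes \<phi> :: "'b::topological_space \<times> 'a::topological_space \<Rightarrow> real"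
  assumes cpt: "compact (UNIV :: 'a set)" and M: "mean M" and \<phi>: "cont \<phi>"
  shows "cont (\<lambda>y. M (\<lambda>x. \<phi> (y, x)))"
  unfolding continuous_on_topological
proof (intro ballI allI impI)
  have c: "cont (\<lambda>x. \<phi> (y, x))" for y
    by (intro continuous_on_compose2[OF \<phi>] continuous_intros) auto
  fix y and B :: "real set"
  assume B: "open B" "M (\<lambda>x. \<phi> (y, x)) \<in> B"
  then obtain e where e: "e > 0" "\<And>z. dist z (M (\<lambda>x. \<phi> (y, x))) < e \<Longrightarrow> z \<in> B"
    by (metis open_dist)
  obtain Y where Y: "y \<in> Y" "open Y" "\<forall>z\<in>Y \<inter> UNIV. \<forall>t\<in>UNIV. dist (\<phi> (z, t)) (\<phi> (y, t)) \<le> e/2"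
    using continuous_on_prod_compactE[of UNIV UNIV \<phi> y "e/2"] \<phi> cpt e(1) by auto
  have "M (\<lambda>x. \<phi> (z, x)) \<in> B" if "z \<in> Y" for z
  proof -
    have "\<bar>M (\<lambda>x. \<phi> (z, x)) - M (\<lambda>x. \<phi> (y, x))\<bar> \<le> e/2"
      by (rule mean_abs_diff_le[OF M c c]) (use Y that in \<open>auto simp: dist_real_def\<close>)
    then show ?thesis using e by (intro e(2)) (auto simp: dist_real_def)
  qed
  with Y show "\<exists>A. open A \<and> y \<in> A \<and> (\<forall>z\<in>UNIV. z \<in> A \<longrightarrow> M (\<lambda>x. \<phi> (z, x)) \<in> B)" by blast
qed

lemma compact_t2_separating_function:
  fixes S T :: "'a::t2_space set"
  assumes cpt: "compact (UNIV :: 'a set)" and S: "closed S" and T: "closed T" and ST: "S \<inter> T = {}"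
  obtains f :: "'a \<Rightarrow> real" where "cont f" "\<And>x. 0 \<le> f x" "\<And>x. f x \<le> 1"
    "\<And>x. x \<in> S \<Longrightarrow> f x = 0" "\<And>x. x \<in> T \<Longrightarrow> f x = 1"
proof -
  have "Hausdorff_space (euclidean :: 'a topology)"
    unfolding Hausdorff_space_def by (metis disjnt_def hausdorff open_openin)
  then have "normal_space (euclidean :: 'a topology)"
    by (intro compact_Hausdorff_or_regular_imp_normal_space disjI1)
      (use cpt in \<open>auto simp: compact_space_def\<close>)
  then obtain f where "continuous_map euclidean (top_of_set {0..1::real}) f" "f ` S \<subseteq> {0}" "f ` T \<subseteq> {1}"
    using Urysohn_lemma[of "euclidean :: 'a topology" S T 0 1] S T ST by (auto simp: disjnt_def)
  then show thesis
    by (intro that[of f]) (auto simp: continuous_map_in_subtopology image_subset_iff)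
qed

text \<open>The algebraic tensor product of the two function spaces. Interchanging means is trivial
  on it, and by Stone-Weierstrass it is uniformly dense; \<open>mean_Fubini\<close> combines the two
  facts.\<close>

inductive_set tensor_functions :: "('a::topological_space \<times> 'b::topological_space \<Rightarrow> real) set" where
  prod: "cont f \<Longrightarrow> cont g \<Longrightarrow> (\<lambda>p. f (fst p) * g (snd p)) \<in> tensor_functions"
| add: "F \<in> tensor_functions \<Longrightarrow> G \<in> tensor_functions \<Longrightarrow> (\<lambda>p. F p + G p) \<in> tensor_functions"

lemma tensor_functions_continuous: "F \<in> tensor_functions \<Longrightarrow> cont F"
  by (induction rule: tensor_functions.induct)
    (auto intro!: continuous_intros intro: continuous_on_compose2)

lemma tensor_functions_mult:
  assumes "F \<in> tensor_functions" "G \<in> tensor_functions"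
  shows "(\<lambda>p. F p * G p) \<in> tensor_functions"
  using assms
proof (induction arbitrary: G rule: tensor_functions.induct)
  case (prod f g)
  from prod(3) show ?case
  proof (induction rule: tensor_functions.induct)
    case (prod f' g')
    have "(\<lambda>p. (f (fst p) * f' (fst p)) * (g (snd p) * g' (snd p))) \<in> tensor_functions"
      using tensor_functions.prod[of "\<lambda>x. f x * f' x" "\<lambda>x. g x * g' x"] prod \<open>cont f\<close> \<open>cont g\<close>
      by (auto intro: continuous_intros)
    then show ?case by (simp add: mult_ac)
  next
    case (add F G)
    then show ?case using tensor_functions.add[OF add(3,4)] by (simp add: distrib_left)
  qed
next
  case (add F F')
  then show ?case using tensor_functions.add[OF add(3)[OF add(5)] add(4)[OF add(5)]]
    by (simp add: distrib_right)
qed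

lemma tensor_functions_dense:
  fixes \<phi> :: "'a::t2_space \<times> 'b::t2_space \<Rightarrow> real"
  assumes "compact (UNIV :: 'a set)" "compact (UNIV :: 'b set)" "cont \<phi>" "e > 0"
  obtains F where "F \<in> tensor_functions" "\<And>p. \<bar>\<phi> p - F p\<bar> < e"
proof -
  have "compact (UNIV :: ('a \<times> 'b) set)"
    using compact_Times[OF assms(1,2)] by simp
  moreover have "\<exists>f. f \<in> tensor_functions \<and> f p \<noteq> f q" if "p \<noteq> q" for p q :: "'a \<times> 'b"
  proof (cases "fst p = fst q")
    case False
    then obtain f where "cont f" "f (fst p) = (0::real)" "f (fst q) = 1"
      by (metis compact_t2_separating_function[OF assms(1), of "{fst p}" "{fst q}"] closed_singleton disjoint_insert(2) Int_empty_right singletonI singletonD)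
    then show ?thesis using tensor_functions.prod[of f "\<lambda>_. 1"]
      by (intro exI[of _ "\<lambda>p. f (fst p)"]) simp
  next
    case True
    then have "snd p \<noteq> snd q" using that by (simp add: prod_eq_iff)
    then obtain f where "cont f" "f (snd p) = (0::real)" "f (snd q) = 1"
      by (metis compact_t2_separating_function[OF assms(2), of "{snd p}" "{snd q}"] closed_singleton disjoint_insert(2) Int_empty_right singletonI singletonD)
    then show ?thesis using tensor_functions.prod[of "\<lambda>_. 1" f]
      by (intro exI[of _ "\<lambda>p. f (snd p)"]) simp
  qed
  moreover have "(\<lambda>p. c) \<in> tensor_functions" for c
    using tensor_functions.prod[of "\<lambda>_. c" "\<lambda>_. 1"] by simp
  ultimately have "\<exists>g. g \<in> tensor_functions \<and> (\<forall>p\<in>UNIV. \<bar>\<phi> p - g p\<bar> < e)"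
    using assms(3,4)
    by (intro Stone_Weierstrass_HOL) (auto intro: tensor_functions.add tensor_functions_mult
        tensor_functions_continuous)
  then show thesis using that by blast
qed

lemma mean_Fubini:
  fixes \<phi> :: "'a::t2_space \<times> 'b::t2_space \<Rightarrow> real"
  assumes ca: "compact (UNIV :: 'a set)" and cb: "compact (UNIV :: 'b set)"
    and M: "mean M" and N: "mean N" and \<phi>: "cont \<phi>"
  shows "M (\<lambda>x. N (\<lambda>y. \<phi> (x, y))) = N (\<lambda>y. M (\<lambda>x. \<phi> (x, y)))"
proof -
  have c1: "cont (\<lambda>y. F (x, y))" and c2: "cont (\<lambda>x. F (x, y))" if "cont F" for F :: "'a \<times> 'b \<Rightarrow> real" and x y
    using that by (auto intro!: continuous_on_compose2[OF that] continuous_intros)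
  have N': "cont (\<lambda>x. N (\<lambda>y. F (x, y)))" if "cont F" for F :: "'a \<times> 'b \<Rightarrow> real"
    by (rule mean_continuous[OF cb N that])
  have M': "cont (\<lambda>y. M (\<lambda>x. F (x, y)))" if "cont F" for F :: "'a \<times> 'b \<Rightarrow> real"
  proof -
    have "cont (\<lambda>p. F (snd p, fst p))"
      by (rule continuous_on_compose2[OF that]) (auto intro!: continuous_intros)
    from mean_continuous[OF ca M this] show ?thesis by simp
  qed
  have eq: "M (\<lambda>x. N (\<lambda>y. F (x, y))) = N (\<lambda>y. M (\<lambda>x. F (x, y)))" if "F \<in> tensor_functions" for F
    using that
  proof (induction rule: tensor_functions.induct)
    case (prod f g)
    have "M (\<lambda>x. f x * c) = M f * c" for c
      using mean_cmult[OF M prod(1), of c] by (simp add: mult.commute)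
    moreover have "N (\<lambda>y. c * g y) = c * N g" for c by (rule mean_cmult[OF N prod(2)])
    ultimately show ?case by simp
  next
    case (add F G)
    note cF = tensor_functions_continuous[OF add(1)] and cG = tensor_functions_continuous[OF add(2)]
    show ?case
      by (simp add: mean_add[OF N c1[OF cF] c1[OF cG]] mean_add[OF M c2[OF cF] c2[OF cG]]
        mean_add[OF M N'[OF cF] N'[OF cG]] mean_add[OF N M'[OF cF] M'[OF cG]] add)
  qed
  have "\<bar>M (\<lambda>x. N (\<lambda>y. \<phi> (x, y))) - N (\<lambda>y. M (\<lambda>x. \<phi> (x, y)))\<bar> \<le> 0 + e" if e: "e > 0" for e
  proof -
    obtain F where F: "F \<in> tensor_functions" "\<And>p. \<bar>\<phi> p - F p\<bar> < e/2"
      using tensor_functions_dense[OF ca cb \<phi>, of "e/2"] e by auto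
    note cF = tensor_functions_continuous[OF F(1)]
    have "\<bar>M (\<lambda>x. N (\<lambda>y. \<phi> (x, y))) - M (\<lambda>x. N (\<lambda>y. F (x, y)))\<bar> \<le> e/2"
      by (intro mean_abs_diff_le[OF M N'[OF \<phi>] N'[OF cF]] mean_abs_diff_le[OF N c1[OF \<phi>] c1[OF cF]])
        (use F in \<open>auto intro: less_imp_le\<close>)
    moreover have "\<bar>N (\<lambda>y. M (\<lambda>x. \<phi> (x, y))) - N (\<lambda>y. M (\<lambda>x. F (x, y)))\<bar> \<le> e/2"
      by (intro mean_abs_diff_le[OF N M'[OF \<phi>] M'[OF cF]] mean_abs_diff_le[OF M c2[OF \<phi>] c2[OF cF]])
        (use F in \<open>auto intro: less_imp_le\<close>)
    ultimately show ?thesis using eq[OF F(1)] by linarith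
  qed
  then show ?thesis by (meson abs_ge_zero eq_iff_diff_eq_0 field_le_epsilon abs_le_zero_iff)
qed

section \<open>Faithful and invariant means\<close>

definition faithful :: "(('a::topological_space \<Rightarrow> real) \<Rightarrow> real) \<Rightarrow> bool" where
  "faithful M \<longleftrightarrow> (\<forall>f. cont f \<longrightarrow> (\<forall>x. 0 \<le> f x) \<longrightarrow> M f = 0 \<longrightarrow> f = (\<lambda>x. 0))"

lemma continuous_bounded:
  fixes f :: "'a::topological_space \<Rightarrow> 'b::real_normed_vector"
  assumes "compact (UNIV :: 'a set)" "cont f"
  obtains C where "C > 0" "\<And>x. norm (f x) \<le> C"
proof -
  have "bounded (range f)" using assms by (intro compact_imp_bounded compact_continuous_image)
  then show thesis using that unfolding bounded_pos by auto
qed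

text \<open>A distribution charging every point of a countable dense set charges every nonempty open
  set. Its weights come from the geometric distribution, pushed forward along an enumeration so that
  a finite dense set is covered as well.\<close>

lemma ex_faithful_mean:
  assumes cpt: "compact (UNIV :: 'a set)"
  obtains M :: "('a::second_countable_topology \<Rightarrow> real) \<Rightarrow> real" where "mean M" "faithful M"
proof -
  obtain D :: "'a set" where D: "countable D" "\<And>X. open X \<Longrightarrow> X \<noteq> {} \<Longrightarrow> \<exists>d\<in>D. d \<in> X"
    by (rule countable_dense_setE) blast
  have "D \<noteq> {}" using D(2)[of UNIV] by auto
  define p where "p = map_pmf (from_nat_into D) (geometric_pmf (1/2))"
  have p: "set_pmf p = D"
    using D \<open>D \<noteq> {}\<close> by (simp add: p_def set_pmf_geometric range_from_nat_into)
  define M where "M f = measure_pmf.expectation p f" for f :: "'a \<Rightarrow> real"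
  have int: "integrable (measure_pmf p) f" if f: "cont f" for f :: "'a \<Rightarrow> real"
  proof -
    obtain C where "\<And>x. norm (f x) \<le> C" using continuous_bounded[OF cpt f] by metis
    then show ?thesis by (intro measure_pmf.integrable_const_bound[of _ C]) auto
  qed
  have "mean M"
    unfolding mean_def M_def by (auto simp: int)
  moreover have "faithful M"
    unfolding faithful_def
  proof (intro allI impI)
    fix f :: "'a \<Rightarrow> real" assume f: "cont f" "\<forall>x. 0 \<le> f x" "M f = 0"
    have "AE x in measure_pmf p. f x = 0"
      using f integral_nonneg_eq_0_iff_AE[OF int[OF f(1)]] by (simp add: M_def)
    then have z: "f x = 0" if "x \<in> D" for x using that p by (simp add: AE_measure_pmf_iff)
    show "f = (\<lambda>x. 0)"
    proof (rule ccontr)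
      assume "f \<noteq> (\<lambda>x. 0)"
      then have "{x. f x \<noteq> 0} \<noteq> {}" by auto
      moreover have "open {x. f x \<noteq> 0}"
        using open_Collect_neq[OF f(1), of "\<lambda>x. 0"] by simp
      ultimately show False using D(2) z by blast
    qed
  qed
  ultimately show thesis using that by blast
qed

lemma compact_group_equicontinuous:
  fixes f :: "'g::topological_group_add \<Rightarrow> 'b::metric_space"
  assumes cpt: "compact (UNIV :: 'g set)" and f: "cont f" and e: "e > 0"
  obtains U where "open U" "0 \<in> U" "\<And>u t. u \<in> U \<Longrightarrow> dist (f (u + t)) (f t) \<le> e"
proof -
  have "cont (\<lambda>p. f (fst p + snd p))"
    by (rule continuous_on_compose2[OF f]) (auto intro!: continuous_intros)
  then obtain U where "0 \<in> U" "open U" "\<forall>u\<in>U \<inter> UNIV. \<forall>t\<in>UNIV. dist (f (u + t)) (f (0 + t)) \<le> e"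
    using continuous_on_prod_compactE[of UNIV UNIV "\<lambda>p. f (fst p + snd p)" 0 e] cpt e by auto
  then show thesis using that by auto
qed

lemma cont_translate:
  fixes f :: "'g::topological_group_add \<Rightarrow> 'b::topological_space"
  assumes "cont f"
  shows "cont (\<lambda>x. f (a + x))" "cont (\<lambda>x. f (x + a))" "cont (\<lambda>x. f (- x))"
  by (intro continuous_on_compose2[OF assms] continuous_intros; simp)+

lemma SUP_attained:
  fixes g :: "'a::topological_space \<Rightarrow> real"
  assumes cpt: "compact (UNIV :: 'a set)" and g: "cont g"
  obtains x where "g x = (SUP x. g x)" "\<And>y. g y \<le> (SUP x. g x)"
proof -
  obtain x where x: "\<And>y. g y \<le> g x"
    using continuous_attains_sup[OF cpt _ g] by auto
  then have "(SUP x. g x) = g x" by (intro cSup_eq_maximum) auto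
  with x show thesis using that by metis
qed

lemma SUP_abs_diff_le:
  fixes f g :: "'a::topological_space \<Rightarrow> real"
  assumes cpt: "compact (UNIV :: 'a set)" and f: "cont f" and g: "cont g" and le: "\<And>x. \<bar>f x - g x\<bar> \<le> e"
  shows "\<bar>(SUP x. f x) - (SUP x. g x)\<bar> \<le> e"
proof -
  obtain x where x: "f x = (SUP x. f x)" "\<And>y. f y \<le> (SUP x. f x)" using SUP_attained[OF cpt f] by metis
  obtain y where y: "g y = (SUP x. g x)" "\<And>x. g x \<le> (SUP x. g x)" using SUP_attained[OF cpt g] by metis
  show ?thesis using le[of x] le[of y] x(1) x(2)[of y] y(1) y(2)[of x] by linarith
qed

lemma SUP_uniform_limit:
  fixes g :: "'a::topological_space \<Rightarrow> real"
  assumes cpt: "compact (UNIV :: 'a set)" and f: "\<And>n::nat. cont (f n)" and g: "cont g"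
    and lim: "uniform_limit UNIV f g sequentially"
  shows "(\<lambda>n. SUP x. f n x) \<longlonglongrightarrow> (SUP x. g x)"
proof (rule LIMSEQ_I)
  fix e :: real assume e: "e > 0"
  then have "\<forall>\<^sub>F n in sequentially. \<forall>x\<in>UNIV. dist (f n x) (g x) < e/2"
    using lim unfolding uniform_limit_iff by (meson half_gt_zero)
  then obtain N where N: "\<And>n x. n \<ge> N \<Longrightarrow> dist (f n x) (g x) < e/2"
    unfolding eventually_sequentially by blast
  show "\<exists>N. \<forall>n\<ge>N. norm ((SUP x. f n x) - (SUP x. g x)) < e"
  proof (intro exI allI impI)
    fix n assume "n \<ge> N"
    then have "\<bar>(SUP x. f n x) - (SUP x. g x)\<bar> \<le> e/2"
      by (intro SUP_abs_diff_le[OF cpt f g]) (use N in \<open>fastforce simp: dist_real_def intro: less_imp_le\<close>)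
    then show "norm ((SUP x. f n x) - (SUP x. g x)) < e" using e by simp
  qed
qed

lemma faithfulD: "faithful M \<Longrightarrow> M f = 0 \<Longrightarrow> cont f \<Longrightarrow> (\<And>x. 0 \<le> f x) \<Longrightarrow> f = (\<lambda>x. 0)"
  by (simp add: faithful_def)

text \<open>The powers of the averaging operator of a faithful mean form an equicontinuous family, and
  their maxima decrease. At a limit function the maximum no longer decreases, which by faithfulness
  forces this function to be constant; the constant is the invariant mean.\<close>

lemma ex_invariant_mean:
  assumes cpt: "compact (UNIV :: 'g set)"
  obtains J :: "('g::{topological_group_add, t2_space, second_countable_topology} \<Rightarrow> real) \<Rightarrow> real"
  where "mean J" "faithful J" "\<And>f a. cont f \<Longrightarrow> J (\<lambda>x. f (a + x)) = J f"
proof -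
  obtain M :: "('g \<Rightarrow> real) \<Rightarrow> real" where M: "mean M" "faithful M"
    using ex_faithful_mean[OF cpt] by metis
  \<comment> \<open>Averaging over right translates commutes with left translations
    (\<open>Q_left\<close>). This gives both equicontinuity of the iterates and left invariance of
    the limit.\<close>
  define P where "P f x = M (\<lambda>h. f (x + h))" for f x
  define Q where "Q n = (P ^^ n)" for n
  have Q0: "Q 0 f = f" and QS: "Q (Suc n) f = P (Q n f)" for n f by (simp_all add: Q_def)
  have P: "cont (P f)" if "cont f" for f
  proof -
    have "cont (\<lambda>p. f (fst p + snd p))"
      by (rule continuous_on_compose2[OF that]) (auto intro!: continuous_intros)
    from mean_continuous[OF cpt M(1) this] show ?thesis by (simp add: P_def[abs_def])
  qed
  have Q: "cont (Q n f)" if "cont f" for f n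
    by (induction n) (simp_all add: Q0 QS P that)
  have Q_add: "Q n (\<lambda>x. f x + g x) = (\<lambda>x. Q n f x + Q n g x)" if "cont f" "cont g" for n f g
  proof (induction n)
    case (Suc n)
    show ?case unfolding QS Suc
      by (auto simp: P_def[abs_def] mean_add[OF M(1)] cont_translate Q that)
  qed (simp add: Q0)
  have Q_cmult: "Q n (\<lambda>x. c * f x) = (\<lambda>x. c * Q n f x)" if "cont f" for n c f
  proof (induction n)
    case (Suc n)
    show ?case unfolding QS Suc
      by (auto simp: P_def[abs_def] mean_cmult[OF M(1)] cont_translate Q that)
  qed (simp add: Q0)
  have Q_const: "Q n (\<lambda>x. c) = (\<lambda>x. c)" for n c
    by (induction n) (auto simp: Q0 QS P_def[abs_def] M(1))
  have P_diff: "\<bar>P f x - P g x\<bar> \<le> e" if "cont f" "cont g" "\<And>x. \<bar>f x - g x\<bar> \<le> e" for f g e x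
    unfolding P_def by (rule mean_abs_diff_le[OF M(1)]) (use that in \<open>auto intro: cont_translate\<close>)
  have Q_diff: "\<bar>Q n f x - Q n g x\<bar> \<le> e" if "cont f" "cont g" "\<And>x. \<bar>f x - g x\<bar> \<le> e" for n f g e x
  proof (induction n arbitrary: x)
    case (Suc n)
    show ?case unfolding QS by (rule P_diff[OF Q Q]) (use that Suc in auto)
  qed (use that in \<open>auto simp: Q0\<close>)
  have Q_mono: "Q n f x \<le> Q n g x" if "cont f" "cont g" "\<And>x. f x \<le> g x" for n f g x
  proof (induction n arbitrary: x)
    case (Suc n)
    show ?case unfolding QS P_def
      by (rule mean_mono[OF M(1)]) (use that Suc Q in \<open>auto intro: cont_translate\<close>)
  qed (use that in \<open>auto simp: Q0\<close>)
  have Q_left: "Q n (\<lambda>x. f (a + x)) = (\<lambda>x. Q n f (a + x))" for n f a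
    by (induction n) (simp_all add: Q0 QS P_def add.assoc)
  have Q_plus: "Q (m + n) f = Q m (Q n f)" for m n f by (simp add: Q_def funpow_add)
  have conv: "\<exists>c. uniform_limit UNIV (\<lambda>n. Q n f) (\<lambda>_. c) sequentially" if f: "cont f" for f
  proof -
    obtain C where C: "\<And>x. norm (f x) \<le> C" using continuous_bounded[OF cpt f] by metis
    have bdd: "norm (Q n f x) \<le> C" for n x
      using Q_diff[OF f, of "\<lambda>x. 0" C n x] C by (simp add: Q_const)
    \<comment> \<open>Since \<open>y = (y - x) + x\<close>, moving the point amounts to left
      translating \<open>f\<close>; as \<open>Q n\<close> does not increase uniform distances, the
      modulus of \<open>f\<close> serves for all \<open>n\<close>.\<close>
    have equi: "\<exists>U. open U \<and> x \<in> U \<and> (\<forall>y\<in>U. \<forall>n. dist (Q n f y) (Q n f x) \<le> e)" if e: "e > 0" for x e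
    proof -
      obtain U where U: "open U" "0 \<in> U" "\<And>u t. u \<in> U \<Longrightarrow> dist (f (u + t)) (f t) \<le> e"
        using compact_group_equicontinuous[OF cpt f e] by metis
      have "open ((\<lambda>y. y - x) -` U)"
        by (rule open_vimage[OF U(1)]) (auto intro!: continuous_intros)
      moreover have "dist (Q n f y) (Q n f x) \<le> e" if "y - x \<in> U" for y n
      proof -
        have "\<bar>Q n (\<lambda>t. f ((y - x) + t)) x - Q n f x\<bar> \<le> e"
          by (rule Q_diff) (use f U(3)[OF that] in \<open>auto intro: cont_translate simp: dist_real_def\<close>)
        then show ?thesis by (simp add: Q_left dist_real_def)
      qed
      ultimately show ?thesis using U(2) by (intro exI[of _ "(\<lambda>y. y - x) -` U"]) auto
    qed
    obtain g r where r: "strict_mono (r :: nat \<Rightarrow> nat)" and g: "cont g"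
      and lim: "uniform_limit UNIV (\<lambda>n. Q (r n) f) g sequentially"
      by (rule Arzela_Ascoli_sequence[OF cpt, of "\<lambda>n. Q n f" C]) (use Q[OF f] bdd equi in auto)
    define a where "a n = (SUP x. Q n f x)" for n
    have a_le: "Q n f x \<le> a n" for n x
      unfolding a_def using SUP_attained[OF cpt Q[OF f]] by metis
    have "decseq a"
    proof (rule decseq_SucI)
      fix n
      obtain x where x: "Q (Suc n) f x = a (Suc n)"
        unfolding a_def using SUP_attained[OF cpt Q[OF f]] by metis
      have "P (Q n f) x \<le> P (\<lambda>x. a n) x"
        unfolding P_def by (rule mean_mono[OF M(1)]) (use Q[OF f] a_le in \<open>auto intro: cont_translate\<close>)
      then show "a (Suc n) \<le> a n" using x M(1) by (simp add: QS P_def)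
    qed
    moreover have "-C \<le> a n" for n
      using a_le[of n 0] bdd[of n 0] by (auto simp: abs_le_iff)
    ultimately obtain c where c: "a \<longlonglongrightarrow> c"
      using decseq_convergent by metis
    have "(\<lambda>n. a (r n)) \<longlonglongrightarrow> (SUP x. g x)"
      unfolding a_def by (rule SUP_uniform_limit[OF cpt Q[OF f] g lim])
    moreover have "(\<lambda>n. a (r n)) \<longlonglongrightarrow> c"
      using LIMSEQ_subseq_LIMSEQ[OF c r] by (simp add: o_def)
    ultimately have sg: "(SUP x. g x) = c" by (rule LIMSEQ_unique)
    have "uniform_limit UNIV (\<lambda>n. Q (Suc (r n)) f) (P g) sequentially"
      unfolding uniform_limit_iff
    proof (intro allI impI)
      fix e :: real assume "e > 0"
      then have "\<forall>\<^sub>F n in sequentially. \<forall>x\<in>UNIV. dist (Q (r n) f x) (g x) < e/2"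
        using lim unfolding uniform_limit_iff by (meson half_gt_zero)
      then show "\<forall>\<^sub>F n in sequentially. \<forall>x\<in>UNIV. dist (Q (Suc (r n)) f x) (P g x) < e"
      proof (rule eventually_mono)
        fix n assume n: "\<forall>x\<in>UNIV. dist (Q (r n) f x) (g x) < e/2"
        have "\<bar>P (Q (r n) f) x - P g x\<bar> \<le> e/2" for x
          by (rule P_diff[OF Q[OF f] g]) (use n in \<open>auto simp: dist_real_def intro: less_imp_le\<close>)
        then show "\<forall>x\<in>UNIV. dist (Q (Suc (r n)) f x) (P g x) < e"
          using \<open>e > 0\<close> by (auto simp: QS dist_real_def intro: le_less_trans[of _ "e/2"])
      qed
    qed
    then have "(\<lambda>n. a (Suc (r n))) \<longlonglongrightarrow> (SUP x. P g x)"
      unfolding a_def by (rule SUP_uniform_limit[OF cpt Q[OF f] P[OF g]])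
    moreover have "(\<lambda>n. a (Suc (r n))) \<longlonglongrightarrow> c"
      using LIMSEQ_subseq_LIMSEQ[OF LIMSEQ_Suc[OF c] r] by (simp add: o_def)
    ultimately have sPg: "(SUP x. P g x) = c" by (rule LIMSEQ_unique)
    obtain x where x: "P g x = c" using SUP_attained[OF cpt P[OF g]] sPg by metis
    have gc: "g y \<le> c" for y using SUP_attained[OF cpt g] sg by metis
    have "M (\<lambda>h. c - g (x + h)) = 0"
      using x mean_diff[OF M(1), of "\<lambda>h. c" "\<lambda>h. g (x + h)"] cont_translate(1)[OF g] M(1)
      by (simp add: P_def)
    then have "(\<lambda>h. c - g (x + h)) = (\<lambda>h. 0)"
      by (intro faithfulD[OF M(2)]) (use gc cont_translate(1)[OF g, of x] in \<open>auto intro!: continuous_intros\<close>)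
    then have "g (x + h) = c" for h by (auto simp: fun_eq_iff)
    from this[of "- x + _"] have gc: "g = (\<lambda>_. c)" by (simp add: add.assoc[symmetric] fun_eq_iff)
    \<comment> \<open>From the subsequence to the full sequence: constants are fixed, so an iterate
      close to \<open>c\<close> keeps all later ones close to \<open>c\<close>.\<close>
    have "uniform_limit UNIV (\<lambda>n. Q n f) (\<lambda>_. c) sequentially"
      unfolding uniform_limit_iff
    proof (intro allI impI)
      fix e :: real assume e: "e > 0"
      then have "\<forall>\<^sub>F n in sequentially. \<forall>x\<in>UNIV. dist (Q (r n) f x) c < e/2"
        using lim unfolding uniform_limit_iff gc by (meson half_gt_zero)
      then obtain N where N: "\<And>x. dist (Q (r N) f x) c < e/2"
        unfolding eventually_sequentially by auto
      show "\<forall>\<^sub>F n in sequentially. \<forall>x\<in>UNIV. dist (Q n f x) c < e"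
      proof (rule eventually_sequentiallyI[of "r N"], intro ballI)
        fix n x assume "r N \<le> n"
        then have "Q n f = Q (n - r N) (Q (r N) f)" by (simp flip: Q_plus)
        moreover have "\<bar>Q (n - r N) (Q (r N) f) x - Q (n - r N) (\<lambda>x. c) x\<bar> \<le> e/2"
          by (rule Q_diff[OF Q[OF f]]) (use N in \<open>auto simp: dist_real_def intro: less_imp_le\<close>)
        ultimately show "dist (Q n f x) c < e" using e by (auto simp: Q_const dist_real_def)
      qed
    qed
    then show ?thesis by blast
  qed
  define J where "J f = lim (\<lambda>n. Q n f 0)" for f
  have lim: "(\<lambda>n. Q n f x) \<longlonglongrightarrow> J f" if f: "cont f" for f x
  proof -
    obtain c where c: "uniform_limit UNIV (\<lambda>n. Q n f) (\<lambda>_. c) sequentially" using conv[OF f] by blast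
    have "(\<lambda>n. Q n f x) \<longlonglongrightarrow> c" for x using tendsto_uniform_limitI[OF c] by simp
    then show ?thesis unfolding J_def by (metis limI)
  qed
  have "mean J"
    unfolding mean_def
  proof (intro conjI allI impI)
    fix f g :: "'g \<Rightarrow> real" and c
    assume f: "cont f"
    show "J (\<lambda>x. c * f x) = c * J f"
      by (rule LIMSEQ_unique[OF lim[of "\<lambda>x. c * f x" 0]])
        (auto simp: Q_cmult f intro!: continuous_intros tendsto_intros lim)
    show "0 \<le> J f" if "\<forall>x. 0 \<le> f x"
      by (rule LIMSEQ_le_const[OF lim[OF f, of 0]])
        (use Q_mono[of "\<lambda>x. 0" f] f that in \<open>auto simp: Q_const\<close>)
    show "J (\<lambda>x. f x + g x) = J f + J g" if "cont g"
      by (rule LIMSEQ_unique[OF lim[of "\<lambda>x. f x + g x" 0]])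
        (auto simp: Q_add f that intro!: continuous_intros tendsto_intros lim)
  next
    show "J (\<lambda>x. 1) = 1" by (simp add: J_def Q_const)
  qed
  moreover have "J (\<lambda>x. f (a + x)) = J f" if "cont f" for f a
    using LIMSEQ_unique[OF lim[OF cont_translate(1)[OF that], of a 0]] lim[OF that] by (simp add: Q_left)
  \<comment> \<open>Faithfulness of \<open>M\<close> makes \<open>P f\<close> strictly positive
    everywhere, hence bounded below by its positive minimum. Further averaging preserves this lower
    bound, so it passes to \<open>J f\<close>.\<close>
  moreover have "faithful J"
    unfolding faithful_def
  proof (intro allI impI, rule ccontr)
    fix f :: "'g \<Rightarrow> real" assume f: "cont f" "\<forall>x. 0 \<le> f x" "J f = 0" "f \<noteq> (\<lambda>x. 0)"
    have pos: "P f x > 0" for x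
    proof -
      have "M (\<lambda>h. f (x + h)) \<noteq> 0"
      proof
        assume "M (\<lambda>h. f (x + h)) = 0"
        then have "(\<lambda>h. f (x + h)) = (\<lambda>h. 0)"
          by (intro faithfulD[OF M(2)]) (use f cont_translate(1)[OF f(1), of x] in auto)
        then have "f (x + (- x + y)) = 0" for y by (rule fun_cong)
        then show False using f(4) by (simp add: add.assoc[symmetric] fun_eq_iff)
      qed
      moreover have "0 \<le> M (\<lambda>h. f (x + h))"
        by (rule mean_nonneg[OF M(1)]) (use f in \<open>auto intro: cont_translate\<close>)
      ultimately show ?thesis by (simp add: P_def)
    qed
    obtain x where x: "\<And>y. P f x \<le> P f y"
      using continuous_attains_inf[OF cpt _ P[OF f(1)]] by auto
    have "Q (Suc n) f = Q n (P f)" for n by (simp add: Q_def funpow_swap1)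
    then have "P f x \<le> Q (Suc n) f 0" for n
      using Q_mono[of "\<lambda>_. P f x" "P f" n 0] P[OF f(1)] x
      by (simp add: Q_const)
    then have "P f x \<le> J f"
      by (intro LIMSEQ_le_const[OF LIMSEQ_Suc[OF lim[OF f(1), of 0]]]) auto
    then show False using pos[of x] f(3) by simp
  qed
  ultimately show thesis using that by blast
qed

section \<open>Means of complex functions\<close>

definition cmean :: "(('a \<Rightarrow> real) \<Rightarrow> real) \<Rightarrow> ('a \<Rightarrow> complex) \<Rightarrow> complex" where
  "cmean M f = Complex (M (\<lambda>x. Re (f x))) (M (\<lambda>x. Im (f x)))"

lemma cmean_add:
  assumes "mean M" "cont f" "cont g"
  shows "cmean M (\<lambda>x. f x + g x) = cmean M f + cmean M g"
  using mean_add[OF assms(1) continuous_on_Re[OF assms(2)] continuous_on_Re[OF assms(3)]]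
    mean_add[OF assms(1) continuous_on_Im[OF assms(2)] continuous_on_Im[OF assms(3)]]
  by (simp add: cmean_def complex_eq_iff)

lemma cmean_cmult:
  assumes M: "mean M" and f: "cont f"
  shows "cmean M (\<lambda>x. c * f x) = c * cmean M f"
proof -
  have r: "cont (\<lambda>x. Re (f x))" "cont (\<lambda>x. Im (f x))" using f by (auto intro: continuous_intros)
  then have "cont (\<lambda>x. a * Re (f x))" "cont (\<lambda>x. a * Im (f x))" for a by (auto intro: continuous_intros)
  with r show ?thesis
    by (simp add: cmean_def complex_eq_iff mean_diff[OF M] mean_add[OF M] mean_cmult[OF M])
qed

lemma cmean_const [simp]: "mean M \<Longrightarrow> cmean M (\<lambda>x. c) = c"
  by (simp add: cmean_def)

lemma cmean_cnj:
  assumes "mean M" "cont f" shows "cmean M (\<lambda>x. cnj (f x)) = cnj (cmean M f)"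
  using mean_cmult[OF assms(1), of "\<lambda>x. Im (f x)" "-1"] assms(2)
  by (simp add: cmean_def complex_eq_iff continuous_on_Im)

lemma cmean_of_real: "mean M \<Longrightarrow> cmean M (\<lambda>x. of_real (f x)) = of_real (M f)"
  by (simp add: cmean_def complex_eq_iff)

lemma cmean_diff:
  assumes "mean M" "cont f" "cont g"
  shows "cmean M (\<lambda>x. f x - g x) = cmean M f - cmean M g"
  using mean_diff[OF assms(1) continuous_on_Re[OF assms(2)] continuous_on_Re[OF assms(3)]]
    mean_diff[OF assms(1) continuous_on_Im[OF assms(2)] continuous_on_Im[OF assms(3)]]
  by (simp add: cmean_def complex_eq_iff)

lemma cmean_sum:
  assumes "mean M" "\<And>i. i \<in> I \<Longrightarrow> cont (f i)"
  shows "cmean M (\<lambda>x. \<Sum>i\<in>I. f i x) = (\<Sum>i\<in>I. cmean M (f i))"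
  using assms(2)
proof (induction I rule: infinite_finite_induct)
  case (insert i I)
  then show ?case
    by (simp add: cmean_add[OF assms(1)] continuous_on_sum)
qed (use assms(1) in auto)

lemma norm_cmean_le:
  assumes M: "mean M" and f: "cont f"
  shows "norm (cmean M f) \<le> M (\<lambda>x. norm (f x))"
proof (cases "cmean M f = 0")
  case True
  then show ?thesis using mean_nonneg[OF M, of "\<lambda>x. norm (f x)"] f by (simp add: continuous_on_norm)
next
  case False
  \<comment> \<open>A phase that rotates the value onto the positive real axis, where monotonicity
    of the real mean applies.\<close>
  define u where "u = cnj (cmean M f) / norm (cmean M f)"
  have u: "norm u = 1" using False by (simp add: u_def norm_divide)
  have "u * cmean M f = of_real (norm (cmean M f))"
    using False by (simp add: u_def complex_norm_square[symmetric] mult.commute[of "cnj _"] power2_eq_square)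
  then have "norm (cmean M f) = Re (cmean M (\<lambda>x. u * f x))"
    by (simp add: cmean_cmult[OF M f])
  also have "\<dots> = M (\<lambda>x. Re (u * f x))" by (simp add: cmean_def)
  also have "\<dots> \<le> M (\<lambda>x. norm (f x))"
  proof (rule mean_mono[OF M])
    show "cont (\<lambda>x. Re (u * f x))" "cont (\<lambda>x. norm (f x))" using f by (auto intro!: continuous_intros)
    show "Re (u * f x) \<le> norm (f x)" for x
      using complex_Re_le_cmod[of "u * f x"] u by (simp add: norm_mult)
  qed
  finally show ?thesis .
qed

lemma norm_cmean_le_const:
  assumes M: "mean M" and f: "cont f" and le: "\<And>x. norm (f x) \<le> c"
  shows "norm (cmean M f) \<le> c"
proof -
  have "M (\<lambda>x. norm (f x)) \<le> M (\<lambda>x. c)"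
    by (rule mean_mono[OF M]) (use f le in \<open>auto intro: continuous_intros\<close>)
  then show ?thesis using norm_cmean_le[OF M f] M by simp
qed

lemma cmean_continuous:
  fixes \<phi> :: "'b::topological_space \<times> 'a::topological_space \<Rightarrow> complex"
  assumes cpt: "compact (UNIV :: 'a set)" and M: "mean M" and \<phi>: "cont \<phi>"
  shows "cont (\<lambda>y. cmean M (\<lambda>x. \<phi> (y, x)))"
  using mean_continuous[OF cpt M, of "\<lambda>p. Re (\<phi> p)"] mean_continuous[OF cpt M, of "\<lambda>p. Im (\<phi> p)"] \<phi>
  unfolding cmean_def Complex_eq by (auto intro!: continuous_intros)

lemma cmean_Fubini:
  fixes \<phi> :: "'a::t2_space \<times> 'b::t2_space \<Rightarrow> complex"
  assumes "compact (UNIV :: 'a set)" "compact (UNIV :: 'b set)" "mean M" "mean N" "cont \<phi>"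
  shows "cmean M (\<lambda>x. cmean N (\<lambda>y. \<phi> (x, y))) = cmean N (\<lambda>y. cmean M (\<lambda>x. \<phi> (x, y)))"
  using mean_Fubini[OF assms(1-4), of "\<lambda>p. Re (\<phi> p)"] mean_Fubini[OF assms(1-4), of "\<lambda>p. Im (\<phi> p)"] assms(5)
  by (simp add: cmean_def continuous_on_Re continuous_on_Im)

section \<open>Integrals as means\<close>

lemma continuous_integrable:
  fixes f :: "'a::topological_space \<Rightarrow> 'b::{banach, second_countable_topology}"
  assumes cpt: "compact (UNIV :: 'a set)" and \<mu>: "prob_space \<mu>" "sets \<mu> = sets borel" and f: "cont f"
  shows "integrable \<mu> f"
proof -
  interpret prob_space \<mu> by fact
  obtain C where "\<And>x. norm (f x) \<le> C" using continuous_bounded[OF cpt f] by metis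
  moreover have "f \<in> borel_measurable \<mu>"
    using borel_measurable_continuous_onI[OF f] measurable_cong_sets[OF \<mu>(2) refl] by blast
  ultimately show ?thesis by (intro integrable_const_bound[of _ C]) auto
qed

definition integral_mean :: "'a measure \<Rightarrow> ('a \<Rightarrow> real) \<Rightarrow> real" where
  "integral_mean \<mu> f = (\<integral>x. f x \<partial>\<mu>)"

lemma mean_integral_mean:
  fixes \<mu> :: "'a::topological_space measure"
  assumes cpt: "compact (UNIV :: 'a set)" and \<mu>: "prob_space \<mu>" "sets \<mu> = sets borel"
  shows "mean (integral_mean \<mu>)"
  unfolding mean_def integral_mean_def
  using continuous_integrable[OF cpt \<mu>, where 'b = real] prob_space.prob_space[OF \<mu>(1)] by auto

lemma cmean_integral_mean:
  fixes \<mu> :: "'a::topological_space measure"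
  assumes "compact (UNIV :: 'a set)" "prob_space \<mu>" "sets \<mu> = sets borel" "cont f"
  shows "cmean (integral_mean \<mu>) f = (\<integral>x. f x \<partial>\<mu>)"
  using continuous_integrable[OF assms] by (simp add: cmean_def integral_mean_def complex_eq_iff)

section \<open>Spectral theory of convolution operators\<close>

locale invariant_mean =
  fixes J :: "('g::{topological_group_add, t2_space, second_countable_topology} \<Rightarrow> real) \<Rightarrow> real"
  assumes cpt: "compact (UNIV :: 'g set)"
    and mean: "mean J" and faithful: "faithful J"
    and left_invariant: "\<And>f a. cont f \<Longrightarrow> J (\<lambda>x. f (a + x)) = J f"
begin

definition ip :: "('g \<Rightarrow> complex) \<Rightarrow> ('g \<Rightarrow> complex) \<Rightarrow> complex" where
  "ip f g = cmean J (\<lambda>x. f x * cnj (g x))"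

definition nsq :: "('g \<Rightarrow> complex) \<Rightarrow> real" where
  "nsq f = J (\<lambda>x. (cmod (f x))\<^sup>2)"

lemma ip_add_left: "cont f \<Longrightarrow> cont g \<Longrightarrow> cont h \<Longrightarrow> ip (\<lambda>x. f x + g x) h = ip f h + ip g h"
  using cmean_add[OF mean, of "\<lambda>x. f x * cnj (h x)" "\<lambda>x. g x * cnj (h x)"]
  by (simp add: ip_def distrib_right continuous_on_mult continuous_on_cnj)

lemma ip_diff_left: "cont f \<Longrightarrow> cont g \<Longrightarrow> cont h \<Longrightarrow> ip (\<lambda>x. f x - g x) h = ip f h - ip g h"
  using cmean_diff[OF mean, of "\<lambda>x. f x * cnj (h x)" "\<lambda>x. g x * cnj (h x)"]
  by (simp add: ip_def left_diff_distrib continuous_on_mult continuous_on_cnj)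

lemma ip_scale_left: "cont f \<Longrightarrow> cont h \<Longrightarrow> ip (\<lambda>x. c * f x) h = c * ip f h"
  using cmean_cmult[OF mean, of "\<lambda>x. f x * cnj (h x)" c]
  by (simp add: ip_def mult.assoc continuous_on_mult continuous_on_cnj)

lemma ip_sum_left:
  assumes "\<And>i. i \<in> S \<Longrightarrow> cont (f i)" "cont h"
  shows "ip (\<lambda>x. \<Sum>i\<in>S. f i x) h = (\<Sum>i\<in>S. ip (f i) h)"
  unfolding ip_def sum_distrib_right
  by (rule cmean_sum[OF mean]) (use assms in \<open>auto intro!: continuous_intros\<close>)

lemma ip_cnj: "cont f \<Longrightarrow> cont g \<Longrightarrow> ip g f = cnj (ip f g)"
  using cmean_cnj[OF mean, of "\<lambda>x. f x * cnj (g x)"]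
  by (simp add: ip_def mult.commute continuous_on_mult continuous_on_cnj)

lemma ip_scale_right:
  assumes "cont f" "cont h" shows "ip f (\<lambda>x. c * h x) = cnj c * ip f h"
  using ip_cnj[of "\<lambda>x. c * h x" f] ip_scale_left[of h f c] ip_cnj[of h f] assms
  by (simp add: continuous_on_mult)

lemma ip_sum_right:
  assumes "\<And>i. i \<in> S \<Longrightarrow> cont (f i)" "cont h"
  shows "ip h (\<lambda>x. \<Sum>i\<in>S. f i x) = (\<Sum>i\<in>S. ip h (f i))"
proof -
  have "cont (\<lambda>x. \<Sum>i\<in>S. f i x)" using assms(1) by (intro continuous_on_sum)
  then have "ip h (\<lambda>x. \<Sum>i\<in>S. f i x) = cnj (ip (\<lambda>x. \<Sum>i\<in>S. f i x) h)"
    using assms(2) by (rule ip_cnj)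
  also have "ip (\<lambda>x. \<Sum>i\<in>S. f i x) h = (\<Sum>i\<in>S. ip (f i) h)"
    by (rule ip_sum_left[OF assms])
  also have "cnj (\<Sum>i\<in>S. ip (f i) h) = (\<Sum>i\<in>S. ip h (f i))"
    unfolding cnj_sum by (rule sum.cong[OF refl]) (use ip_cnj assms in metis)
  finally show ?thesis .
qed

lemma ip_zero_left [simp]: "ip (\<lambda>x. 0) h = 0" and ip_zero_right [simp]: "ip h (\<lambda>x. 0) = 0"
  using mean by (simp_all add: ip_def)

lemma ip_self: "ip f f = of_real (nsq f)"
  unfolding ip_def nsq_def complex_norm_square[symmetric] of_real_power[symmetric]
  by (rule cmean_of_real[OF mean])

lemma nsq_nonneg: "cont f \<Longrightarrow> 0 \<le> nsq f"
  unfolding nsq_def by (rule mean_nonneg[OF mean]) (auto intro!: continuous_intros)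

lemma nsq_eq_0D:
  assumes "nsq f = 0" "cont f" shows "f = (\<lambda>x. 0)"
proof -
  have "(\<lambda>x. (cmod (f x))\<^sup>2) = (\<lambda>x. 0)"
    by (rule faithfulD[OF faithful]) (use assms in \<open>auto simp: nsq_def intro!: continuous_intros\<close>)
  then show ?thesis by (simp add: fun_eq_iff)
qed

lemma nsq_scale:
  assumes "cont f" shows "nsq (\<lambda>x. c * f x) = (cmod c)\<^sup>2 * nsq f"
  using mean_cmult[OF mean, of "\<lambda>x. (cmod (f x))\<^sup>2" "(cmod c)\<^sup>2"] assms
  by (simp add: nsq_def norm_mult power_mult_distrib continuous_on_power continuous_on_norm)

lemma nsq_diff:
  assumes f: "cont f" and g: "cont g"
  shows "nsq (\<lambda>x. f x - g x) = nsq f - 2 * Re (ip f g) + nsq g"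
proof -
  have fg: "cont (\<lambda>x. f x - g x)" using f g by (intro continuous_intros)
  have 1: "ip h (\<lambda>x. f x - g x) = ip h f - ip h g" if "cont h" for h
    using ip_cnj[OF fg that] ip_diff_left[OF f g that] ip_cnj[OF f that] ip_cnj[OF g that] by simp
  have "complex_of_real (nsq (\<lambda>x. f x - g x)) = ip f f - ip f g - (ip g f - ip g g)"
    unfolding ip_self[symmetric] using ip_diff_left[OF f g fg] 1[OF f] 1[OF g] by simp
  also have "\<dots> = of_real (nsq f - 2 * Re (ip f g) + nsq g)"
    by (simp add: ip_cnj[OF f g] ip_self complex_eq_iff)
  finally show ?thesis by (simp only: of_real_eq_iff)
qed

lemma nsq_le_const:
  assumes "cont f" "\<And>x. cmod (f x) \<le> c" shows "nsq f \<le> c\<^sup>2"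
proof -
  have "nsq f \<le> J (\<lambda>x. c\<^sup>2)"
    unfolding nsq_def by (rule mean_mono[OF mean]) (use assms in \<open>auto intro!: continuous_intros power_mono\<close>)
  then show ?thesis using mean by simp
qed

lemma Re_ip_sq_le:
  assumes f: "cont f" and g: "cont g"
  shows "(Re (ip f g))\<^sup>2 \<le> nsq f * nsq g"
proof (cases "nsq g = 0")
  case True
  then show ?thesis using nsq_eq_0D[OF True g] by simp
next
  case False
  then have pos: "nsq g > 0" using nsq_nonneg[OF g] by simp
  define t where "t = Re (ip f g) / nsq g"
  have tg: "cont (\<lambda>x. of_real t * g x)" using g by (intro continuous_intros)
  have "0 \<le> nsq (\<lambda>x. f x - of_real t * g x)"
    by (rule nsq_nonneg, rule continuous_on_diff[OF f tg])
  also have "\<dots> = nsq f - 2 * t * Re (ip f g) + t\<^sup>2 * nsq g"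
    using nsq_diff[OF f tg] ip_scale_right[OF f g, of "of_real t"] nsq_scale[OF g, of "of_real t"] by simp
  also have "\<dots> = nsq f - (Re (ip f g))\<^sup>2 / nsq g"
    using pos by (simp add: t_def field_simps power2_eq_square)
  finally show ?thesis using pos by (simp add: field_simps)
qed

text \<open>The pointwise inequality \<open>t \<le> (1 + t^2) / 2\<close> avoids a square root. For
  functions of norm 1 the bound is 1, no worse than Cauchy-Schwarz; \<open>norm_K_sq_le\<close>
  later restores homogeneity.\<close>

lemma J_norm_le:
  assumes f: "cont f" shows "J (\<lambda>x. cmod (f x)) \<le> (1 + nsq f) / 2"
proof -
  have "J (\<lambda>x. cmod (f x)) \<le> J (\<lambda>x. 1 / 2 + 1 / 2 * (cmod (f x))\<^sup>2)"
  proof (rule mean_mono[OF mean])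
    fix x
    have "0 \<le> (1 - cmod (f x))\<^sup>2" by simp
    then show "cmod (f x) \<le> 1 / 2 + 1 / 2 * (cmod (f x))\<^sup>2" by (simp add: power2_eq_square algebra_simps)
  qed (use f in \<open>auto intro!: continuous_intros\<close>)
  also have "\<dots> = 1 / 2 + J (\<lambda>x. 1 / 2 * (cmod (f x))\<^sup>2)"
    using mean_add[OF mean continuous_on_const, of "\<lambda>x. 1 / 2 * (cmod (f x))\<^sup>2" "1/2"] mean_const[OF mean] f
    by (simp add: continuous_intros)
  also have "J (\<lambda>x. 1 / 2 * (cmod (f x))\<^sup>2) = 1 / 2 * nsq f"
    unfolding nsq_def by (rule mean_cmult[OF mean]) (use f in \<open>intro continuous_intros\<close>)
  also have "1 / 2 + 1 / 2 * nsq f = (1 + nsq f) / 2" by simp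
  finally show ?thesis .
qed

definition left_translate :: "'g \<Rightarrow> ('g \<Rightarrow> complex) \<Rightarrow> 'g \<Rightarrow> complex" where
  "left_translate a f = (\<lambda>x. f (- a + x))"

lemma cont_left_translate: "cont f \<Longrightarrow> cont (left_translate a f)"
  unfolding left_translate_def by (rule cont_translate)

lemma left_translate_add: "left_translate a (left_translate b f) = left_translate (a + b) f"
  by (simp add: left_translate_def minus_add add.assoc del: add_uminus_conv_diff)

lemma left_translate_0 [simp]: "left_translate 0 f = f"
  by (simp add: left_translate_def)

lemma cmean_left_translate: "cont f \<Longrightarrow> cmean J (\<lambda>x. f (a + x)) = cmean J f"
  using left_invariant[of "\<lambda>x. Re (f x)" a] left_invariant[of "\<lambda>x. Im (f x)" a]
  by (simp add: cmean_def continuous_on_Re continuous_on_Im)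

lemma ip_left_translate:
  assumes "cont f" "cont g" shows "ip (left_translate a f) (left_translate a g) = ip f g"
  using cmean_left_translate[of "\<lambda>x. f x * cnj (g x)" "- a"] assms
  by (simp add: ip_def left_translate_def continuous_on_mult continuous_on_cnj)

definition orthonormal :: "(nat \<Rightarrow> 'g \<Rightarrow> complex) \<Rightarrow> nat \<Rightarrow> bool" where
  "orthonormal e m \<longleftrightarrow> (\<forall>i<m. cont (e i)) \<and> (\<forall>i<m. \<forall>j<m. ip (e i) (e j) = (if i = j then 1 else 0))"

lemma orthonormal_cont: "orthonormal e m \<Longrightarrow> i < m \<Longrightarrow> cont (e i)"
  by (simp add: orthonormal_def)

lemma orthonormal_ip: "orthonormal e m \<Longrightarrow> i < m \<Longrightarrow> j < m \<Longrightarrow> ip (e i) (e j) = (if i = j then 1 else 0)"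
  by (simp add: orthonormal_def)

lemma orthonormal_nsq:
  assumes "orthonormal e m" "i < m" shows "nsq (e i) = 1"
proof -
  have "complex_of_real (nsq (e i)) = of_real 1"
    unfolding ip_self[symmetric] using orthonormal_ip[OF assms(1,2,2)] by simp
  then show ?thesis unfolding of_real_eq_iff .
qed

lemma cont_lincomb: "orthonormal e m \<Longrightarrow> cont (\<lambda>x. \<Sum>i<m. c i * e i x)"
  by (intro continuous_intros) (auto intro: orthonormal_cont)

lemma ip_lincomb:
  assumes e: "orthonormal e m" and j: "j < m"
  shows "ip (\<lambda>x. \<Sum>i<m. c i * e i x) (e j) = c j"
proof -
  have "ip (\<lambda>x. \<Sum>i<m. c i * e i x) (e j) = (\<Sum>i<m. ip (\<lambda>x. c i * e i x) (e j))"
    by (rule ip_sum_left) (use e j in \<open>auto intro!: continuous_intros intro: orthonormal_cont\<close>)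
  also have "\<dots> = (\<Sum>i<m. if i = j then c i else 0)"
    by (rule sum.cong) (use e j in \<open>auto simp: ip_scale_left orthonormal_cont orthonormal_ip\<close>)
  also have "\<dots> = c j" using j by simp
  finally show ?thesis .
qed

lemma nsq_lincomb:
  assumes e: "orthonormal e m"
  shows "nsq (\<lambda>x. \<Sum>i<m. c i * e i x) = (\<Sum>i<m. (cmod (c i))\<^sup>2)"
proof -
  let ?p = "\<lambda>x. \<Sum>i<m. c i * e i x"
  have "ip ?p ?p = (\<Sum>i<m. ip ?p (\<lambda>x. c i * e i x))"
    by (rule ip_sum_right) (use e cont_lincomb[OF e] in \<open>auto intro!: continuous_intros intro: orthonormal_cont\<close>)
  also have "\<dots> = (\<Sum>i<m. of_real ((cmod (c i))\<^sup>2))"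
  proof (rule sum.cong[OF refl])
    fix i assume "i \<in> {..<m}"
    then show "ip ?p (\<lambda>x. c i * e i x) = of_real ((cmod (c i))\<^sup>2)"
      unfolding complex_norm_square
      using ip_scale_right[OF cont_lincomb[OF e] orthonormal_cont[OF e], of i] ip_lincomb[OF e, of i]
      by (simp add: mult.commute)
  qed
  finally show ?thesis unfolding ip_self of_real_sum[symmetric] of_real_eq_iff .
qed

lemma nsq_minus_projection:
  assumes e: "orthonormal e m" and f: "cont f"
  shows "nsq (\<lambda>x. f x - (\<Sum>i<m. ip f (e i) * e i x)) = nsq f - (\<Sum>i<m. (cmod (ip f (e i)))\<^sup>2)"
proof -
  let ?p = "\<lambda>x. \<Sum>i<m. ip f (e i) * e i x"
  have "ip f ?p = (\<Sum>i<m. ip f (\<lambda>x. ip f (e i) * e i x))"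
    by (rule ip_sum_right) (use e f in \<open>auto intro!: continuous_intros intro: orthonormal_cont\<close>)
  also have "\<dots> = (\<Sum>i<m. of_real ((cmod (ip f (e i)))\<^sup>2))"
    unfolding complex_norm_square
    by (rule sum.cong)
      (use e f in \<open>auto simp: ip_scale_right orthonormal_cont mult.commute[of "cnj (ip f (e _))"]\<close>)
  finally have "Re (ip f ?p) = (\<Sum>i<m. (cmod (ip f (e i)))\<^sup>2)" by simp
  then show ?thesis
    using nsq_diff[OF f cont_lincomb[OF e, of "\<lambda>i. ip f (e i)"]] nsq_lincomb[OF e, of "\<lambda>i. ip f (e i)"] by simp
qed

lemma Bessel:
  assumes "orthonormal e m" "cont f"
  shows "(\<Sum>i<m. (cmod (ip f (e i)))\<^sup>2) \<le> nsq f"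
  using nsq_minus_projection[OF assms] nsq_nonneg[of "\<lambda>x. f x - (\<Sum>i<m. ip f (e i) * e i x)"]
    cont_lincomb[OF assms(1)] assms(2) by (simp add: continuous_on_diff)

definition function_subspace :: "('g \<Rightarrow> complex) set \<Rightarrow> bool" where
  "function_subspace V \<longleftrightarrow> (\<forall>f\<in>V. cont f) \<and> (\<lambda>x. 0) \<in> V \<and>
     (\<forall>f\<in>V. \<forall>g\<in>V. (\<lambda>x. f x + g x) \<in> V) \<and> (\<forall>c. \<forall>f\<in>V. (\<lambda>x. c * f x) \<in> V)"

lemma function_subspace_lincomb:
  fixes m :: nat
  assumes V: "function_subspace V" and "\<And>i. i < m \<Longrightarrow> e i \<in> V"
  shows "(\<lambda>x. \<Sum>i<m. c i * e i x) \<in> V"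
  using assms(2)
proof (induction m)
  case (Suc m)
  then show ?case using V by (auto simp: function_subspace_def)
qed (use V in \<open>simp add: function_subspace_def\<close>)

lemma function_subspace_diff:
  assumes V: "function_subspace V" and f: "f \<in> V" and g: "g \<in> V"
  shows "(\<lambda>x. f x - g x) \<in> V"
proof -
  have add: "\<And>f g. f \<in> V \<Longrightarrow> g \<in> V \<Longrightarrow> (\<lambda>x. f x + g x) \<in> V"
    and scale: "\<And>c f. f \<in> V \<Longrightarrow> (\<lambda>x. c * f x) \<in> V"
    using V by (auto simp: function_subspace_def)
  show ?thesis using add[OF f scale[OF g, of "-1"]] by simp
qed

definition orthonormal_basis :: "('g \<Rightarrow> complex) set \<Rightarrow> (nat \<Rightarrow> 'g \<Rightarrow> complex) \<Rightarrow> nat \<Rightarrow> bool" where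
  "orthonormal_basis V e d \<longleftrightarrow> orthonormal e d \<and> (\<forall>i<d. e i \<in> V) \<and>
     (\<forall>v\<in>V. v = (\<lambda>x. \<Sum>i<d. ip v (e i) * e i x))"

text \<open>Finite dimension enters as a bound on the length of orthonormal systems. A longest
  system spans, since a nonzero remainder after projection could be normalised and appended.\<close>

lemma ex_orthonormal_basis:
  assumes V: "function_subspace V"
    and bdd: "\<And>e m. orthonormal e m \<Longrightarrow> (\<And>i. i < m \<Longrightarrow> e i \<in> V) \<Longrightarrow> m \<le> B"
  obtains e d where "orthonormal_basis V e d"
proof -
  let ?P = "\<lambda>m. \<exists>e. orthonormal e m \<and> (\<forall>i<m. e i \<in> V)"
  have P0: "?P 0" by (simp add: orthonormal_def)
  define d where "d = (GREATEST m. ?P m)"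
  have le: "m \<le> B" if "?P m" for m using that bdd by blast
  have "?P d" unfolding d_def by (rule GreatestI_nat[of ?P 0 B]) (use P0 le in blast)+
  then obtain e where e: "orthonormal e d" "\<And>i. i < d \<Longrightarrow> e i \<in> V" by blast
  have "v = (\<lambda>x. \<Sum>i<d. ip v (e i) * e i x)" if v: "v \<in> V" for v
  proof (rule ccontr)
    assume ne: "v \<noteq> (\<lambda>x. \<Sum>i<d. ip v (e i) * e i x)"
    define p where "p x = (\<Sum>i<d. ip v (e i) * e i x)" for x
    define w where "w x = v x - p x" for x
    have pV: "p \<in> V" unfolding p_def[abs_def] by (rule function_subspace_lincomb[OF V e(2)])
    have wV: "w \<in> V" unfolding w_def[abs_def] by (rule function_subspace_diff[OF V v pV])
    have c: "cont v" "cont p" "cont w" using V v pV wV by (auto simp: function_subspace_def)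
    have "w \<noteq> (\<lambda>x. 0)" using ne by (auto simp: w_def p_def fun_eq_iff)
    then have "nsq w > 0" using nsq_eq_0D[of w] nsq_nonneg[of w] c by force
    define a where "a = complex_of_real (1 / sqrt (nsq w))"
    define u where "u x = a * w x" for x
    have uV: "u \<in> V" using V wV unfolding u_def[abs_def] function_subspace_def by blast
    have cu: "cont u" using V uV by (auto simp: function_subspace_def)
    have "nsq u = 1"
      using nsq_scale[OF c(3), of a] \<open>nsq w > 0\<close>
      by (simp add: u_def[abs_def] a_def power_divide norm_divide)
    then have uu: "ip u u = 1" by (simp add: ip_self)
    have "ip w (e j) = 0" if "j < d" for j
      using ip_diff_left[OF c(1,2) orthonormal_cont[OF e(1) that]] ip_lincomb[OF e(1) that, of "\<lambda>i. ip v (e i)"]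
      by (simp add: w_def[abs_def] p_def[abs_def])
    then have ue: "ip u (e j) = 0" if "j < d" for j
      using ip_scale_left[OF c(3) orthonormal_cont[OF e(1) that]] that by (simp add: u_def[abs_def])
    then have eu: "ip (e j) u = 0" if "j < d" for j
      using ip_cnj[OF cu orthonormal_cont[OF e(1) that]] that by simp
    have "orthonormal (e(d := u)) (Suc d)"
      unfolding orthonormal_def using e(1) cu uu ue eu
      by (auto simp: less_Suc_eq orthonormal_cont orthonormal_ip)
    moreover have "\<forall>i<Suc d. (e(d := u)) i \<in> V" using e(2) uV by (auto simp: less_Suc_eq)
    ultimately have "?P (Suc d)" by blast
    then have "Suc d \<le> d" unfolding d_def by (rule Greatest_le_nat[of ?P _ B]) (use le in blast)
    then show False by simp
  qed
  then have "orthonormal_basis V e d" using e by (auto simp: orthonormal_basis_def)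
  then show thesis by (rule that)
qed

text \<open>Count the squared moduli of all products of some \<open>e j\<close> with some
  \<open>b i\<close> in two ways: expansion in the basis gives \<open>m\<close>, Bessel's inequality
  gives at most \<open>d\<close>.\<close>

lemma orthonormal_card_le:
  assumes b: "orthonormal_basis V b d" and e: "orthonormal e m" "\<And>i. i < m \<Longrightarrow> e i \<in> V"
  shows "m \<le> d"
proof -
  have ob: "orthonormal b d" using b by (simp add: orthonormal_basis_def)
  have 1: "(\<Sum>i<d. (cmod (ip (e j) (b i)))\<^sup>2) = 1" if "j < m" for j
  proof -
    have "e j = (\<lambda>x. \<Sum>i<d. ip (e j) (b i) * b i x)"
      using b e(2)[OF that] by (simp add: orthonormal_basis_def)
    then have "nsq (e j) = (\<Sum>i<d. (cmod (ip (e j) (b i)))\<^sup>2)"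
      using nsq_lincomb[OF ob, of "\<lambda>i. ip (e j) (b i)"] by simp
    then show ?thesis using orthonormal_nsq[OF e(1) that] by simp
  qed
  have "real m = (\<Sum>j<m. \<Sum>i<d. (cmod (ip (e j) (b i)))\<^sup>2)" by (simp add: 1)
  also have "\<dots> = (\<Sum>i<d. \<Sum>j<m. (cmod (ip (e j) (b i)))\<^sup>2)" by (rule sum.swap)
  also have "\<dots> = (\<Sum>i<d. \<Sum>j<m. (cmod (ip (b i) (e j)))\<^sup>2)"
  proof (intro sum.cong refl)
    fix i j assume "i \<in> {..<d}" "j \<in> {..<m}"
    then show "(cmod (ip (e j) (b i)))\<^sup>2 = (cmod (ip (b i) (e j)))\<^sup>2"
      using ip_cnj[of "e j" "b i"] orthonormal_cont[OF ob] orthonormal_cont[OF e(1)] by simp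
  qed
  also have "\<dots> \<le> (\<Sum>i<d. nsq (b i))"
    by (rule sum_mono) (use Bessel[OF e(1)] orthonormal_cont[OF ob] in auto)
  also have "\<dots> = (\<Sum>i<d. 1)"
    by (rule sum.cong) (simp_all add: orthonormal_nsq[OF ob])
  finally show ?thesis by simp
qed

end

section \<open>Convolution operators with a symmetric kernel\<close>

locale convolution_kernel = invariant_mean J
  for J :: "('g::{topological_group_add, t2_space, second_countable_topology} \<Rightarrow> real) \<Rightarrow> real" +
  fixes k :: "'g \<Rightarrow> real"
  assumes k_cont: "cont k" and k_minus: "\<And>x. k (- x) = k x"
begin

definition K :: "('g \<Rightarrow> complex) \<Rightarrow> 'g \<Rightarrow> complex" where
  "K f x = cmean J (\<lambda>y. of_real (k (- x + y)) * f y)"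

lemma cont_kernel: "cont (\<lambda>p. complex_of_real (k (- fst p + snd p)))"
  by (intro continuous_intros continuous_on_compose2[OF k_cont]) auto

lemma cont_kernel_section: "cont (\<lambda>y. complex_of_real (k (- x + y)))"
  by (intro continuous_intros continuous_on_compose2[OF k_cont]) auto

lemma cont_kernel_mult: "cont f \<Longrightarrow> cont (\<lambda>y. complex_of_real (k (- x + y)) * f y)"
  by (intro continuous_on_mult cont_kernel_section)

lemma cont_K:
  assumes "cont f" shows "cont (K f)"
proof -
  have "cont (\<lambda>p. complex_of_real (k (- fst p + snd p)) * f (snd p))"
    by (intro continuous_on_mult cont_kernel continuous_on_compose2[OF assms] continuous_intros) auto
  from cmean_continuous[OF cpt mean this] show ?thesis by (simp add: K_def[abs_def])
qed

lemma K_diff: "cont f \<Longrightarrow> cont g \<Longrightarrow> K (\<lambda>x. f x - g x) = (\<lambda>x. K f x - K g x)"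
  using cmean_diff[OF mean cont_kernel_mult cont_kernel_mult] by (simp add: K_def fun_eq_iff right_diff_distrib)

lemma K_add: "cont f \<Longrightarrow> cont g \<Longrightarrow> K (\<lambda>x. f x + g x) = (\<lambda>x. K f x + K g x)"
  using cmean_add[OF mean cont_kernel_mult cont_kernel_mult] by (simp add: K_def fun_eq_iff distrib_left)

lemma K_scale:
  assumes "cont f" shows "K (\<lambda>x. c * f x) = (\<lambda>x. c * K f x)"
  using cmean_cmult[OF mean cont_kernel_mult[OF assms]] by (simp add: K_def fun_eq_iff mult.left_commute)

lemma K_zero [simp]: "K (\<lambda>x. 0) = (\<lambda>x. 0)"
  using mean by (simp add: K_def fun_eq_iff)

text \<open>The kernel sees only \<open>- x + y\<close>, which does not change when both points are
  left translated; left invariance of \<open>J\<close> does the rest.\<close>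

lemma K_left_translate:
  assumes "cont f" shows "K (left_translate a f) = left_translate a (K f)"
proof
  fix x
  have "K (left_translate a f) x = cmean J (\<lambda>y. of_real (k (- x + (a + y))) * f y)"
    using cmean_left_translate[of "\<lambda>y. of_real (k (- x + y)) * f (- a + y)" a]
      cont_kernel_mult[of "\<lambda>y. f (- a + y)" x] cont_translate(1)[OF assms, of "- a"]
    by (simp add: K_def left_translate_def add.assoc[symmetric])
  also have "(\<lambda>y. - x + (a + y)) = (\<lambda>y. - (- a + x) + y)"
    by (simp add: minus_add add.assoc del: add_uminus_conv_diff)
  then have "(\<lambda>y. of_real (k (- x + (a + y))) * f y) = (\<lambda>y. of_real (k (- (- a + x) + y)) * f y)"
    by (simp add: fun_eq_iff)
  finally show "K (left_translate a f) x = left_translate a (K f) x"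
    by (simp add: K_def left_translate_def)
qed

lemma k_swap: "k (- x + y) = k (- y + x)"
  using k_minus[of "- x + y"] by (simp add: minus_add)

lemma K_self_adjoint:
  assumes f: "cont f" and g: "cont g" shows "ip (K f) g = ip f (K g)"
proof -
  have \<phi>: "cont (\<lambda>p. complex_of_real (k (- fst p + snd p)) * f (snd p) * cnj (g (fst p)))"
    by (intro continuous_intros cont_kernel continuous_on_compose2[OF f] continuous_on_compose2[OF g]) auto
  have "ip (K f) g = cmean J (\<lambda>x. cmean J (\<lambda>y. of_real (k (- x + y)) * f y * cnj (g x)))"
  proof -
    have "cmean J (\<lambda>y. of_real (k (- x + y)) * f y * cnj (g x)) = K f x * cnj (g x)" for x
      using cmean_cmult[OF mean cont_kernel_mult[OF f], of "cnj (g x)" x]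
      by (simp add: K_def mult_ac)
    then show ?thesis by (simp add: ip_def)
  qed
  also have "\<dots> = cmean J (\<lambda>y. cmean J (\<lambda>x. of_real (k (- x + y)) * f y * cnj (g x)))"
    using cmean_Fubini[OF cpt cpt mean mean \<phi>] by simp
  also have "\<dots> = ip f (K g)"
  proof -
    have "cmean J (\<lambda>x. of_real (k (- x + y)) * f y * cnj (g x)) = f y * cnj (K g y)" for y
    proof -
      have "cnj (K g y) = cmean J (\<lambda>x. of_real (k (- y + x)) * cnj (g x))"
        using cmean_cnj[OF mean cont_kernel_mult[OF g], of y] by (simp add: K_def)
      then show ?thesis
        using cmean_cmult[OF mean cont_kernel_mult[of "\<lambda>x. cnj (g x)" y], of "f y"] g
        by (simp add: k_swap[of y] mult_ac continuous_on_cnj)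
    qed
    then show ?thesis by (simp add: ip_def)
  qed
  finally show ?thesis .
qed

definition kmax :: real where "kmax = (SUP x. \<bar>k x\<bar>)"

lemma k_le_kmax: "\<bar>k x\<bar> \<le> kmax"
  unfolding kmax_def using SUP_attained[OF cpt, of "\<lambda>x. \<bar>k x\<bar>"] continuous_on_rabs[OF k_cont] by metis

lemma kmax_nonneg: "0 \<le> kmax"
  using k_le_kmax[of 0] by simp

lemma norm_kernel_mean_le:
  assumes h: "cont h" and f: "cont f" and le: "\<And>y. \<bar>h y\<bar> \<le> e"
  shows "cmod (cmean J (\<lambda>y. of_real (h y) * f y)) \<le> e * ((1 + nsq f) / 2)"
proof -
  have c: "cont (\<lambda>y. complex_of_real (h y) * f y)" using h f by (intro continuous_intros)
  have "cmod (cmean J (\<lambda>y. of_real (h y) * f y)) \<le> J (\<lambda>y. cmod (of_real (h y) * f y))"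
    by (rule norm_cmean_le[OF mean c])
  also have "\<dots> \<le> J (\<lambda>y. e * cmod (f y))"
  proof (rule mean_mono[OF mean continuous_on_norm[OF c]])
    show "cont (\<lambda>y. e * cmod (f y))" using f by (intro continuous_intros)
    show "cmod (of_real (h y) * f y) \<le> e * cmod (f y)" for y
      using le[of y] by (simp add: norm_mult mult_right_mono)
  qed
  also have "\<dots> = e * J (\<lambda>y. cmod (f y))"
    by (rule mean_cmult[OF mean]) (use f in \<open>intro continuous_intros\<close>)
  also have "\<dots> \<le> e * ((1 + nsq f) / 2)"
    using J_norm_le[OF f] le[of 0] by (intro mult_left_mono) auto
  finally show ?thesis .
qed

lemma norm_K_le: "cont f \<Longrightarrow> cmod (K f x) \<le> kmax * ((1 + nsq f) / 2)"
  unfolding K_def by (rule norm_kernel_mean_le) (auto intro: cont_translate k_cont k_le_kmax)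

text \<open>The neighbourhood is chosen before \<open>f\<close>, and \<open>f\<close> enters the
  estimate only through \<open>nsq f\<close>. With Arzela-Ascoli this is the compactness of
  \<open>K\<close> with respect to the mean-square norm.\<close>

lemma K_equicontinuous:
  assumes e: "e > 0"
  shows "\<exists>U. open U \<and> x \<in> U \<and> (\<forall>z\<in>U. \<forall>f. cont f \<longrightarrow> cmod (K f z - K f x) \<le> e * ((1 + nsq f) / 2))"
proof -
  have "cont (\<lambda>p. k (- fst p + snd p))"
    by (intro continuous_on_compose2[OF k_cont] continuous_intros) auto
  then obtain U where U: "x \<in> U" "open U"
    "\<forall>z\<in>U \<inter> UNIV. \<forall>t\<in>UNIV. dist (k (- z + t)) (k (- x + t)) \<le> e"
    using continuous_on_prod_compactE[of UNIV UNIV "\<lambda>p. k (- fst p + snd p)" x e] cpt e by auto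
  have "cmod (K f z - K f x) \<le> e * ((1 + nsq f) / 2)" if "z \<in> U" "cont f" for z f
  proof -
    have "K f z - K f x = cmean J (\<lambda>y. of_real (k (- z + y) - k (- x + y)) * f y)"
      using cmean_diff[OF mean cont_kernel_mult cont_kernel_mult, of f f z x] that(2)
      by (simp add: K_def left_diff_distrib)
    also have "cmod \<dots> \<le> e * ((1 + nsq f) / 2)"
      by (rule norm_kernel_mean_le)
        (use U that in \<open>auto intro!: continuous_intros cont_translate k_cont simp: dist_real_def\<close>)
    finally show ?thesis .
  qed
  with U show ?thesis by blast
qed

text \<open>The bound \<open>norm_K_le\<close> is not homogeneous; applying it to the normalised
  function gives the homogeneous form.\<close>

lemma norm_K_sq_le:
  assumes f: "cont f" shows "(cmod (K f x))\<^sup>2 \<le> kmax\<^sup>2 * nsq f"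
proof (cases "nsq f = 0")
  case True
  then show ?thesis using nsq_eq_0D[OF True f] by simp
next
  case False
  then have pos: "nsq f > 0" using nsq_nonneg[OF f] by simp
  define a where "a = complex_of_real (1 / sqrt (nsq f))"
  have a: "(cmod a)\<^sup>2 = 1 / nsq f" using pos by (simp add: a_def norm_divide power_divide)
  have "nsq (\<lambda>x. a * f x) = 1" using nsq_scale[OF f, of a] pos by (simp add: a)
  then have "cmod (a * K f x) \<le> kmax"
    using norm_K_le[of "\<lambda>x. a * f x" x] K_scale[OF f, of a] f by (simp add: continuous_on_mult)
  then have "(cmod (a * K f x))\<^sup>2 \<le> kmax\<^sup>2" by (intro power_mono) auto
  then show ?thesis using pos by (simp add: norm_mult power_mult_distrib a field_simps)
qed

lemma nsq_K_le:
  assumes f: "cont f" shows "nsq (K f) \<le> kmax\<^sup>2 * nsq f"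
proof -
  have "cmod (K f x) \<le> sqrt (kmax\<^sup>2 * nsq f)" for x
    using norm_K_sq_le[OF f, of x] by (rule real_le_rsqrt)
  from nsq_le_const[OF cont_K[OF f] this] show ?thesis
    using nsq_nonneg[OF f] by simp
qed

lemma nsq_uniform_limit:
  assumes u: "\<And>n::nat. cont (u n)" and g: "cont g" and lim: "uniform_limit UNIV u g sequentially"
  shows "(\<lambda>n. nsq (u n)) \<longlonglongrightarrow> nsq g" "cont h \<Longrightarrow> (\<lambda>n. ip (u n) h) \<longlonglongrightarrow> ip g h"
    "uniform_limit UNIV (\<lambda>n. K (u n)) (K g) sequentially"
proof -
  have ev: "\<forall>\<^sub>F n in sequentially. \<forall>x\<in>UNIV. dist (u n x) (g x) < e" if "e > 0" for e
    using lim that unfolding uniform_limit_iff by blast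
  have bound: "cmod (cmean J (\<lambda>x. c x * (u n x - g x))) \<le> C * e"
    if n: "\<forall>x\<in>UNIV. dist (u n x) (g x) < e" and c: "cont c" and C: "\<And>x. cmod (c x) \<le> C" for n c C e
  proof (rule norm_cmean_le_const[OF mean])
    show "cont (\<lambda>x. c x * (u n x - g x))" using c u g by (intro continuous_intros)
    have "0 \<le> C" using C[of 0] norm_ge_zero order_trans by blast
    then show "cmod (c x * (u n x - g x)) \<le> C * e" for x
      unfolding norm_mult using n C[of x] by (intro mult_mono) (auto simp: dist_norm intro: less_imp_le)
  qed
  show lim_ip: "(\<lambda>n. ip (u n) h) \<longlonglongrightarrow> ip g h" if h: "cont h" for h
  proof (rule LIMSEQ_I)
    fix r :: real assume r: "r > 0"
    obtain C where C: "C > 0" "\<And>x. cmod (h x) \<le> C" using continuous_bounded[OF cpt h] by metis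
    have "\<forall>\<^sub>F n in sequentially. norm (ip (u n) h - ip g h) < r"
      using ev[of "r / (2 * C)"]
    proof (rule eventually_mono)
      fix n assume n: "\<forall>x\<in>UNIV. dist (u n x) (g x) < r / (2 * C)"
      have "ip (u n) h - ip g h = cmean J (\<lambda>x. cnj (h x) * (u n x - g x))"
        using ip_diff_left[OF u g h, of n] by (simp add: ip_def mult.commute)
      moreover have "cmod (cmean J (\<lambda>x. cnj (h x) * (u n x - g x))) \<le> C * (r / (2 * C))"
        by (rule bound[OF n]) (use h C in \<open>auto intro: continuous_intros\<close>)
      ultimately show "norm (ip (u n) h - ip g h) < r" using C r by simp
    qed (use r C in simp)
    then show "\<exists>N. \<forall>n\<ge>N. norm (ip (u n) h - ip g h) < r" by (simp add: eventually_sequentially)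
  qed
  have d: "(\<lambda>n. nsq (\<lambda>x. u n x - g x)) \<longlonglongrightarrow> 0"
  proof (rule LIMSEQ_I)
    fix r :: real assume r: "r > 0"
    have "\<forall>\<^sub>F n in sequentially. norm (nsq (\<lambda>x. u n x - g x) - 0) < r"
      using ev[of "sqrt (r / 2)"]
    proof (rule eventually_mono)
      fix n assume n: "\<forall>x\<in>UNIV. dist (u n x) (g x) < sqrt (r / 2)"
      have ug: "cont (\<lambda>x. u n x - g x)" using u g by (intro continuous_intros)
      have "nsq (\<lambda>x. u n x - g x) \<le> (sqrt (r / 2))\<^sup>2"
        by (rule nsq_le_const[OF ug]) (use n in \<open>auto simp: dist_norm intro: less_imp_le\<close>)
      then show "norm (nsq (\<lambda>x. u n x - g x) - 0) < r" using r nsq_nonneg[OF ug] by simp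
    qed (use r in simp)
    then show "\<exists>N. \<forall>n\<ge>N. norm (nsq (\<lambda>x. u n x - g x) - 0) < r" by (simp add: eventually_sequentially)
  qed
  \<comment> \<open>By \<open>nsq_diff\<close> this expression is \<open>nsq (u n)\<close>, so the
    norms converge because the distances and the inner products with \<open>g\<close> do.\<close>
  have "(\<lambda>n. nsq (\<lambda>x. u n x - g x) + 2 * Re (ip (u n) g) - nsq g) \<longlonglongrightarrow> 0 + 2 * Re (ip g g) - nsq g"
    by (intro tendsto_intros d lim_ip g)
  then show "(\<lambda>n. nsq (u n)) \<longlonglongrightarrow> nsq g"
    by (simp add: nsq_diff[OF u g] ip_self)
  show "uniform_limit UNIV (\<lambda>n. K (u n)) (K g) sequentially"
    unfolding uniform_limit_iff
  proof (intro allI impI)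
    fix r :: real assume r: "r > 0"
    have km: "kmax + 1 > 0" using kmax_nonneg by simp
    show "\<forall>\<^sub>F n in sequentially. \<forall>x\<in>UNIV. dist (K (u n) x) (K g x) < r"
      using ev[of "r / (2 * (kmax + 1))"]
    proof (rule eventually_mono)
      fix n assume n: "\<forall>x\<in>UNIV. dist (u n x) (g x) < r / (2 * (kmax + 1))"
      have "dist (K (u n) x) (K g x) < r" for x
      proof -
        have "K (u n) x - K g x = cmean J (\<lambda>y. of_real (k (- x + y)) * (u n y - g y))"
          using K_diff[OF u g, of n] by (simp add: K_def fun_eq_iff)
        moreover have "cmod (cmean J (\<lambda>y. of_real (k (- x + y)) * (u n y - g y))) \<le> (kmax + 1) * (r / (2 * (kmax + 1)))"
          by (rule bound[OF n cont_kernel_section]) (use k_le_kmax[of "- x + _"] in \<open>simp add: add_increasing2\<close>)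
        moreover have "(kmax + 1) * (r / (2 * (kmax + 1))) = r / 2" using km by (simp add: field_simps)
        ultimately show ?thesis using r by (simp add: dist_norm)
      qed
      then show "\<forall>x\<in>UNIV. dist (K (u n) x) (K g x) < r" by blast
    qed (use r km in simp)
  qed
qed

text \<open>Power iteration: with \<open>N n = \<parallel>K\<^sup>n F\<parallel>\<^sup>2\<close> the ratios \<open>N (n + 1) / N n\<close> increase to some \<open>q\<close> by the
  Cauchy--Schwarz inequality, and a uniform limit point of the normalised odd iterates is an
  eigenfunction of \<open>K\<^sup>2\<close> for \<open>q\<close>. It cannot be orthogonal to \<open>K F\<close>, since \<open>K\<^sup>2\<close> multiplies the inner product with
  it by \<open>q\<close>.\<close>

lemma ex_eigenfunction:
  assumes F: "cont F" and KF: "K F \<noteq> (\<lambda>x. 0)"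
  obtains q g where "q > 0" "cont g" "K (K g) = (\<lambda>x. of_real q * g x)" "ip (K F) g \<noteq> 0"
proof -
  define f where "f n = (K ^^ n) F" for n
  have f0: "f 0 = F" and fS: "f (Suc n) = K (f n)" for n by (simp_all add: f_def)
  have fc: "cont (f n)" for n by (induction n) (simp_all add: f0 fS F cont_K)
  define N where "N n = nsq (f n)" for n
  have N_nonneg: "N n \<ge> 0" for n by (simp add: N_def nsq_nonneg fc)
  have "ip (f n) (f (Suc (Suc n))) = ip (f (Suc n)) (f (Suc n))" for n
    using K_self_adjoint[OF fc fc, of n "Suc n"] by (simp add: fS)
  then have CS: "(N (Suc n))\<^sup>2 \<le> N n * N (Suc (Suc n))" for n
    using Re_ip_sq_le[OF fc fc, of n "Suc (Suc n)"] by (simp add: N_def ip_self)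
  have N1: "N (Suc 0) \<noteq> 0" using nsq_eq_0D[OF _ fc, of "Suc 0"] KF by (auto simp: N_def f0 fS)
  have N0: "N 0 \<noteq> 0"
  proof
    assume "N 0 = 0"
    then have "F = (\<lambda>x. 0)" using nsq_eq_0D[OF _ F] by (simp add: N_def f0)
    then show False using KF by simp
  qed
  \<comment> \<open>Cauchy-Schwarz propagates nonvanishing: two nonzero consecutive norms force the
    next one to be nonzero, so the iteration never dies.\<close>
  have "N n \<noteq> 0 \<and> N (Suc n) \<noteq> 0" for n
  proof (induction n)
    case (Suc n)
    then have "(N (Suc n))\<^sup>2 > 0" by simp
    then have "N n * N (Suc (Suc n)) > 0" using CS[of n] by linarith
    then show ?case using Suc by auto
  qed (use N0 N1 in auto)
  then have N_pos: "N n > 0" for n using N_nonneg[of n] by (simp add: less_le)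
  define \<rho> where "\<rho> n = N (Suc n) / N n" for n
  have \<rho>_pos: "\<rho> n > 0" for n using N_pos by (simp add: \<rho>_def)
  have "incseq \<rho>"
  proof (rule incseq_SucI)
    fix n
    have "N (Suc n) * N (Suc n) \<le> N (Suc (Suc n)) * N n" using CS[of n] by (simp add: power2_eq_square mult.commute)
    then show "\<rho> n \<le> \<rho> (Suc n)"
      unfolding \<rho>_def using N_pos by (simp add: frac_le_eq divide_le_eq le_divide_eq)
  qed
  moreover have "\<rho> n \<le> kmax\<^sup>2" for n
    using nsq_K_le[OF fc, of n] N_pos[of n] by (simp add: \<rho>_def N_def fS divide_le_eq)
  ultimately obtain q where q: "\<rho> \<longlonglongrightarrow> q" "\<And>n. \<rho> n \<le> q"
    using incseq_convergent by metis
  have q_pos: "q > 0" using q(2)[of 0] \<rho>_pos[of 0] by linarith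
  \<comment> \<open>Normalising the even iterates exhibits each \<open>u n\<close> as the image
    under \<open>K\<close> of a unit vector, and this yields the uniform bound and
    equicontinuity.\<close>
  define c where "c n = complex_of_real (1 / sqrt (N (2 * n)))" for n
  have cN: "(cmod (c n))\<^sup>2 = 1 / N (2 * n)" for n
    using N_pos[of "2 * n"] by (simp add: c_def norm_divide power_divide)
  define v where "v n x = c n * f (2 * n) x" for n x
  define u where "u n = K (v n)" for n
  have vc: "cont (v n)" for n unfolding v_def[abs_def] using fc by (intro continuous_intros)
  have v1: "nsq (v n) = 1" for n
    using nsq_scale[OF fc, of "c n" "2 * n"] N_pos[of "2 * n"] by (simp add: v_def[abs_def] cN N_def)
  have u_eq: "u n = (\<lambda>x. c n * f (Suc (2 * n)) x)" for n
    using K_scale[OF fc, of "c n" "2 * n"] by (simp add: u_def v_def[abs_def] fS)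
  have uc: "cont (u n)" for n unfolding u_def by (rule cont_K[OF vc])
  have bd: "norm (u n x) \<le> kmax" for n x
    using norm_K_le[OF vc, of n x] by (simp add: u_def v1)
  have equi: "\<exists>U. open U \<and> x \<in> U \<and> (\<forall>y\<in>U. \<forall>n. dist (u n y) (u n x) \<le> e)" if e0: "e > 0" for x e
  proof -
    obtain U where U: "open U" "x \<in> U" "\<And>z f. z \<in> U \<Longrightarrow> cont f \<Longrightarrow> cmod (K f z - K f x) \<le> e * ((1 + nsq f) / 2)"
      using K_equicontinuous[OF e0] by metis
    then show ?thesis using U(3)[OF _ vc] by (auto simp: u_def v1 dist_norm)
  qed
  obtain r g where r: "strict_mono (r :: nat \<Rightarrow> nat)" and g: "cont g"
    and lim: "uniform_limit UNIV (\<lambda>n. u (r n)) g sequentially"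
    by (rule Arzela_Ascoli_sequence[OF cpt uc bd equi])
  have Kuc: "cont (K (u n))" for n by (rule cont_K[OF uc])
  have Kgc: "cont (K g)" by (rule cont_K[OF g])
  note lim1 = nsq_uniform_limit(3)[OF uc g lim]
  note lim2 = nsq_uniform_limit(3)[OF Kuc Kgc lim1]
  have Ku: "K (u n) = (\<lambda>x. c n * f (Suc (Suc (2 * n))) x)" for n
    using K_scale[OF fc, of "c n" "Suc (2 * n)"] by (simp add: u_eq fS)
  have KKu: "K (K (u n)) = (\<lambda>x. c n * f (Suc (Suc (Suc (2 * n)))) x)" for n
    using K_scale[OF fc, of "c n" "Suc (Suc (2 * n))"] by (simp add: Ku fS)
  have nsqs: "nsq (u n) = \<rho> (2 * n)" "nsq (K (u n)) = \<rho> (2 * n) * \<rho> (Suc (2 * n))"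
    "nsq (K (K (u n))) = \<rho> (2 * n) * \<rho> (Suc (2 * n)) * \<rho> (Suc (Suc (2 * n)))" for n
    unfolding KKu unfolding Ku unfolding u_eq unfolding nsq_scale[OF fc] cN \<rho>_def
    using N_pos[of "Suc (2 * n)"] N_pos[of "Suc (Suc (2 * n))"] by (simp_all add: N_def)
  have \<rho>_lim: "(\<lambda>n. \<rho> (2 * r n)) \<longlonglongrightarrow> q" "(\<lambda>n. \<rho> (Suc (2 * r n))) \<longlonglongrightarrow> q" "(\<lambda>n. \<rho> (Suc (Suc (2 * r n)))) \<longlonglongrightarrow> q"
  proof -
    have sm: "strict_mono (\<lambda>n. 2 * r n)" "strict_mono (\<lambda>n. Suc (2 * r n))" "strict_mono (\<lambda>n. Suc (Suc (2 * r n)))"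
      using r by (auto simp: strict_mono_def)
    show "(\<lambda>n. \<rho> (2 * r n)) \<longlonglongrightarrow> q" "(\<lambda>n. \<rho> (Suc (2 * r n))) \<longlonglongrightarrow> q" "(\<lambda>n. \<rho> (Suc (Suc (2 * r n)))) \<longlonglongrightarrow> q"
      using LIMSEQ_subseq_LIMSEQ[OF q(1) sm(1)] LIMSEQ_subseq_LIMSEQ[OF q(1) sm(2)]
        LIMSEQ_subseq_LIMSEQ[OF q(1) sm(3)] by (simp_all add: o_def)
  qed
  have ng: "nsq g = q"
    by (rule LIMSEQ_unique[OF nsq_uniform_limit(1)[OF uc g lim]]) (simp add: nsqs \<rho>_lim)
  have nKg: "nsq (K g) = q * q"
    by (rule LIMSEQ_unique[OF nsq_uniform_limit(1)[OF Kuc Kgc lim1]])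
      (unfold nsqs, intro tendsto_mult \<rho>_lim)
  have nKKg: "nsq (K (K g)) = q * q * q"
    by (rule LIMSEQ_unique[OF nsq_uniform_limit(1)[OF cont_K[OF Kuc] cont_K[OF Kgc] lim2]])
      (unfold nsqs, intro tendsto_mult \<rho>_lim)
  have qg: "cont (\<lambda>x. of_real q * g x)" using g by (intro continuous_intros)
  have "ip (K (K g)) g = ip (K g) (K g)" by (rule K_self_adjoint[OF Kgc g])
  then have "ip (K (K g)) (\<lambda>x. of_real q * g x) = of_real (q * (q * q))"
    using ip_scale_right[OF cont_K[OF Kgc] g, of "of_real q"] by (simp add: ip_self nKg)
  \<comment> \<open>The three limits of norms give \<open>q^3 - 2 q q^2 + q^2 q = 0\<close>.\<close>
  then have "nsq (\<lambda>x. K (K g) x - of_real q * g x) = 0"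
    using nsq_diff[OF cont_K[OF Kgc] qg] nsq_scale[OF g, of "of_real q"]
    by (simp add: nKKg ng power2_eq_square)
  then have "(\<lambda>x. K (K g) x - of_real q * g x) = (\<lambda>x. 0)"
    by (rule nsq_eq_0D) (intro continuous_on_diff cont_K Kgc qg)
  then have KKg: "K (K g) = (\<lambda>x. of_real q * g x)" by (simp add: fun_eq_iff)
  have "ip (K F) g \<noteq> 0"
  proof
    assume 0: "ip (K F) g = 0"
    have "ip (f (Suc (2 * n))) g = 0" for n
    proof (induction n)
      case (Suc n)
      have "f (Suc (2 * Suc n)) = K (K (f (Suc (2 * n))))" by (simp add: fS)
      then have "ip (f (Suc (2 * Suc n))) g = ip (f (Suc (2 * n))) (K (K g))"
        using K_self_adjoint[OF cont_K[OF fc] g, of "Suc (2 * n)"] K_self_adjoint[OF fc Kgc, of "Suc (2 * n)"] by simp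
      also have "\<dots> = 0"
        unfolding KKg using ip_scale_right[OF fc g, of "Suc (2 * n)" "of_real q"] Suc by simp
      finally show ?case .
    qed (simp add: fS f0 0)
    then have "ip (u (r n)) g = 0" for n
      unfolding u_eq using ip_scale_left[OF fc g] by simp
    then have "(\<lambda>n. 0) \<longlonglongrightarrow> ip g g" using nsq_uniform_limit(2)[OF uc g lim g] by simp
    then have "ip g g = 0" by (simp add: LIMSEQ_const_iff)
    then show False using q_pos by (simp add: ip_self ng)
  qed
  with q_pos g KKg show thesis by (rule that)
qed

text \<open>Up to conjugation \<open>q e\<^sub>i(x)\<close> is the inner product of \<open>e\<^sub>i\<close> with the image under \<open>K\<close> of the kernel
  section at \<open>x\<close>: bound the sum of squares by Bessel's inequality and take the mean over \<open>x\<close>.\<close>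

lemma orthonormal_eigenfunctions_le:
  assumes e: "orthonormal e m" and q: "q > 0"
    and eig: "\<And>i. i < m \<Longrightarrow> K (K (e i)) = (\<lambda>x. of_real q * e i x)"
  shows "real m \<le> (kmax\<^sup>2)\<^sup>2 / q\<^sup>2"
proof -
  have le: "(\<Sum>i<m. q\<^sup>2 * (cmod (e i x))\<^sup>2) \<le> (kmax\<^sup>2)\<^sup>2" for x
  proof -
    define kx where "kx y = complex_of_real (k (- x + y))" for y
    have kxc: "cont kx" unfolding kx_def[abs_def] by (rule cont_kernel_section)
    have "q\<^sup>2 * (cmod (e i x))\<^sup>2 = (cmod (ip (K kx) (e i)))\<^sup>2" if i: "i < m" for i
    proof -
      note ec = orthonormal_cont[OF e i]
      have "ip (K (e i)) kx = K (K (e i)) x"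
        by (simp add: ip_def K_def[of "K (e i)"] kx_def mult.commute)
      also have "\<dots> = of_real q * e i x" by (simp add: eig[OF i])
      also have "ip (K (e i)) kx = ip (e i) (K kx)" by (rule K_self_adjoint[OF ec kxc])
      also have "\<dots> = cnj (ip (K kx) (e i))" by (rule ip_cnj[OF cont_K[OF kxc] ec])
      finally have "cmod (ip (K kx) (e i)) = cmod (of_real q * e i x)" by (metis complex_mod_cnj)
      then show ?thesis using q by (simp add: norm_mult power_mult_distrib)
    qed
    then have "(\<Sum>i<m. q\<^sup>2 * (cmod (e i x))\<^sup>2) = (\<Sum>i<m. (cmod (ip (K kx) (e i)))\<^sup>2)" by simp
    also have "\<dots> \<le> nsq (K kx)" by (rule Bessel[OF e cont_K[OF kxc]])
    also have "\<dots> \<le> kmax\<^sup>2 * nsq kx" by (rule nsq_K_le[OF kxc])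
    also have "\<dots> \<le> kmax\<^sup>2 * kmax\<^sup>2"
      by (intro mult_left_mono nsq_le_const[OF kxc]) (auto simp: kx_def k_le_kmax)
    finally show ?thesis by (simp add: power2_eq_square)
  qed
  have sc: "cont (\<lambda>x. (cmod (e i x))\<^sup>2)" if "i < m" for i
    using orthonormal_cont[OF e that] by (intro continuous_intros)
  have "J (\<lambda>x. \<Sum>i<n. q\<^sup>2 * (cmod (e i x))\<^sup>2) = real n * q\<^sup>2" if "n \<le> m" for n
    using that
  proof (induction n)
    case (Suc n)
    have c: "cont (\<lambda>x. q\<^sup>2 * (cmod (e i x))\<^sup>2)" if "i \<le> n" for i
      using sc[of i] Suc(2) that by (intro continuous_on_mult continuous_on_const) auto
    have "J (\<lambda>x. \<Sum>i<Suc n. q\<^sup>2 * (cmod (e i x))\<^sup>2) =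
      J (\<lambda>x. \<Sum>i<n. q\<^sup>2 * (cmod (e i x))\<^sup>2) + J (\<lambda>x. q\<^sup>2 * (cmod (e n x))\<^sup>2)"
      unfolding sum.lessThan_Suc by (rule mean_add[OF mean]) (auto intro!: continuous_on_sum c)
    also have "J (\<lambda>x. q\<^sup>2 * (cmod (e n x))\<^sup>2) = q\<^sup>2 * nsq (e n)"
      unfolding nsq_def by (rule mean_cmult[OF mean sc]) (use Suc in auto)
    also have "nsq (e n) = 1" by (rule orthonormal_nsq[OF e]) (use Suc in auto)
    finally show ?case using Suc by (simp add: algebra_simps)
  qed (use mean in simp)
  from this[of m] have "real m * q\<^sup>2 = J (\<lambda>x. \<Sum>i<m. q\<^sup>2 * (cmod (e i x))\<^sup>2)" by simp
  also have "\<dots> \<le> J (\<lambda>x. (kmax\<^sup>2)\<^sup>2)"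
    by (rule mean_mono[OF mean]) (use le sc in \<open>auto intro!: continuous_on_sum continuous_on_mult\<close>)
  finally have "real m * q\<^sup>2 \<le> (kmax\<^sup>2)\<^sup>2" using mean by simp
  then show ?thesis using q by (simp add: le_divide_eq)
qed

end

section \<open>Irreducible representations inside eigenspaces\<close>

context convolution_kernel
begin

text \<open>Left translations act on the eigenspace \<open>E\<close>, where orthonormal systems have
  bounded length. An invariant subspace of least dimension among those not orthogonal to
  \<open>K F\<close> is irreducible: for a proper nonzero invariant part, this part or its
  orthogonal complement would be smaller and still not orthogonal to \<open>K F\<close>. The unitary
  matrices \<open>R\<close> describe the translations in an orthonormal basis.\<close>

lemma ex_irreducible_eigenfunctions:
  assumes F: "cont F" and KF: "K F \<noteq> (\<lambda>x. 0)"
  obtains R q h c j where "irreducible_unitary_rep R" "q > 0" "j < rep_dim R" "cont h"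
    "K (K h) = (\<lambda>x. of_real q * h x)" "ip (K F) h \<noteq> 0"
    "h = (\<lambda>x. \<Sum>i<rep_dim R. R (- x) $$ (i, j) * c i)"
proof -
  obtain q g where q: "q > 0" and g: "cont g" "K (K g) = (\<lambda>x. of_real q * g x)" "ip (K F) g \<noteq> 0"
    using ex_eigenfunction[OF F KF] by metis
  have KFc: "cont (K F)" by (rule cont_K[OF F])
  define E where "E = {h. cont h \<and> K (K h) = (\<lambda>x. of_real q * h x)}"
  have E_sub: "function_subspace E"
    unfolding function_subspace_def E_def
    by (auto simp: K_add K_scale cont_K continuous_on_add continuous_on_mult distrib_left mult.left_commute)
  have E_inv: "left_translate a h \<in> E" if "h \<in> E" for a h
    using that by (auto simp: E_def K_left_translate cont_K cont_left_translate) (simp add: left_translate_def)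
  define B where "B = nat \<lfloor>(kmax\<^sup>2)\<^sup>2 / q\<^sup>2\<rfloor>"
  have bdd: "m \<le> B" if "orthonormal e m" "\<And>i. i < m \<Longrightarrow> e i \<in> E" for e m
  proof -
    have "real m \<le> (kmax\<^sup>2)\<^sup>2 / q\<^sup>2"
      by (rule orthonormal_eigenfunctions_le[OF that(1) q]) (use that(2) in \<open>simp add: E_def\<close>)
    then show ?thesis unfolding B_def by (simp add: le_nat_floor)
  qed
  define inv_sub where "inv_sub V \<longleftrightarrow> function_subspace V \<and> V \<subseteq> E \<and> (\<forall>a. \<forall>f\<in>V. left_translate a f \<in> V)" for V
  define good where "good V \<longleftrightarrow> inv_sub V \<and> (\<exists>f\<in>V. ip (K F) f \<noteq> 0)" for V
  have basis: "\<exists>e d. orthonormal_basis V e d" if "inv_sub V" for V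
  proof -
    have "m \<le> B" if "orthonormal e m" "\<And>i. i < m \<Longrightarrow> e i \<in> V" for e m
      using bdd that \<open>inv_sub V\<close> by (auto simp: inv_sub_def)
    then show ?thesis using ex_orthonormal_basis[of V B] \<open>inv_sub V\<close> unfolding inv_sub_def by metis
  qed
  define P where "P d \<longleftrightarrow> (\<exists>V e. good V \<and> orthonormal_basis V e d)" for d
  have "good E" using E_sub E_inv g by (auto simp: good_def inv_sub_def E_def)
  then have "\<exists>d. P d" using basis[of E] unfolding P_def good_def by metis
  define d where "d = (LEAST d. P d)"
  have "P d" unfolding d_def by (rule LeastI_ex) fact
  then obtain V e where V: "good V" and e: "orthonormal_basis V e d" unfolding P_def by blast
  have d_le: "d \<le> m" if "good W" "orthonormal_basis W b m" for W b m
    unfolding d_def by (rule Least_le) (use that P_def in blast)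
  have eo: "orthonormal e d" and eV: "\<And>i. i < d \<Longrightarrow> e i \<in> V"
    and e_exp: "\<And>v. v \<in> V \<Longrightarrow> v = (\<lambda>x. \<Sum>i<d. ip v (e i) * e i x)"
    using e by (auto simp: orthonormal_basis_def)
  have ec: "cont (e i)" if "i < d" for i using orthonormal_cont[OF eo that] .
  have V_sub: "function_subspace V" and VE: "V \<subseteq> E" and V_inv: "\<And>a f. f \<in> V \<Longrightarrow> left_translate a f \<in> V"
    using V by (auto simp: good_def inv_sub_def)
  have Vc: "cont v" if "v \<in> V" for v using V_sub that by (auto simp: function_subspace_def)
  have minimal: "W = {\<lambda>x. 0} \<or> W = V" if W: "inv_sub W" and WV: "W \<subseteq> V" for W
  proof (rule ccontr)
    assume ne: "\<not> (W = {\<lambda>x. 0} \<or> W = V)"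
    have W_sub: "function_subspace W" and W_inv: "\<And>a f. f \<in> W \<Longrightarrow> left_translate a f \<in> W"
      using W by (auto simp: inv_sub_def)
    define W' where "W' = {f \<in> V. \<forall>w\<in>W. ip f w = 0}"
    have W'_sub: "function_subspace W'"
      unfolding function_subspace_def W'_def
      using V_sub WV Vc by (auto simp: function_subspace_def ip_add_left ip_scale_left subset_iff)
    have "left_translate a f \<in> W'" if "f \<in> W'" for a f
    proof -
      have "ip (left_translate a f) w = 0" if "w \<in> W" for w
      proof -
        have "w = left_translate a (left_translate (- a) w)" by (simp add: left_translate_add)
        then have "ip (left_translate a f) w = ip f (left_translate (- a) w)"
          using ip_left_translate[of f "left_translate (- a) w" a] \<open>f \<in> W'\<close> that WV Vc
          by (simp add: W'_def subset_iff cont_left_translate)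
        then show ?thesis using \<open>f \<in> W'\<close> W_inv[OF that] by (simp add: W'_def)
      qed
      then show ?thesis using that V_inv by (simp add: W'_def)
    qed
    then have W'_inv: "inv_sub W'" using W'_sub VE by (auto simp: inv_sub_def W'_def)
    obtain b m where b: "orthonormal_basis W b m" using basis[OF W] by blast
    obtain b' m' where b': "orthonormal_basis W' b' m'" using basis[OF W'_inv] by blast
    have bo: "orthonormal b m" and bW: "\<And>i. i < m \<Longrightarrow> b i \<in> W"
      and b_exp: "\<And>v. v \<in> W \<Longrightarrow> v = (\<lambda>x. \<Sum>i<m. ip v (b i) * b i x)"
      using b by (auto simp: orthonormal_basis_def)
    have bo': "orthonormal b' m'" and bW': "\<And>i. i < m' \<Longrightarrow> b' i \<in> W'"
      and b_exp': "\<And>v. v \<in> W' \<Longrightarrow> v = (\<lambda>x. \<Sum>i<m'. ip v (b' i) * b' i x)"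
      using b' by (auto simp: orthonormal_basis_def)
    define p where "p v x = (\<Sum>i<m. ip v (b i) * b i x)" for v x
    have pW: "p v \<in> W" for v unfolding p_def[abs_def] by (rule function_subspace_lincomb[OF W_sub bW])
    have pW': "(\<lambda>x. v x - p v x) \<in> W'" if v: "v \<in> V" for v
    proof -
      have pV: "p v \<in> V" using pW WV by blast
      have dV: "(\<lambda>x. v x - p v x) \<in> V" by (rule function_subspace_diff[OF V_sub v pV])
      have 0: "ip (\<lambda>x. v x - p v x) (b i) = 0" if "i < m" for i
        using ip_diff_left[OF Vc[OF v] Vc[OF pV] orthonormal_cont[OF bo that]]
          ip_lincomb[OF bo that, of "\<lambda>i. ip v (b i)"] by (simp add: p_def[abs_def])
      have "ip (\<lambda>x. v x - p v x) w = 0" if "w \<in> W" for w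
      proof -
        have "ip (\<lambda>x. v x - p v x) w = ip (\<lambda>x. v x - p v x) (\<lambda>x. \<Sum>i<m. ip w (b i) * b i x)"
          using b_exp[OF that] by simp
        also have "\<dots> = (\<Sum>i<m. ip (\<lambda>x. v x - p v x) (\<lambda>x. ip w (b i) * b i x))"
          by (rule ip_sum_right)
            (use orthonormal_cont[OF bo] Vc[OF dV] in \<open>auto intro!: continuous_on_mult continuous_on_const\<close>)
        also have "\<dots> = 0"
          by (rule sum.neutral) (use 0 ip_scale_right[OF Vc[OF dV] orthonormal_cont[OF bo]] in auto)
        finally show ?thesis .
      qed
      with dV show ?thesis by (simp add: W'_def)
    qed
    define f where "f i = (if i < m then b i else b' (i - m))" for i
    have WW': "ip w' w = 0" "ip w w' = 0" if "w \<in> W" "w' \<in> W'" for w w'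
      using that ip_cnj[of w' w] WV Vc by (auto simp: W'_def)
    have "orthonormal f (m + m')"
      unfolding orthonormal_def
    proof (intro conjI allI impI)
      fix i assume i: "i < m + m'"
      then show "cont (f i)" using orthonormal_cont[OF bo] orthonormal_cont[OF bo'] by (simp add: f_def)
      fix j assume j: "j < m + m'"
      show "ip (f i) (f j) = (if i = j then 1 else 0)"
        using i j orthonormal_ip[OF bo, of i j] orthonormal_ip[OF bo', of "i - m" "j - m"]
          WW'[OF bW[of i] bW'[of "j - m"]] WW'[OF bW[of j] bW'[of "i - m"]]
        by (auto simp: f_def)
    qed
    moreover have "f i \<in> V" if "i < m + m'" for i
      using that bW[of i] bW'[of "i - m"] WV by (auto simp: f_def W'_def)
    ultimately have mm: "m + m' \<le> d" by (rule orthonormal_card_le[OF e])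
    have "(\<lambda>x. 0) \<in> W" using W_sub by (simp add: function_subspace_def)
    have "m \<noteq> 0"
    proof
      assume "m = 0"
      then have "v = (\<lambda>x. 0)" if "v \<in> W" for v using b_exp[OF that] by simp
      then have "W = {\<lambda>x. 0}" using \<open>(\<lambda>x. 0) \<in> W\<close> by blast
      then show False using ne by blast
    qed
    have "m' \<noteq> 0"
    proof
      assume "m' = 0"
      then have "(\<lambda>x. v x - p v x) = (\<lambda>x. 0)" if "v \<in> V" for v using b_exp'[OF pW'[OF that]] by simp
      then have "v = p v" if "v \<in> V" for v using that by (simp add: fun_eq_iff)
      then have "V \<subseteq> W" using pW by (metis subsetI)
      then show False using ne WV by blast
    qed
    \<comment> \<open>Both parts are nonzero and \<open>m + m' \<le> d\<close>, so each is smaller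
      than the minimal dimension. Hence \<open>K F\<close> is orthogonal to both, and so to their
      sum \<open>V\<close>.\<close>
    have "\<not> good W" using d_le[OF _ b] mm \<open>m' \<noteq> 0\<close> by auto
    then have z: "ip (K F) w = 0" if "w \<in> W" for w using W that by (auto simp: good_def)
    have "\<not> good W'" using d_le[OF _ b'] mm \<open>m \<noteq> 0\<close> by auto
    then have z': "ip (K F) w = 0" if "w \<in> W'" for w using W'_inv that by (auto simp: good_def)
    have "ip (K F) v = 0" if v: "v \<in> V" for v
    proof -
      have c: "cont v" "cont (p v)" using Vc v pW WV by auto
      then have "ip (\<lambda>x. v x - p v x) (K F) = ip v (K F) - ip (p v) (K F)" by (rule ip_diff_left[OF _ _ KFc])
      moreover have "ip (p v) (K F) = 0" using z[OF pW] ip_cnj[OF KFc c(2)] by simp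
      moreover have "ip (\<lambda>x. v x - p v x) (K F) = 0"
        using z'[OF pW'[OF v]] ip_cnj[OF KFc, of "\<lambda>x. v x - p v x"] c by (simp add: continuous_on_diff)
      ultimately show ?thesis using ip_cnj[OF c(1) KFc] by simp
    qed
    then show False using V by (auto simp: good_def)
  qed
  define R where "R a = mat d d (\<lambda>(i, j). ip (left_translate a (e j)) (e i))" for a
  have Rc: "R a \<in> carrier_mat d d" for a by (simp add: R_def)
  have R_ij: "R a $$ (i, j) = ip (left_translate a (e j)) (e i)" if "i < d" "j < d" for a i j
    using that by (simp add: R_def)
  have dim: "rep_dim R = d" by (simp add: rep_dim_def R_def)
  have L_exp: "left_translate a (e j) = (\<lambda>x. \<Sum>i<d. R a $$ (i, j) * e i x)" if "j < d" for a j
    using e_exp[OF V_inv[OF eV[OF that]], of a] that by (simp add: R_ij)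
  have Lc: "cont (left_translate a (e j))" if "j < d" for a j by (rule cont_left_translate[OF ec[OF that]])
  have L_lin: "left_translate a (\<lambda>x. \<Sum>j<d. s j * e j x) = (\<lambda>x. \<Sum>i<d. (\<Sum>j<d. R a $$ (i, j) * s j) * e i x)" for a s
  proof
    fix x
    have "left_translate a (\<lambda>x. \<Sum>j<d. s j * e j x) x = (\<Sum>j<d. s j * left_translate a (e j) x)"
      by (simp add: left_translate_def)
    also have "\<dots> = (\<Sum>j<d. \<Sum>i<d. R a $$ (i, j) * s j * e i x)"
      by (rule sum.cong) (simp_all add: L_exp sum_distrib_left mult_ac)
    also have "\<dots> = (\<Sum>i<d. (\<Sum>j<d. R a $$ (i, j) * s j) * e i x)"
      by (subst sum.swap) (simp add: sum_distrib_right)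
    finally show "left_translate a (\<lambda>x. \<Sum>j<d. s j * e j x) x = (\<Sum>i<d. (\<Sum>j<d. R a $$ (i, j) * s j) * e i x)" .
  qed
  have R0: "R 0 = 1\<^sub>m d"
    by (rule eq_matI) (auto simp: R_ij orthonormal_ip[OF eo], auto simp: R_def)
  have R_add: "R (a + b) = R a * R b" for a b
  proof (rule eq_matI)
    fix i j assume "i < dim_row (R a * R b)" "j < dim_col (R a * R b)"
    then have ij: "i < d" "j < d" by (auto simp: R_def)
    have "left_translate (a + b) (e j) = left_translate a (\<lambda>x. \<Sum>k<d. R b $$ (k, j) * e k x)"
      using L_exp[OF ij(2), of b] by (simp flip: left_translate_add)
    also have "\<dots> = (\<lambda>x. \<Sum>l<d. (\<Sum>k<d. R a $$ (l, k) * R b $$ (k, j)) * e l x)" by (rule L_lin)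
    finally have "R (a + b) $$ (i, j) = (\<Sum>k<d. R a $$ (i, k) * R b $$ (k, j))"
      using ij ip_lincomb[OF eo ij(1), of "\<lambda>l. \<Sum>k<d. R a $$ (l, k) * R b $$ (k, j)"] by (simp add: R_ij)
    then show "R (a + b) $$ (i, j) = (R a * R b) $$ (i, j)"
      using ij Rc[of a] Rc[of b] by (simp add: scalar_prod_def atLeast0LessThan)
  qed (auto simp: R_def)
  have R_adj: "mat_adjoint (R a) = R (- a)" for a
  proof (rule eq_matI)
    fix i j assume "i < dim_row (R (- a))" "j < dim_col (R (- a))"
    then have ij: "i < d" "j < d" by (auto simp: R_def)
    have "ip (left_translate (- a) (e j)) (e i) =
      ip (left_translate a (left_translate (- a) (e j))) (left_translate a (e i))"
      by (rule ip_left_translate[OF Lc[OF ij(2)] ec[OF ij(1)], symmetric])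
    also have "\<dots> = cnj (ip (left_translate a (e i)) (e j))"
      using ip_cnj[OF Lc[OF ij(1)] ec[OF ij(2)], of a] by (simp add: left_translate_add)
    finally show "mat_adjoint (R a) $$ (i, j) = R (- a) $$ (i, j)"
      using ij Rc[of a] by (simp add: mat_adjoint_index R_ij)
  qed (auto simp: R_def)
  have R_unitary: "unitary_mat d (R a)" for a
    unfolding unitary_mat_def R_adj R_add[symmetric] using Rc by (simp add: R0)
  have R_cont: "continuous_on UNIV (\<lambda>a. R a $$ (i, j))" if "i < d" "j < d" for i j
  proof -
    have "cont (\<lambda>p. e j (- fst p + snd p) * cnj (e i (snd p)))"
      by (intro continuous_intros continuous_on_compose2[OF ec] that) auto
    from cmean_continuous[OF cpt mean this] show ?thesis
      using that by (simp add: R_ij ip_def left_translate_def)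
  qed
  have R_rep: "unitary_rep R"
    unfolding unitary_rep_def dim using R_unitary R0 R_add R_cont by blast
  obtain f where f: "f \<in> V" "ip (K F) f \<noteq> 0" using V by (auto simp: good_def)
  \<comment> \<open>Passing from \<open>f\<close> to a single basis vector: its translates are
    described by one column of \<open>R\<close>, which is the form demanded of
    \<open>h\<close>.\<close>
  have "ip (K F) f = (\<Sum>j<d. ip (K F) (\<lambda>x. ip f (e j) * e j x))"
    by (subst e_exp[OF f(1)], rule ip_sum_right)
      (use ec KFc in \<open>auto intro!: continuous_on_mult continuous_on_const\<close>)
  then obtain j where j: "j < d" "ip (K F) (\<lambda>x. ip f (e j) * e j x) \<noteq> 0"
    using f(2) by (metis (no_types, lifting) lessThan_iff sum.neutral)
  then have jn: "ip (K F) (e j) \<noteq> 0" using ip_scale_right[OF KFc ec[OF j(1)]] by auto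
  have irr: "S = {0\<^sub>v d} \<or> S = carrier_vec d"
    if S: "VectorSpace.subspace class_ring S (module_vec TYPE(complex) d)"
      and S_inv: "\<And>a s. s \<in> S \<Longrightarrow> R a *\<^sub>v s \<in> S" for S
  proof -
    have S': "S \<subseteq> carrier_vec d" "0\<^sub>v d \<in> S" "\<And>v w. v \<in> S \<Longrightarrow> w \<in> S \<Longrightarrow> v + w \<in> S"
      "\<And>c v. v \<in> S \<Longrightarrow> c \<cdot>\<^sub>v v \<in> S"
      using S by (auto simp: subspace_module_vec_iff)
    \<comment> \<open>The coordinate isomorphism from vectors onto \<open>V\<close>. It intertwines
      \<open>R\<close> with left translation (\<open>\<Phi>_L\<close>), so an invariant space of
      vectors becomes an invariant subspace of \<open>V\<close>, to which \<open>minimal\<close>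
      applies.\<close>
    define \<Phi> where "\<Phi> s x = (\<Sum>i<d. s $ i * e i x)" for s :: "complex vec" and x
    have \<Phi>_ip: "ip (\<Phi> s) (e i) = s $ i" if "i < d" for s i
      unfolding \<Phi>_def[abs_def] by (rule ip_lincomb[OF eo that])
    have \<Phi>_V: "\<Phi> s \<in> V" for s unfolding \<Phi>_def[abs_def] by (rule function_subspace_lincomb[OF V_sub eV])
    have \<Phi>_inj: "s = t" if "\<Phi> s = \<Phi> t" "s \<in> carrier_vec d" "t \<in> carrier_vec d" for s t
      using that \<Phi>_ip by (intro eq_vecI) (auto, metis)
    have \<Phi>_add: "(\<lambda>x. \<Phi> s x + \<Phi> t x) = \<Phi> (s + t)" if "s \<in> carrier_vec d" "t \<in> carrier_vec d" for s t
      using that by (simp add: \<Phi>_def fun_eq_iff distrib_right sum.distrib)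
    have \<Phi>_scale: "(\<lambda>x. c * \<Phi> s x) = \<Phi> (c \<cdot>\<^sub>v s)" if "s \<in> carrier_vec d" for c s
      using that by (simp add: \<Phi>_def fun_eq_iff sum_distrib_left mult.assoc)
    have \<Phi>_0: "\<Phi> (0\<^sub>v d) = (\<lambda>x. 0)" by (simp add: \<Phi>_def fun_eq_iff)
    have \<Phi>_L: "left_translate a (\<Phi> s) = \<Phi> (R a *\<^sub>v s)" if "s \<in> carrier_vec d" for a s
    proof -
      have "(R a *\<^sub>v s) $ i = (\<Sum>j<d. R a $$ (i, j) * s $ j)" if "i < d" for i
        using that \<open>s \<in> carrier_vec d\<close> Rc[of a] by (simp add: scalar_prod_def atLeast0LessThan)
      then show ?thesis using L_lin[of a "\<lambda>j. s $ j"] by (simp add: \<Phi>_def[abs_def])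
    qed
    have "inv_sub (\<Phi> ` S)"
      unfolding inv_sub_def function_subspace_def
    proof (intro conjI ballI allI)
      show "\<Phi> ` S \<subseteq> E" using \<Phi>_V VE by blast
      show "(\<lambda>x. 0) \<in> \<Phi> ` S" using S'(2) \<Phi>_0 by (metis imageI)
      fix f assume "f \<in> \<Phi> ` S"
      then obtain s where s: "s \<in> S" "s \<in> carrier_vec d" "f = \<Phi> s" using S'(1) by blast
      show "cont f" using Vc \<Phi>_V s by blast
      show "(\<lambda>x. c * f x) \<in> \<Phi> ` S" for c using \<Phi>_scale[OF s(2)] S'(4)[OF s(1)] s(3) by blast
      show "left_translate a f \<in> \<Phi> ` S" for a using \<Phi>_L[OF s(2)] S_inv[OF s(1)] s(3) by blast
      fix h assume "h \<in> \<Phi> ` S"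
      then obtain t where t: "t \<in> S" "t \<in> carrier_vec d" "h = \<Phi> t" using S'(1) by blast
      show "(\<lambda>x. f x + h x) \<in> \<Phi> ` S" using \<Phi>_add[OF s(2) t(2)] S'(3)[OF s(1) t(1)] s(3) t(3) by blast
    qed
    then consider "\<Phi> ` S = {\<lambda>x. 0}" | "\<Phi> ` S = V" using minimal \<Phi>_V by blast
    then show ?thesis
    proof cases
      case 1
      have "s = 0\<^sub>v d" if "s \<in> S" for s
        using 1 that S'(1) \<Phi>_0 by (intro \<Phi>_inj) auto
      then show ?thesis using S'(2) by blast
    next
      case 2
      have "v \<in> S" if "v \<in> carrier_vec d" for v
      proof -
        have "\<Phi> v \<in> \<Phi> ` S" using 2 \<Phi>_V by simp
        then obtain s where "s \<in> S" "\<Phi> v = \<Phi> s" by blast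
        then show ?thesis using \<Phi>_inj[of v s] that S'(1) by blast
      qed
      then show ?thesis using S'(1) by blast
    qed
  qed
  have "irreducible_unitary_rep R"
    unfolding irreducible_unitary_rep_def dim
  proof (intro conjI allI impI)
    fix S assume "VectorSpace.subspace class_ring S (module_vec TYPE(complex) d) \<and> (\<forall>g. \<forall>w\<in>S. R g *\<^sub>v w \<in> S)"
    then show "S = {0\<^sub>v d} \<or> S = carrier_vec d" by (intro irr) auto
  qed (use R_rep j(1) in auto)
  \<comment> \<open>Evaluating the translate by \<open>- x\<close> at the unit recovers the value at
    \<open>x\<close>, so the constants \<open>c i\<close> are the values \<open>e i 0\<close>. The
    argument \<open>- x\<close> of \<open>R\<close> matches the one in the Fourier
    transform.\<close>
  moreover have "e j = (\<lambda>x. \<Sum>i<rep_dim R. R (- x) $$ (i, j) * e i 0)"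
  proof
    fix x
    have "e j x = left_translate (- x) (e j) 0" by (simp add: left_translate_def)
    then show "e j x = (\<Sum>i<rep_dim R. R (- x) $$ (i, j) * e i 0)" by (simp add: L_exp[OF j(1)] dim)
  qed
  moreover have "K (K (e j)) = (\<lambda>x. of_real q * e j x)" using eV[OF j(1)] VE by (auto simp: E_def)
  moreover have "j < rep_dim R" using j(1) dim by simp
  ultimately show thesis using q ec[OF j(1)] jn by (intro that)
qed

end

section \<open>Injectivity of the Fourier transform and convolution regularity\<close>

lemma compact_t2_separating_point:
  fixes S :: "'a::t2_space set"
  assumes cpt: "compact (UNIV :: 'a set)" and S: "closed S" and x: "x \<notin> S"
  obtains f :: "'a \<Rightarrow> real" where "cont f" "\<And>y. 0 \<le> f y" "\<And>y. f y \<le> 1" "\<And>y. y \<in> S \<Longrightarrow> f y = 0" "f x = 1"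
proof (rule compact_t2_separating_function[OF cpt S, of "{x}"])
  show "closed {x}" "S \<inter> {x} = {}" using x by auto
  fix f :: "'a \<Rightarrow> real"
  assume f: "cont f" "\<And>y. 0 \<le> f y" "\<And>y. f y \<le> 1" "\<And>y. y \<in> S \<Longrightarrow> f y = 0" "\<And>y. y \<in> {x} \<Longrightarrow> f y = 1"
  show thesis by (rule that[OF f(1-4)]) (simp_all add: f(5))
qed

lemma cmean_integral_mean_sum:
  fixes \<mu> :: "'g::topological_space measure"
  assumes "compact (UNIV :: 'g set)" "prob_space \<mu>" "sets \<mu> = sets borel" "\<And>i. i < m \<Longrightarrow> cont (f i)"
  shows "cmean (integral_mean \<mu>) (\<lambda>x. \<Sum>i<m. f i x * c i) = (\<Sum>i<m. (\<integral>x. f i x \<partial>\<mu>) * c i)"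
proof -
  have M: "mean (integral_mean \<mu>)" by (rule mean_integral_mean[OF assms(1-3)])
  have "cmean (integral_mean \<mu>) (\<lambda>x. \<Sum>i<m. f i x * c i) = (\<Sum>i<m. cmean (integral_mean \<mu>) (\<lambda>x. f i x * c i))"
    by (rule cmean_sum[OF M]) (use assms(4) in \<open>auto intro!: continuous_on_mult continuous_on_const\<close>)
  also have "\<dots> = (\<Sum>i<m. (\<integral>x. f i x \<partial>\<mu>) * c i)"
  proof (rule sum.cong[OF refl])
    fix i assume "i \<in> {..<m}"
    then show "cmean (integral_mean \<mu>) (\<lambda>x. f i x * c i) = (\<integral>x. f i x \<partial>\<mu>) * c i"
      using cmean_cmult[OF M assms(4), of i "c i"] cmean_integral_mean[OF assms(1-3) assms(4), of i]
      by (simp add: mult.commute)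
  qed
  finally show ?thesis .
qed

lemma unitary_rep_continuous_inverse:
  assumes "unitary_rep \<pi>" "i < rep_dim \<pi>" "j < rep_dim \<pi>"
  shows "cont (\<lambda>g. \<pi> (- g) $$ (i, j))"
  using assms by (intro cont_translate(3)) (simp add: unitary_rep_def)

text \<open>Smoothing by \<open>k\<close> replaces the difference of the two measures, in general
  not given by a function, by the continuous \<open>F\<close>: by Fubini, its value at
  \<open>K h\<close> is the inner product of \<open>h\<close> with \<open>F\<close>. This identity
  \<open>D\<close> is used for \<open>K h\<close>, for \<open>F\<close> itself and finally for
  \<open>f\<close>.\<close>

lemma (in convolution_kernel) cmean_K_eq:
  fixes \<mu>\<^sub>1 \<mu>\<^sub>2 :: "'g measure"
  assumes \<mu>1: "prob_space \<mu>\<^sub>1" "sets \<mu>\<^sub>1 = sets borel" and \<mu>2: "prob_space \<mu>\<^sub>2" "sets \<mu>\<^sub>2 = sets borel"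
    and eq: "\<And>\<pi>. irreducible_unitary_rep \<pi> \<Longrightarrow> fourier_transform \<mu>\<^sub>1 \<pi> = fourier_transform \<mu>\<^sub>2 \<pi>"
    and f: "cont f"
  shows "cmean (integral_mean \<mu>\<^sub>1) (K f) = cmean (integral_mean \<mu>\<^sub>2) (K f)"
proof -
  let ?M1 = "integral_mean \<mu>\<^sub>1" and ?M2 = "integral_mean \<mu>\<^sub>2"
  note M1 = mean_integral_mean[OF cpt \<mu>1] and M2 = mean_integral_mean[OF cpt \<mu>2]
  define G where "G M y = cmean M (\<lambda>x. complex_of_real (k (- x + y)))" for M y
  have swapped: "cont (\<lambda>p. complex_of_real (k (- snd p + fst p)))"
    by (intro continuous_intros continuous_on_compose2[OF k_cont]) auto
  have Gc: "cont (G M)" if "mean M" for M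
    using cmean_continuous[OF cpt that swapped] by (simp add: G_def[abs_def])
  have G_real: "cnj (G M y) = G M y" if "mean M" for M y
    unfolding G_def by (simp add: cmean_of_real[OF that])
  have pairing: "cmean M (K h) = ip h (G M)" if M: "mean M" and h: "cont h" for M h
  proof -
    have c: "cont (\<lambda>p. complex_of_real (k (- fst p + snd p)) * h (snd p))"
      by (intro continuous_on_mult cont_kernel continuous_on_compose2[OF h] continuous_intros) auto
    have "cmean M (K h) = cmean M (\<lambda>x. cmean J (\<lambda>y. complex_of_real (k (- x + y)) * h y))"
      by (simp add: K_def[abs_def])
    also have "\<dots> = cmean J (\<lambda>y. cmean M (\<lambda>x. complex_of_real (k (- x + y)) * h y))"
      using cmean_Fubini[OF cpt cpt M mean c] by simp
    also have "\<dots> = ip h (G M)"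
    proof -
      have "cont (\<lambda>x. complex_of_real (k (- x + y)))" for y
        by (intro continuous_intros continuous_on_compose2[OF k_cont]) auto
      then have "cmean M (\<lambda>x. complex_of_real (k (- x + y)) * h y) = h y * cnj (G M y)" for y
        unfolding G_real[OF M] using cmean_cmult[OF M, of "\<lambda>x. complex_of_real (k (- x + y))" "h y"]
        by (simp add: G_def mult.commute)
      then show ?thesis by (simp add: ip_def)
    qed
    finally show ?thesis .
  qed
  define F where "F y = G ?M1 y - G ?M2 y" for y
  have Fc: "cont F" unfolding F_def[abs_def] by (intro continuous_on_diff Gc M1 M2)
  have D: "cmean ?M1 (K h) - cmean ?M2 (K h) = ip h F" if h: "cont h" for h
  proof -
    have "ip h F = cnj (ip F h)" by (rule ip_cnj[OF Fc h])
    also have "ip F h = ip (G ?M1) h - ip (G ?M2) h"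
      unfolding F_def[abs_def] by (rule ip_diff_left[OF Gc[OF M1] Gc[OF M2] h])
    finally show ?thesis
      using ip_cnj[OF Gc[OF M1] h] ip_cnj[OF Gc[OF M2] h] by (simp add: pairing[OF M1 h] pairing[OF M2 h])
  qed
  have KF: "K F = (\<lambda>x. 0)"
  proof (rule ccontr)
    assume "K F \<noteq> (\<lambda>x. 0)"
    then obtain R q h c j where R: "irreducible_unitary_rep R" and q: "q > 0" and j: "j < rep_dim R"
      and h: "cont h" and KKh: "K (K h) = (\<lambda>x. of_real q * h x)" and KFh: "ip (K F) h \<noteq> 0"
      and h_eq: "h = (\<lambda>x. \<Sum>i<rep_dim R. R (- x) $$ (i, j) * c i)"
      by (rule ex_irreducible_eigenfunctions[OF Fc])
    have Ru: "unitary_rep R" using R by (simp add: irreducible_unitary_rep_def)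
    have coeff: "(\<integral>x. R (- x) $$ (i, j) \<partial>\<mu>\<^sub>1) = (\<integral>x. R (- x) $$ (i, j) \<partial>\<mu>\<^sub>2)" if "i < rep_dim R" for i
      using arg_cong[OF eq[OF R], of "\<lambda>A. A $$ (i, j)"] that j by (simp add: fourier_transform_def)
    have "cmean ?M1 h = cmean ?M2 h"
      unfolding h_eq
      using cmean_integral_mean_sum[OF cpt \<mu>1, of "rep_dim R" "\<lambda>i x. R (- x) $$ (i, j)" c]
        cmean_integral_mean_sum[OF cpt \<mu>2, of "rep_dim R" "\<lambda>i x. R (- x) $$ (i, j)" c]
        unitary_rep_continuous_inverse[OF Ru _ j] by (simp add: coeff)
    moreover have "cmean ?M1 (K (K h)) = of_real q * cmean ?M1 h" "cmean ?M2 (K (K h)) = of_real q * cmean ?M2 h"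
      unfolding KKh by (rule cmean_cmult[OF M1 h], rule cmean_cmult[OF M2 h])
    \<comment> \<open>The measures agree on \<open>h\<close>, a combination of matrix coefficients,
      hence on its multiple \<open>K (K h)\<close>; \<open>D\<close> at \<open>K h\<close> turns
      this into orthogonality.\<close>
    ultimately have "ip (K h) F = 0" using D[OF cont_K[OF h]] by simp
    then have "ip F (K h) = 0" using ip_cnj[OF cont_K[OF h] Fc] by simp
    then show False using KFh K_self_adjoint[OF Fc h] by simp
  qed
  have "ip F F = 0" using D[OF Fc] M1 M2 by (simp add: KF)
  then have "F = (\<lambda>x. 0)" using nsq_eq_0D[OF _ Fc] by (simp add: ip_self)
  then show ?thesis using D[OF f] by simp
qed

text \<open>For \<open>k\<close> supported near the unit, \<open>K f\<close> is uniformly close to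
  \<open>J k\<close> times \<open>f\<close>, and on \<open>K f\<close> the two measures agree. The
  factor \<open>J k > 0\<close> is carried along and cancelled only at the end.\<close>

lemma integral_eq_if_fourier_transform_eq:
  fixes \<mu>\<^sub>1 \<mu>\<^sub>2 :: "'g::{topological_group_add, t2_space, second_countable_topology} measure"
  assumes cpt: "compact (UNIV :: 'g set)"
    and \<mu>1: "prob_space \<mu>\<^sub>1" "sets \<mu>\<^sub>1 = sets borel" and \<mu>2: "prob_space \<mu>\<^sub>2" "sets \<mu>\<^sub>2 = sets borel"
    and eq: "\<And>\<pi>. irreducible_unitary_rep \<pi> \<Longrightarrow> fourier_transform \<mu>\<^sub>1 \<pi> = fourier_transform \<mu>\<^sub>2 \<pi>"
    and f: "cont (f :: 'g \<Rightarrow> real)"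
  shows "(\<integral>x. f x \<partial>\<mu>\<^sub>1) = (\<integral>x. f x \<partial>\<mu>\<^sub>2)"
proof -
  obtain J :: "('g \<Rightarrow> real) \<Rightarrow> real" where J: "mean J" "faithful J" "\<And>f a. cont f \<Longrightarrow> J (\<lambda>x. f (a + x)) = J f"
    using ex_invariant_mean[OF cpt] by metis
  interpret invariant_mean J by unfold_locales (use cpt J in auto)
  let ?M1 = "integral_mean \<mu>\<^sub>1" and ?M2 = "integral_mean \<mu>\<^sub>2"
  note M1 = mean_integral_mean[OF cpt \<mu>1] and M2 = mean_integral_mean[OF cpt \<mu>2]
  have "\<bar>?M1 f - ?M2 f\<bar> \<le> 0 + e" if e: "e > 0" for e
  proof -
    \<comment> \<open>The equicontinuity lemma controls perturbations from the left, whereas the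
      average below perturbs the argument from the right. Composing \<open>f\<close> with inversion
      swaps the sides, hence the condition \<open>- z \<in> U\<close> in
      \<open>close\<close>.\<close>
    obtain U where U: "open U" "0 \<in> U" "\<And>u t. u \<in> U \<Longrightarrow> dist (f (- (u + t))) (f (- t)) \<le> e / 2"
      using compact_group_equicontinuous[OF cpt cont_translate(3)[OF f], of "e / 2"] e
      by (metis half_gt_zero)
    have close: "\<bar>f (x + z) - f x\<bar> \<le> e / 2" if "- z \<in> U" for x z
      using U(3)[OF that, of "- x"] by (simp add: minus_add dist_real_def)
    \<comment> \<open>Making the neighbourhood symmetric keeps the support of the symmetrised bump
      function \<open>k\<close> inside it.\<close>
    define U' where "U' = U \<inter> uminus -` U"
    have "open U'" unfolding U'_def
      by (intro open_Int U(1) open_vimage[OF U(1)] continuous_intros)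
    moreover have "0 \<in> U'" using U(2) by (simp add: U'_def)
    ultimately obtain k0 :: "'g \<Rightarrow> real" where k0: "cont k0" "\<And>x. 0 \<le> k0 x" "\<And>x. x \<in> - U' \<Longrightarrow> k0 x = 0" "k0 0 = 1"
      using compact_t2_separating_point[OF cpt, of "- U'" 0] by (metis ComplD closed_Compl)
    define k where "k x = k0 x + k0 (- x)" for x
    have kc: "cont k" unfolding k_def[abs_def] by (intro continuous_on_add k0(1) cont_translate(3))
    have k_nonneg: "0 \<le> k x" for x using k0(2) by (simp add: k_def)
    have k_zero: "k x = 0" if "- x \<notin> U" for x
    proof -
      have "x \<in> - U'" "- x \<in> - U'" using that by (auto simp: U'_def)
      then show ?thesis by (simp add: k_def k0(3))
    qed
    interpret convolution_kernel J k
      by unfold_locales (use kc in \<open>auto simp: k_def\<close>)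
    have "J k \<noteq> 0"
    proof
      assume "J k = 0"
      then have "k = (\<lambda>x. 0)" by (intro faithfulD[OF J(2)] kc k_nonneg)
      then have "k 0 = 0" by simp
      then show False using k0(4) by (simp add: k_def)
    qed
    then have Jk: "J k > 0" using mean_nonneg[OF J(1) kc k_nonneg] by simp
    \<comment> \<open>The substitution \<open>y = x + z\<close>, allowed by left invariance, turns
      \<open>K f\<close> into an average of right translates of \<open>f\<close> with weight
      \<open>k\<close>.\<close>
    define Kf where "Kf x = J (\<lambda>z. k z * f (x + z))" for x
    have K_eq: "K (\<lambda>x. complex_of_real (f x)) = (\<lambda>x. of_real (Kf x))"
    proof
      fix x
      have "cont (\<lambda>y. k (- x + y) * f y)"
        by (intro continuous_on_mult f cont_translate(1)[OF kc])
      then have "J (\<lambda>y. k (- x + y) * f y) = Kf x"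
        using J(3)[of "\<lambda>y. k (- x + y) * f y" x] by (simp add: Kf_def add.assoc[symmetric])
      then show "K (\<lambda>x. complex_of_real (f x)) x = of_real (Kf x)"
        using cmean_of_real[OF J(1), of "\<lambda>y. k (- x + y) * f y"] by (simp add: K_def)
    qed
    have "cont (\<lambda>x. complex_of_real (f x))" using f by (intro continuous_intros)
    note Kc = cont_K[OF this] and K_means = cmean_K_eq[OF \<mu>1 \<mu>2 eq this]
    have Kfc: "cont Kf" using continuous_on_Re[OF Kc] by (simp add: K_eq)
    have KM: "?M1 Kf = ?M2 Kf"
      using K_means unfolding K_eq cmean_of_real[OF M1] cmean_of_real[OF M2] by simp
    have Jf: "cont (\<lambda>x. J k * f x)" using f by (intro continuous_intros)
    have Kf_close: "\<bar>Kf x - J k * f x\<bar> \<le> J k * (e / 2)" for x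
    proof -
      have c: "cont (\<lambda>z. k z * f (x + z))" by (intro continuous_on_mult kc cont_translate(1)[OF f])
      have kz: "\<bar>k z * f (x + z) - f x * k z\<bar> \<le> e / 2 * k z" for z
      proof (cases "- z \<in> U")
        case True
        have "k z * f (x + z) - f x * k z = k z * (f (x + z) - f x)" by (simp add: algebra_simps)
        then have "\<bar>k z * f (x + z) - f x * k z\<bar> = k z * \<bar>f (x + z) - f x\<bar>"
          using k_nonneg[of z] by (simp add: abs_mult)
        also have "\<dots> \<le> k z * (e / 2)" by (intro mult_left_mono close[OF True] k_nonneg)
        finally show ?thesis by (simp add: mult.commute)
      qed (simp add: k_zero)
      have "k z * f (x + z) \<le> f x * k z + e / 2 * k z" "f x * k z - e / 2 * k z \<le> k z * f (x + z)" for z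
        using kz[of z] by linarith+
      then have "k z * f (x + z) \<le> (f x + e / 2) * k z" "(f x - e / 2) * k z \<le> k z * f (x + z)" for z
        by (simp_all add: algebra_simps)
      then have "J (\<lambda>z. k z * f (x + z)) \<le> J (\<lambda>z. (f x + e / 2) * k z)"
        "J (\<lambda>z. (f x - e / 2) * k z) \<le> J (\<lambda>z. k z * f (x + z))"
        by (auto intro!: mean_mono[OF J(1)] c continuous_on_mult continuous_on_const kc)
      then show ?thesis
        unfolding mean_cmult[OF J(1) kc] Kf_def by (intro abs_leI) (simp_all add: algebra_simps)
    qed
    have "\<bar>?M1 Kf - J k * ?M1 f\<bar> \<le> J k * (e / 2)" "\<bar>?M2 Kf - J k * ?M2 f\<bar> \<le> J k * (e / 2)"
      using mean_abs_diff_le[OF M1 Kfc Jf Kf_close] mean_abs_diff_le[OF M2 Kfc Jf Kf_close]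
      by (simp_all add: mean_cmult[OF M1 f] mean_cmult[OF M2 f])
    then have "\<bar>J k * ?M1 f - J k * ?M2 f\<bar> \<le> J k * e"
      using KM by linarith
    then have "J k * \<bar>?M1 f - ?M2 f\<bar> \<le> J k * e"
      using Jk by (simp add: abs_mult flip: right_diff_distrib)
    then show ?thesis using Jk by simp
  qed
  then have "?M1 f = ?M2 f" by (meson abs_ge_zero eq_iff_diff_eq_0 field_le_epsilon abs_le_zero_iff)
  then show ?thesis by (simp add: integral_mean_def)
qed

section \<open>Measures determined by continuous functions\<close>

lemma closed_indicator_limit:
  fixes C :: "'a::{t2_space, second_countable_topology} set"
  assumes cpt: "compact (UNIV :: 'a set)" and C: "closed C"
  obtains h :: "nat \<Rightarrow> 'a \<Rightarrow> real" where "\<And>n. cont (h n)" "\<And>n x. \<bar>h n x\<bar> \<le> 1"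
    "\<And>x. (\<lambda>n. h n x) \<longlonglongrightarrow> indicator C x"
proof (cases "C = UNIV")
  case True
  then show thesis by (intro that[of "\<lambda>n x. 1"]) auto
next
  case False
  \<comment> \<open>The sets where some function of \<open>\<F>\<close> exceeds \<open>1/2\<close>
    cover the complement of \<open>C\<close>. By the Lindelof property countably many suffice; the
    case \<open>C = UNIV\<close> is split off since nothing would have to be covered.\<close>
  define \<F> where "\<F> = {f :: 'a \<Rightarrow> real. cont f \<and> (\<forall>x. 0 \<le> f x \<and> f x \<le> 1) \<and> (\<forall>x\<in>C. f x = 0)}"
  have "open S" if "S \<in> (\<lambda>f. {x. 1/2 < f x}) ` \<F>" for S
  proof -
    obtain f where "f \<in> \<F>" "S = {x. 1/2 < f x}" using \<open>S \<in> _\<close> by blast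
    then show ?thesis using open_Collect_less[OF continuous_on_const, of f "1/2"] by (simp add: \<F>_def)
  qed
  from Lindelof[OF this] obtain \<S> where \<S>: "\<S> \<subseteq> (\<lambda>f. {x. 1/2 < f x}) ` \<F>" "countable \<S>"
    "\<Union>\<S> = \<Union>((\<lambda>f. {x. 1/2 < f x}) ` \<F>)" by metis
  then obtain \<F>' where \<F>': "countable \<F>'" "\<F>' \<subseteq> \<F>" "\<S> = (\<lambda>f. {x. 1/2 < f x}) ` \<F>'"
    using countable_subset_image[of \<S> "\<lambda>f. {x. 1/2 < f x}" \<F>] by blast
  have cover: "\<exists>f\<in>\<F>'. 1/2 < f x" if "x \<notin> C" for x
  proof -
    obtain f :: "'a \<Rightarrow> real" where "cont f" "\<And>y. 0 \<le> f y" "\<And>y. f y \<le> 1" "\<And>y. y \<in> C \<Longrightarrow> f y = 0" "f x = 1"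
      using compact_t2_separating_point[OF cpt C \<open>x \<notin> C\<close>] by metis
    then have "x \<in> \<Union>((\<lambda>f. {x. 1/2 < f x}) ` \<F>)" by (auto simp: \<F>_def intro!: bexI[of _ f])
    then show ?thesis unfolding \<S>(3)[symmetric] \<F>'(3) by auto
  qed
  have "\<F>' \<noteq> {}" using cover False by auto
  define f where "f = from_nat_into \<F>'"
  have f: "f i \<in> \<F>'" for i unfolding f_def using \<open>\<F>' \<noteq> {}\<close> by (rule from_nat_into)
  then have f': "f i \<in> \<F>" for i using \<F>'(2) by blast
  \<comment> \<open>On \<open>C\<close> every factor is 1. Off \<open>C\<close> some
    \<open>f i\<close> exceeds \<open>1/2\<close>, and once \<open>n > i\<close> the power
    \<open>n\<close> of that single factor pushes the product below \<open>(1/2)^n\<close>.\<close>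
  define h where "h n x = (\<Prod>i<n. (1 - f i x) ^ n)" for n x
  have f01: "0 \<le> 1 - f i x" "1 - f i x \<le> 1" for i x using f'[of i] by (auto simp: \<F>_def)
  have "cont (h n)" for n
    unfolding h_def[abs_def] using f' by (auto simp: \<F>_def intro!: continuous_intros)
  moreover have h01: "0 \<le> h n x \<and> h n x \<le> 1" for n x
    unfolding h_def using f01 by (auto intro!: prod_nonneg prod_le_1 power_le_one)
  moreover have "(\<lambda>n. h n x) \<longlonglongrightarrow> indicator C x" for x
  proof (cases "x \<in> C")
    case True
    then have "h n x = 1" for n using f' by (auto simp: h_def \<F>_def)
    then show ?thesis using True by simp
  next
    case False
    obtain g where "g \<in> \<F>'" "1/2 < g x" using cover[OF False] by blast
    then obtain i where i: "1/2 < f i x"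
      using from_nat_into_surj[OF \<F>'(1)] unfolding f_def by metis
    have "h n x \<le> (1/2) ^ n" if "n > i" for n
    proof -
      have "h n x = (1 - f i x) ^ n * (\<Prod>j\<in>{..<n} - {i}. (1 - f j x) ^ n)"
        unfolding h_def using that by (subst prod.remove[of _ i]) auto
      also have "\<dots> \<le> (1/2) ^ n * 1"
        using f01 i by (intro mult_mono power_mono prod_le_1) (auto intro!: power_le_one prod_nonneg)
      finally show ?thesis by simp
    qed
    then have "\<forall>\<^sub>F n in sequentially. norm (h n x) \<le> (1/2) ^ n"
      using h01 by (intro eventually_sequentiallyI[of "Suc i"]) auto
    then have "(\<lambda>n. h n x) \<longlonglongrightarrow> 0"
      by (rule Lim_null_comparison) (simp add: LIMSEQ_power_zero)
    then show ?thesis using False by simp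
  qed
  ultimately show thesis by (intro that[of h]) auto
qed

text \<open>Dominated convergence transfers the equality to closed sets, which are stable under
  intersection and generate the Borel sets.\<close>

lemma prob_measure_eqI_continuous:
  fixes \<mu>\<^sub>1 \<mu>\<^sub>2 :: "'a::{t2_space, second_countable_topology} measure"
  assumes cpt: "compact (UNIV :: 'a set)"
    and \<mu>1: "prob_space \<mu>\<^sub>1" "sets \<mu>\<^sub>1 = sets borel" and \<mu>2: "prob_space \<mu>\<^sub>2" "sets \<mu>\<^sub>2 = sets borel"
    and eq: "\<And>f :: 'a \<Rightarrow> real. cont f \<Longrightarrow> (\<integral>x. f x \<partial>\<mu>\<^sub>1) = (\<integral>x. f x \<partial>\<mu>\<^sub>2)"
  shows "\<mu>\<^sub>1 = \<mu>\<^sub>2"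
proof -
  have lim: "(\<lambda>n. \<integral>x. h n x \<partial>\<mu>) \<longlonglongrightarrow> measure \<mu> C"
    if \<mu>: "prob_space \<mu>" "sets \<mu> = sets borel" and C: "closed C"
      and h: "\<And>n. cont (h n)" "\<And>n x. \<bar>h n x\<bar> \<le> 1" "\<And>x. (\<lambda>n. h n x) \<longlonglongrightarrow> indicator C x"
    for \<mu> C and h :: "nat \<Rightarrow> 'a \<Rightarrow> real"
  proof -
    interpret prob_space \<mu> by fact
    have Cs: "C \<in> sets \<mu>" using C \<mu>(2) by simp
    have "(\<lambda>n. \<integral>x. h n x \<partial>\<mu>) \<longlonglongrightarrow> (\<integral>x. indicator C x \<partial>\<mu>)"
    proof (rule integral_dominated_convergence[where w = "\<lambda>x. 1"])
      show "h n \<in> borel_measurable \<mu>" for n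
        using continuous_integrable[OF cpt \<mu> h(1)] by (rule borel_measurable_integrable)
    qed (use Cs h in auto)
    then show ?thesis using Cs \<mu>(2) by (simp add: sets.Int_space_eq2)
  qed
  have closed_eq: "emeasure \<mu>\<^sub>1 C = emeasure \<mu>\<^sub>2 C" if C: "closed C" for C
  proof -
    obtain h :: "nat \<Rightarrow> 'a \<Rightarrow> real" where h: "\<And>n. cont (h n)" "\<And>n x. \<bar>h n x\<bar> \<le> 1"
      "\<And>x. (\<lambda>n. h n x) \<longlonglongrightarrow> indicator C x"
      using closed_indicator_limit[OF cpt C] by metis
    have "measure \<mu>\<^sub>1 C = measure \<mu>\<^sub>2 C"
      using LIMSEQ_unique[OF lim[OF \<mu>1 C h]] lim[OF \<mu>2 C h] eq[OF h(1)] by simp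
    then show ?thesis
      using \<mu>1 \<mu>2 by (simp add: prob_space_def finite_measure.emeasure_eq_measure)
  qed
  show ?thesis
  proof (rule measure_eqI_generator_eq[where E = "Collect closed" and \<Omega> = UNIV and A = "\<lambda>_. UNIV"])
    show "Int_stable (Collect closed :: 'a set set)" by (auto simp: Int_stable_def)
    show "sets \<mu>\<^sub>1 = sigma_sets UNIV (Collect closed)" "sets \<mu>\<^sub>2 = sigma_sets UNIV (Collect closed)"
      unfolding \<mu>1(2) \<mu>2(2) by (subst borel_eq_closed, simp)+
    show "emeasure \<mu>\<^sub>1 UNIV \<noteq> \<infinity>"
      using \<mu>1 by (simp add: prob_space_def finite_measure.emeasure_eq_measure)
  qed (use closed_eq in auto)
qed

section \<open>Convolution of probability measures\<close>

lemma measurable_group_add: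
  fixes \<mu> \<nu> :: "'g::{topological_group_add, second_countable_topology} measure"
  assumes "sets \<mu> = sets borel" "sets \<nu> = sets borel"
  shows "(\<lambda>p. fst p + snd p) \<in> measurable (\<mu> \<Otimes>\<^sub>M \<nu>) borel"
proof -
  have "sets (\<mu> \<Otimes>\<^sub>M \<nu>) = sets (borel :: ('g \<times> 'g) measure)"
    unfolding borel_prod[symmetric] by (rule sets_pair_measure_cong[OF assms])
  moreover have "(\<lambda>p :: 'g \<times> 'g. fst p + snd p) \<in> borel_measurable borel"
    by (intro borel_measurable_continuous_onI continuous_intros)
  ultimately show ?thesis using measurable_cong_sets by blast
qed

text \<open>The section at \<open>y\<close> of the preimage of \<open>A\<close> under the group
  operation is the translate of \<open>A\<close> by \<open>- y\<close>. Hence the defining set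
  function is an image of the product measure, so it is countably additive and its integrals are
  iterated integrals.\<close>

lemma group_convolution_eq_distr:
  fixes \<mu> \<nu> :: "'g::{topological_group_add, second_countable_topology} measure"
  assumes \<mu>: "prob_space \<mu>" "sets \<mu> = sets borel" and \<nu>: "prob_space \<nu>" "sets \<nu> = sets borel"
  shows "group_convolution \<mu> \<nu> = distr (\<mu> \<Otimes>\<^sub>M \<nu>) borel (\<lambda>p. fst p + snd p)" (is "_ = ?D")
proof -
  interpret \<mu>: prob_space \<mu> by fact
  interpret \<nu>: prob_space \<nu> by fact
  interpret pair_sigma_finite \<mu> \<nu> ..
  have sp: "space \<mu> = UNIV" "space \<nu> = UNIV"
    using sets_eq_imp_space_eq[OF \<mu>(2)] sets_eq_imp_space_eq[OF \<nu>(2)] by auto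
  note m = measurable_group_add[OF \<mu>(2) \<nu>(2)]
  have em: "emeasure ?D A = (\<integral>\<^sup>+x. emeasure \<mu> ((\<lambda>a. a - x) ` A) \<partial>\<nu>)" if A: "A \<in> sets borel" for A
  proof -
    let ?X = "(\<lambda>p. fst p + snd p) -` A \<inter> space (\<mu> \<Otimes>\<^sub>M \<nu>)"
    have "emeasure ?D A = emeasure (\<mu> \<Otimes>\<^sub>M \<nu>) ?X" by (rule emeasure_distr[OF m A])
    also have "\<dots> = (\<integral>\<^sup>+y. emeasure \<mu> ((\<lambda>x. (x, y)) -` ?X) \<partial>\<nu>)"
      by (rule emeasure_pair_measure_alt2[OF measurable_sets[OF m A]])
    also have "\<dots> = (\<integral>\<^sup>+y. emeasure \<mu> ((\<lambda>a. a - y) ` A) \<partial>\<nu>)"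
    proof -
      have "x \<in> (\<lambda>a. a - y) ` A" if "x + y \<in> A" for x y
        using that by (intro image_eqI[of _ _ "x + y"]) auto
      then have "(\<lambda>x. (x, y)) -` ?X = (\<lambda>a. a - y) ` A" for y by (auto simp: space_pair_measure sp)
      then show ?thesis by simp
    qed
    finally show ?thesis .
  qed
  have "group_convolution \<mu> \<nu> = measure_of UNIV (sets borel) (emeasure ?D)"
    unfolding group_convolution_def
    by (rule measure_of_eq) (use em sets.sigma_sets_eq[of "borel :: 'g measure"] in auto)
  also have "\<dots> = ?D" using measure_of_of_measure[of ?D] by simp
  finally show ?thesis .
qed

lemma group_convolution_prob:
  fixes \<mu> \<nu> :: "'g::{topological_group_add, second_countable_topology} measure"
  assumes \<mu>: "prob_space \<mu>" "sets \<mu> = sets borel" and \<nu>: "prob_space \<nu>" "sets \<nu> = sets borel"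
  shows "prob_space (group_convolution \<mu> \<nu>)" "sets (group_convolution \<mu> \<nu>) = sets borel"
proof -
  interpret \<mu>: prob_space \<mu> by fact
  interpret \<nu>: prob_space \<nu> by fact
  interpret pair_prob_space \<mu> \<nu> ..
  show "prob_space (group_convolution \<mu> \<nu>)"
    unfolding group_convolution_eq_distr[OF assms]
    by (rule prob_space_distr[OF measurable_group_add[OF \<mu>(2) \<nu>(2)]])
  show "sets (group_convolution \<mu> \<nu>) = sets borel"
    unfolding group_convolution_eq_distr[OF assms] by simp
qed

lemma integral_group_convolution:
  fixes \<mu> \<nu> :: "'g::{topological_group_add, second_countable_topology} measure" and f :: "'g \<Rightarrow> complex"
  assumes cpt: "compact (UNIV :: 'g set)"
    and \<mu>: "prob_space \<mu>" "sets \<mu> = sets borel" and \<nu>: "prob_space \<nu>" "sets \<nu> = sets borel"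
    and f: "cont f"
  shows "(\<integral>x. f x \<partial>(group_convolution \<mu> \<nu>)) = (\<integral>y. (\<integral>x. f (x + y) \<partial>\<mu>) \<partial>\<nu>)"
proof -
  interpret \<mu>: prob_space \<mu> by fact
  interpret \<nu>: prob_space \<nu> by fact
  interpret pair_prob_space \<mu> \<nu> ..
  note m = measurable_group_add[OF \<mu>(2) \<nu>(2)]
  have fm: "f \<in> borel_measurable borel" by (rule borel_measurable_continuous_onI[OF f])
  obtain C where C: "\<And>x. norm (f x) \<le> C" using continuous_bounded[OF cpt f] by metis
  have "integrable (\<mu> \<Otimes>\<^sub>M \<nu>) (\<lambda>p. f (fst p + snd p))"
    by (rule P.integrable_const_bound[of _ C]) (use C measurable_compose[OF m fm] in auto)
  then have "(\<integral>y. (\<integral>x. f (x + y) \<partial>\<mu>) \<partial>\<nu>) = (\<integral>p. f (fst p + snd p) \<partial>(\<mu> \<Otimes>\<^sub>M \<nu>))"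
    using integral_snd[of "\<lambda>x y. f (x + y)"] by (simp add: case_prod_beta')
  then show ?thesis
    unfolding group_convolution_eq_distr[OF \<mu> \<nu>] by (simp add: integral_distr[OF m fm])
qed

section \<open>Fourier transforms of measures\<close>

lemma fourier_transform_carrier: "fourier_transform \<mu> \<pi> \<in> carrier_mat (rep_dim \<pi>) (rep_dim \<pi>)"
  by (simp add: fourier_transform_def)

text \<open>The inverse in the transform reverses products,
  \<open>\<pi> (- (x + y)) = \<pi> (- y) * \<pi> (- x)\<close>; this is where the order of the two
  factors comes from.\<close>

lemma fourier_transform_convolution:
  fixes \<mu> \<nu> :: "'g::{topological_group_add, second_countable_topology} measure"
  assumes cpt: "compact (UNIV :: 'g set)"
    and \<mu>: "prob_space \<mu>" "sets \<mu> = sets borel" and \<nu>: "prob_space \<nu>" "sets \<nu> = sets borel"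
    and \<pi>: "unitary_rep \<pi>"
  shows "fourier_transform (group_convolution \<mu> \<nu>) \<pi> = fourier_transform \<nu> \<pi> * fourier_transform \<mu> \<pi>"
proof (rule eq_matI)
  let ?d = "rep_dim \<pi>"
  fix i j assume "i < dim_row (fourier_transform \<nu> \<pi> * fourier_transform \<mu> \<pi>)"
    "j < dim_col (fourier_transform \<nu> \<pi> * fourier_transform \<mu> \<pi>)"
  then have ij: "i < ?d" "j < ?d" by (auto simp: fourier_transform_def)
  note c = unitary_rep_continuous_inverse[OF \<pi>]
  note int\<mu> = continuous_integrable[OF cpt \<mu> c] and int\<nu> = continuous_integrable[OF cpt \<nu> c]
  have "\<pi> (- (x + y)) $$ (i, j) = (\<Sum>k<?d. \<pi> (- y) $$ (i, k) * \<pi> (- x) $$ (k, j))" for x y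
  proof -
    have "\<pi> (- (x + y)) = \<pi> (- y) * \<pi> (- x)"
      using \<pi> by (simp add: unitary_rep_def minus_add del: add_uminus_conv_diff)
    then show ?thesis
      using ij unitary_rep_carrier[OF \<pi>, of "- x"] unitary_rep_carrier[OF \<pi>, of "- y"]
      by (simp add: scalar_prod_def atLeast0LessThan)
  qed
  then have "(\<integral>x. \<pi> (- x) $$ (i, j) \<partial>(group_convolution \<mu> \<nu>)) =
    (\<integral>y. (\<integral>x. (\<Sum>k<?d. \<pi> (- y) $$ (i, k) * \<pi> (- x) $$ (k, j)) \<partial>\<mu>) \<partial>\<nu>)"
    using integral_group_convolution[OF cpt \<mu> \<nu> c[OF ij]] by simp
  also have "\<dots> = (\<integral>y. (\<Sum>k<?d. \<pi> (- y) $$ (i, k) * (\<integral>x. \<pi> (- x) $$ (k, j) \<partial>\<mu>)) \<partial>\<nu>)"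
    using int\<mu>[OF _ ij(2)] by (subst Bochner_Integration.integral_sum) auto
  also have "\<dots> = (\<Sum>k<?d. (\<integral>y. \<pi> (- y) $$ (i, k) \<partial>\<nu>) * (\<integral>x. \<pi> (- x) $$ (k, j) \<partial>\<mu>))"
    using int\<nu>[OF ij(1)] by (subst Bochner_Integration.integral_sum) auto
  finally show "fourier_transform (group_convolution \<mu> \<nu>) \<pi> $$ (i, j) =
      (fourier_transform \<nu> \<pi> * fourier_transform \<mu> \<pi>) $$ (i, j)"
    using ij by (simp add: fourier_transform_def scalar_prod_def atLeast0LessThan)
qed (simp_all add: fourier_transform_def)

lemma mat_trace_fourier_transform:
  fixes \<mu> :: "'g::topological_group_add measure"
  assumes cpt: "compact (UNIV :: 'g set)" and \<mu>: "prob_space \<mu>" "sets \<mu> = sets borel"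
    and \<pi>: "unitary_rep \<pi>" and C: "C \<in> carrier_mat (rep_dim \<pi>) (rep_dim \<pi>)"
  shows "integrable \<mu> (\<lambda>x. mat_trace (\<pi> (- x) * C))"
    "mat_trace (fourier_transform \<mu> \<pi> * C) = (\<integral>x. mat_trace (\<pi> (- x) * C) \<partial>\<mu>)"
proof -
  let ?d = "rep_dim \<pi>"
  have tr: "mat_trace (A * C) = (\<Sum>i<?d. \<Sum>k<?d. A $$ (i, k) * C $$ (k, i))" if "A \<in> carrier_mat ?d ?d" for A
    using that C by (simp add: mat_trace_def scalar_prod_def atLeast0LessThan)
  note int = continuous_integrable[OF cpt \<mu> unitary_rep_continuous_inverse[OF \<pi>]]
  have eq: "(\<lambda>x. mat_trace (\<pi> (- x) * C)) = (\<lambda>x. \<Sum>i<?d. \<Sum>k<?d. \<pi> (- x) $$ (i, k) * C $$ (k, i))"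
    using unitary_rep_carrier[OF \<pi>] by (simp add: tr)
  show "integrable \<mu> (\<lambda>x. mat_trace (\<pi> (- x) * C))"
    unfolding eq by (intro Bochner_Integration.integrable_sum integrable_mult_left int) auto
  have "(\<integral>x. (\<Sum>i<?d. \<Sum>k<?d. \<pi> (- x) $$ (i, k) * C $$ (k, i)) \<partial>\<mu>) =
    (\<Sum>i<?d. \<Sum>k<?d. (\<integral>x. \<pi> (- x) $$ (i, k) \<partial>\<mu>) * C $$ (k, i))"
  proof (subst Bochner_Integration.integral_sum)
    show "integrable \<mu> (\<lambda>x. \<Sum>k<?d. \<pi> (- x) $$ (i, k) * C $$ (k, i))" if "i \<in> {..<?d}" for i
      using that by (intro Bochner_Integration.integrable_sum integrable_mult_left int) auto
    show "(\<Sum>i<?d. \<integral>x. (\<Sum>k<?d. \<pi> (- x) $$ (i, k) * C $$ (k, i)) \<partial>\<mu>) =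
        (\<Sum>i<?d. \<Sum>k<?d. (\<integral>x. \<pi> (- x) $$ (i, k) \<partial>\<mu>) * C $$ (k, i))"
      using int by (intro sum.cong refl) (subst Bochner_Integration.integral_sum, auto)
  qed
  then show "mat_trace (fourier_transform \<mu> \<pi> * C) = (\<integral>x. mat_trace (\<pi> (- x) * C) \<partial>\<mu>)"
    unfolding eq by (simp add: tr fourier_transform_def)
qed

text \<open>Multiplying the coefficients by the transform averages the polynomial: by cyclicity of
  the trace the new value at \<open>g\<close> is the integral over \<open>x\<close> of the old
  values at \<open>g + - x\<close>, which are nonnegative.\<close>

lemma lo_ng_positive_fourier_transform:
  fixes \<mu> :: "'g::topological_group_add measure"
  assumes cpt: "compact (UNIV :: 'g set)" and \<mu>: "prob_space \<mu>" "sets \<mu> = sets borel"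
    and G: "\<And>\<pi>. \<pi> \<in> \<G> \<Longrightarrow> unitary_rep \<pi>"
  shows "lo_ng_positive \<G> (fourier_transform \<mu>)"
proof (rule lo_ng_positiveI)
  fix \<Omega> B and g :: 'g
  assume \<Omega>: "finite \<Omega>" "\<Omega> \<subseteq> \<G>" and B: "\<And>\<pi>. \<pi> \<in> \<Omega> \<Longrightarrow> B \<pi> \<in> carrier_mat (rep_dim \<pi>) (rep_dim \<pi>)"
    and pos: "\<And>g. (\<Sum>\<pi>\<in>\<Omega>. of_nat (rep_dim \<pi>) * mat_trace (\<pi> g * B \<pi>)) \<in> \<real>\<^sub>\<ge>\<^sub>0"
  define \<phi> where "\<phi> x = (\<Sum>\<pi>\<in>\<Omega>. of_nat (rep_dim \<pi>) * mat_trace (\<pi> (- x) * (B \<pi> * \<pi> g)))" for x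
  have un: "unitary_rep \<pi>" if "\<pi> \<in> \<Omega>" for \<pi> using that \<Omega> G by blast
  have Bc: "B \<pi> * \<pi> g \<in> carrier_mat (rep_dim \<pi>) (rep_dim \<pi>)" if "\<pi> \<in> \<Omega>" for \<pi>
    by (rule mult_carrier_mat[OF B[OF that] unitary_rep_carrier[OF un[OF that]]])
  have tr: "mat_trace (\<pi> g * A * B \<pi>) = mat_trace (A * (B \<pi> * \<pi> g))"
    if \<pi>: "\<pi> \<in> \<Omega>" and A: "A \<in> carrier_mat (rep_dim \<pi>) (rep_dim \<pi>)" for \<pi> A
  proof -
    note c = unitary_rep_carrier[OF un[OF \<pi>], of g] B[OF \<pi>]
    have "mat_trace (\<pi> g * A * B \<pi>) = mat_trace (\<pi> g * (A * B \<pi>))"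
      by (simp only: assoc_mult_mat[OF c(1) A c(2)])
    also have "\<dots> = mat_trace (A * B \<pi> * \<pi> g)"
      by (rule mat_trace_comm[OF c(1) mult_carrier_mat[OF A c(2)]])
    also have "\<dots> = mat_trace (A * (B \<pi> * \<pi> g))"
      by (simp only: assoc_mult_mat[OF A c(2,1)])
    finally show ?thesis .
  qed
  have \<phi>_pos: "\<phi> x \<in> \<real>\<^sub>\<ge>\<^sub>0" for x
  proof -
    have "\<phi> x = (\<Sum>\<pi>\<in>\<Omega>. of_nat (rep_dim \<pi>) * mat_trace (\<pi> (g + - x) * B \<pi>))"
      unfolding \<phi>_def
    proof (rule sum.cong[OF refl])
      fix \<pi> assume \<pi>: "\<pi> \<in> \<Omega>"
      have "\<pi> (g + - x) = \<pi> g * \<pi> (- x)" using un[OF \<pi>] unfolding unitary_rep_def by blast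
      then show "of_nat (rep_dim \<pi>) * mat_trace (\<pi> (- x) * (B \<pi> * \<pi> g)) =
          of_nat (rep_dim \<pi>) * mat_trace (\<pi> (g + - x) * B \<pi>)"
        using tr[OF \<pi> unitary_rep_carrier[OF un[OF \<pi>], of "- x"]] by (simp only:)
    qed
    then show ?thesis using pos[of "g + - x"] by (simp only:)
  qed
  have int: "integrable \<mu> (\<lambda>x. of_nat (rep_dim \<pi>) * mat_trace (\<pi> (- x) * (B \<pi> * \<pi> g)))" if "\<pi> \<in> \<Omega>" for \<pi>
    by (intro integrable_mult_right mat_trace_fourier_transform(1)[OF cpt \<mu> un[OF that] Bc[OF that]])
  have "(\<Sum>\<pi>\<in>\<Omega>. of_nat (rep_dim \<pi>) * mat_trace (\<pi> g * fourier_transform \<mu> \<pi> * B \<pi>)) =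
    (\<Sum>\<pi>\<in>\<Omega>. \<integral>x. of_nat (rep_dim \<pi>) * mat_trace (\<pi> (- x) * (B \<pi> * \<pi> g)) \<partial>\<mu>)"
  proof (rule sum.cong[OF refl])
    fix \<pi> assume \<pi>: "\<pi> \<in> \<Omega>"
    show "of_nat (rep_dim \<pi>) * mat_trace (\<pi> g * fourier_transform \<mu> \<pi> * B \<pi>) =
      (\<integral>x. of_nat (rep_dim \<pi>) * mat_trace (\<pi> (- x) * (B \<pi> * \<pi> g)) \<partial>\<mu>)"
      using tr[OF \<pi> fourier_transform_carrier, of \<mu>] mat_trace_fourier_transform(2)[OF cpt \<mu> un[OF \<pi>] Bc[OF \<pi>]]
      by simp
  qed
  also have "\<dots> = (\<integral>x. \<phi> x \<partial>\<mu>)"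
    unfolding \<phi>_def by (rule Bochner_Integration.integral_sum[symmetric]) (rule int)
  finally have eq: "(\<Sum>\<pi>\<in>\<Omega>. of_nat (rep_dim \<pi>) * mat_trace (\<pi> g * fourier_transform \<mu> \<pi> * B \<pi>)) = (\<integral>x. \<phi> x \<partial>\<mu>)" .
  have "integrable \<mu> \<phi>" unfolding \<phi>_def by (rule Bochner_Integration.integrable_sum) (rule int)
  moreover have "0 \<le> Re (\<phi> x)" "Im (\<phi> x) = 0" for x using \<phi>_pos[of x] by (auto simp: complex_nonneg_Reals_iff)
  ultimately show "(\<Sum>\<pi>\<in>\<Omega>. of_nat (rep_dim \<pi>) * mat_trace (\<pi> g * fourier_transform \<mu> \<pi> * B \<pi>)) \<in> \<real>\<^sub>\<ge>\<^sub>0"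
    unfolding eq complex_nonneg_Reals_iff by (simp flip: integral_Re integral_Im)
qed (rule fourier_transform_carrier)

lemma fourier_transform_trivial_rep:
  assumes "prob_space \<mu>" shows "fourier_transform \<mu> trivial_rep = 1\<^sub>m 1"
  using prob_space.prob_space[OF assms]
  by (intro eq_matI) (auto simp: fourier_transform_def rep_dim_def trivial_rep_def)

section \<open>Reflection of measures under inversion\<close>

definition reflected_measure :: "'g::topological_group_add measure \<Rightarrow> 'g measure" where
  "reflected_measure \<mu> = distr \<mu> borel uminus"

lemma measurable_uminus_group:
  fixes \<mu> :: "'g::topological_group_add measure"
  assumes "sets \<mu> = sets borel" shows "uminus \<in> measurable \<mu> (borel :: 'g measure)"
proof -
  have "(uminus :: 'g \<Rightarrow> 'g) \<in> borel_measurable borel"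
    by (intro borel_measurable_continuous_onI continuous_intros)
  then show ?thesis using measurable_cong_sets[OF assms refl] by blast
qed

lemma emeasure_reflected_measure:
  fixes \<mu> :: "'g::topological_group_add measure"
  assumes \<mu>: "sets \<mu> = sets borel" and A: "A \<in> sets borel"
  shows "emeasure (reflected_measure \<mu>) A = emeasure \<mu> (uminus ` A)"
proof -
  have "uminus -` A \<inter> space \<mu> = uminus ` A"
    using sets_eq_imp_space_eq[OF \<mu>] by (force intro: image_eqI[of _ uminus "- _"])
  then show ?thesis
    unfolding reflected_measure_def using emeasure_distr[OF measurable_uminus_group[OF \<mu>] A] by simp
qed

lemma uminus_image_group:
  fixes A B :: "'g::topological_group_add set"
  shows "uminus ` uminus ` A = A" "uminus ` A \<subseteq> uminus ` B \<longleftrightarrow> A \<subseteq> B"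
    "compact A \<Longrightarrow> compact (uminus ` A)" "open A \<Longrightarrow> open (uminus ` A)"
    "A \<in> sets borel \<Longrightarrow> uminus ` A \<in> sets borel"
proof -
  have vim: "uminus ` A = uminus -` A" for A :: "'g set" by (force intro: image_eqI[of _ uminus "- _"])
  show "uminus ` uminus ` A = A" by (simp add: image_image)
  show "uminus ` A \<subseteq> uminus ` B \<longleftrightarrow> A \<subseteq> B" by (rule inj_image_subset_iff) (simp add: inj_def)
  show "compact (uminus ` A)" if "compact A"
    by (intro compact_continuous_image continuous_intros that)
  show "open (uminus ` A)" if "open A"
    unfolding vim by (intro open_vimage that continuous_intros)
  show "uminus ` A \<in> sets borel" if "A \<in> sets borel"
    unfolding vim using measurable_sets[OF measurable_uminus_group[OF refl] that] by simp
qed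

lemma regular_prob_measuresD:
  assumes "\<mu> \<in> regular_prob_measures" shows "prob_space \<mu>" "sets \<mu> = sets borel"
  using assms by (auto simp: regular_prob_measures_def)

lemma reflected_measure_regular:
  fixes \<mu> :: "'g::{topological_group_add, t2_space} measure"
  assumes \<mu>: "\<mu> \<in> regular_prob_measures"
  shows "reflected_measure \<mu> \<in> regular_prob_measures"
proof -
  note p = regular_prob_measuresD[OF \<mu>]
  have prob: "prob_space (reflected_measure \<mu>)"
    unfolding reflected_measure_def by (rule prob_space.prob_space_distr[OF p(1) measurable_uminus_group[OF p(2)]])
  note em = emeasure_reflected_measure[OF p(2)]
  have reg: "emeasure \<mu> A = (SUP K\<in>{K. compact K \<and> K \<subseteq> A}. emeasure \<mu> K)"
    "emeasure \<mu> A = (INF U\<in>{U. open U \<and> A \<subseteq> U}. emeasure \<mu> U)" if "A \<in> sets borel" for A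
    using \<mu> that unfolding regular_prob_measures_def by blast+
  \<comment> \<open>Inversion permutes the compact sets and the open sets and respects inclusion.
    Abstracting the class \<open>P\<close> and the direction of inclusion \<open>Q\<close> serves
    inner and outer regularity at once.\<close>
  have reindex: "(\<lambda>K. emeasure \<mu> (uminus ` K)) ` {K. P K \<and> Q K A} = emeasure \<mu> ` {K. P K \<and> Q K (uminus ` A)}"
    if P: "\<And>K. P K \<Longrightarrow> P (uminus ` K)" and Q: "\<And>K. Q (uminus ` K) (uminus ` A) \<longleftrightarrow> Q K A"
    for P and Q :: "'g set \<Rightarrow> 'g set \<Rightarrow> bool" and A
  proof (intro equalityI subsetI)
    fix x assume "x \<in> (\<lambda>K. emeasure \<mu> (uminus ` K)) ` {K. P K \<and> Q K A}"
    then show "x \<in> emeasure \<mu> ` {K. P K \<and> Q K (uminus ` A)}" using P Q by auto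
  next
    fix x assume "x \<in> emeasure \<mu> ` {K. P K \<and> Q K (uminus ` A)}"
    then obtain K where K: "P K" "Q K (uminus ` A)" "x = emeasure \<mu> K" by auto
    show "x \<in> (\<lambda>K. emeasure \<mu> (uminus ` K)) ` {K. P K \<and> Q K A}"
      by (rule image_eqI[of _ _ "uminus ` K"])
        (use K P[OF K(1)] Q[of "uminus ` K"] in \<open>simp_all add: uminus_image_group(1)\<close>)
  qed
  have "emeasure (reflected_measure \<mu>) A = (SUP K\<in>{K. compact K \<and> K \<subseteq> A}. emeasure (reflected_measure \<mu>) K)"
    "emeasure (reflected_measure \<mu>) A = (INF U\<in>{U. open U \<and> A \<subseteq> U}. emeasure (reflected_measure \<mu>) U)"
    if A: "A \<in> sets borel" for A
  proof -
    have A': "uminus ` A \<in> sets borel" by (rule uminus_image_group(5)[OF A])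
    have "(\<lambda>K. emeasure (reflected_measure \<mu>) K) ` {K. compact K \<and> K \<subseteq> A} =
        (\<lambda>K. emeasure \<mu> (uminus ` K)) ` {K. compact K \<and> K \<subseteq> A}"
      by (rule image_cong[OF refl]) (use em in \<open>auto intro: borel_closed compact_imp_closed\<close>)
    also have "\<dots> = emeasure \<mu> ` {K. compact K \<and> K \<subseteq> uminus ` A}"
      by (rule reindex[of compact "\<lambda>K A. K \<subseteq> A"]) (rule uminus_image_group, assumption, rule uminus_image_group)
    finally show "emeasure (reflected_measure \<mu>) A = (SUP K\<in>{K. compact K \<and> K \<subseteq> A}. emeasure (reflected_measure \<mu>) K)"
      unfolding em[OF A] reg(1)[OF A'] by simp
    have "(\<lambda>K. emeasure (reflected_measure \<mu>) K) ` {U. open U \<and> A \<subseteq> U} =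
        (\<lambda>K. emeasure \<mu> (uminus ` K)) ` {U. open U \<and> A \<subseteq> U}"
      by (rule image_cong[OF refl]) (use em in auto)
    also have "\<dots> = emeasure \<mu> ` {U. open U \<and> uminus ` A \<subseteq> U}"
      by (rule reindex[of "open" "\<lambda>U A. A \<subseteq> U"]) (rule uminus_image_group, assumption, rule uminus_image_group)
    finally show "emeasure (reflected_measure \<mu>) A = (INF U\<in>{U. open U \<and> A \<subseteq> U}. emeasure (reflected_measure \<mu>) U)"
      unfolding em[OF A] reg(2)[OF A'] by simp
  qed
  moreover have "sets (reflected_measure \<mu>) = sets borel" by (simp add: reflected_measure_def)
  ultimately show ?thesis
    using prob unfolding regular_prob_measures_def by blast
qed

text \<open>Reflection replaces \<open>\<pi> (- x)\<close> by \<open>\<pi> x\<close>, which by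
  unitarity is the adjoint of \<open>\<pi> (- x)\<close>; integration commutes with
  conjugation.\<close>

lemma fourier_transform_reflected:
  fixes \<mu> :: "'g::topological_group_add measure"
  assumes \<mu>: "sets \<mu> = sets borel" and \<pi>: "unitary_rep \<pi>"
  shows "fourier_transform (reflected_measure \<mu>) \<pi> = mat_adjoint (fourier_transform \<mu> \<pi>)"
proof (rule eq_matI)
  let ?d = "rep_dim \<pi>"
  fix i j assume "i < dim_row (mat_adjoint (fourier_transform \<mu> \<pi>))" "j < dim_col (mat_adjoint (fourier_transform \<mu> \<pi>))"
  then have ij: "i < ?d" "j < ?d" by (auto simp: fourier_transform_def)
  have inverse: "\<pi> (- x) = mat_adjoint (\<pi> x)" for x
  proof -
    have c: "\<pi> x \<in> carrier_mat ?d ?d" "\<pi> (- x) \<in> carrier_mat ?d ?d" "mat_adjoint (\<pi> x) \<in> carrier_mat ?d ?d"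
      using unitary_rep_carrier[OF \<pi>] by auto
    have 1: "\<pi> (- x) * \<pi> x = 1\<^sub>m ?d" "\<pi> x * mat_adjoint (\<pi> x) = 1\<^sub>m ?d"
    proof -
      have "\<pi> (- x + x) = \<pi> (- x) * \<pi> x" "\<pi> 0 = 1\<^sub>m ?d" "unitary_mat ?d (\<pi> x)"
        using \<pi> unfolding unitary_rep_def by blast+
      then show "\<pi> (- x) * \<pi> x = 1\<^sub>m ?d" "\<pi> x * mat_adjoint (\<pi> x) = 1\<^sub>m ?d"
        by (simp_all add: unitary_mat_def)
    qed
    have "\<pi> (- x) = \<pi> (- x) * (\<pi> x * mat_adjoint (\<pi> x))" unfolding 1 using c by simp
    also have "\<dots> = \<pi> (- x) * \<pi> x * mat_adjoint (\<pi> x)" by (rule assoc_mult_mat[OF c(2,1,3), symmetric])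
    also have "\<dots> = mat_adjoint (\<pi> x)" unfolding 1 using c by simp
    finally show ?thesis .
  qed
  have "(\<lambda>x. \<pi> (- x) $$ (i, j)) \<in> borel_measurable borel"
    by (intro borel_measurable_continuous_onI unitary_rep_continuous_inverse[OF \<pi> ij])
  then have "(\<integral>x. \<pi> (- x) $$ (i, j) \<partial>(reflected_measure \<mu>)) = (\<integral>x. \<pi> x $$ (i, j) \<partial>\<mu>)"
    unfolding reflected_measure_def by (subst integral_distr[OF measurable_uminus_group[OF \<mu>]]) auto
  also have "\<dots> = (\<integral>x. cnj (\<pi> (- x) $$ (j, i)) \<partial>\<mu>)"
  proof (intro Bochner_Integration.integral_cong refl)
    fix x
    have "cnj (mat_adjoint (\<pi> x) $$ (j, i)) = \<pi> x $$ (i, j)"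
      using ij unitary_rep_carrier[OF \<pi>, of x] by (simp add: mat_adjoint_index)
    then show "\<pi> x $$ (i, j) = cnj (\<pi> (- x) $$ (j, i))" by (simp add: inverse)
  qed
  also have "\<dots> = cnj (\<integral>x. \<pi> (- x) $$ (j, i) \<partial>\<mu>)" by simp
  finally show "fourier_transform (reflected_measure \<mu>) \<pi> $$ (i, j) = mat_adjoint (fourier_transform \<mu> \<pi>) $$ (i, j)"
    using ij by (simp add: fourier_transform_def mat_adjoint_index)
qed (simp_all add: fourier_transform_def)

text \<open>This carries equality of transforms from the chosen representatives to all irreducible
  representations. The Peter-Weyl argument produces some \<open>R\<close>, which need not belong to
  the chosen dual.\<close>

lemma fourier_transform_equivalent:
  fixes \<mu> :: "'g::topological_group_add measure"
  assumes cpt: "compact (UNIV :: 'g set)" and \<mu>: "prob_space \<mu>" "sets \<mu> = sets borel"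
    and \<pi>: "unitary_rep \<pi>" and \<rho>: "unitary_rep \<rho>" and eqv: "rep_dim \<rho> = rep_dim \<pi>"
    and U: "unitary_mat (rep_dim \<pi>) U" and UP: "\<And>g. U * \<pi> g = \<rho> g * U"
  shows "U * fourier_transform \<mu> \<pi> = fourier_transform \<mu> \<rho> * U"
proof (rule eq_matI)
  let ?d = "rep_dim \<pi>"
  have Uc: "U \<in> carrier_mat ?d ?d" using U by (simp add: unitary_mat_def)
  fix i j assume "i < dim_row (fourier_transform \<mu> \<rho> * U)" "j < dim_col (fourier_transform \<mu> \<rho> * U)"
  then have ij: "i < ?d" "j < ?d" using Uc eqv by (auto simp: fourier_transform_def)
  note int1 = continuous_integrable[OF cpt \<mu> unitary_rep_continuous_inverse[OF \<pi>]]
  note int2 = continuous_integrable[OF cpt \<mu> unitary_rep_continuous_inverse[OF \<rho>, unfolded eqv]]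
  have "(\<Sum>k<?d. U $$ (i, k) * \<pi> (- x) $$ (k, j)) = (\<Sum>k<?d. \<rho> (- x) $$ (i, k) * U $$ (k, j))" for x
    using arg_cong[OF UP[of "- x"], of "\<lambda>A. A $$ (i, j)"] ij Uc
      unitary_rep_carrier[OF \<pi>, of "- x"] unitary_rep_carrier[OF \<rho>, of "- x", unfolded eqv]
    by (simp add: scalar_prod_def atLeast0LessThan)
  then have "(\<integral>x. (\<Sum>k<?d. U $$ (i, k) * \<pi> (- x) $$ (k, j)) \<partial>\<mu>) =
      (\<integral>x. (\<Sum>k<?d. \<rho> (- x) $$ (i, k) * U $$ (k, j)) \<partial>\<mu>)" by simp
  moreover have "(\<integral>x. (\<Sum>k<?d. U $$ (i, k) * \<pi> (- x) $$ (k, j)) \<partial>\<mu>) =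
      (\<Sum>k<?d. U $$ (i, k) * (\<integral>x. \<pi> (- x) $$ (k, j) \<partial>\<mu>))"
    using int1[OF _ ij(2)] by (subst Bochner_Integration.integral_sum) auto
  moreover have "(\<integral>x. (\<Sum>k<?d. \<rho> (- x) $$ (i, k) * U $$ (k, j)) \<partial>\<mu>) =
      (\<Sum>k<?d. (\<integral>x. \<rho> (- x) $$ (i, k) \<partial>\<mu>) * U $$ (k, j))"
    using int2[OF ij(1)] by (subst Bochner_Integration.integral_sum) auto
  ultimately show "(U * fourier_transform \<mu> \<pi>) $$ (i, j) = (fourier_transform \<mu> \<rho> * U) $$ (i, j)"
    using ij Uc eqv by (simp add: fourier_transform_def scalar_prod_def atLeast0LessThan)
next
  show "dim_row (U * fourier_transform \<mu> \<pi>) = dim_row (fourier_transform \<mu> \<rho> * U)"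
    "dim_col (U * fourier_transform \<mu> \<pi>) = dim_col (fourier_transform \<mu> \<rho> * U)"
    using U eqv by (auto simp: fourier_transform_def unitary_mat_def)
qed

section \<open>Injectivity and the characterisation of regularity\<close>

theorem fourier_transform_injective:
  fixes \<mu>\<^sub>1 \<mu>\<^sub>2 :: "'g::{topological_group_add, t2_space, second_countable_topology} measure"
  assumes cpt: "compact (UNIV :: 'g set)" and dual: "is_unitary_dual \<G>"
    and \<mu>1: "prob_space \<mu>\<^sub>1" "sets \<mu>\<^sub>1 = sets borel" and \<mu>2: "prob_space \<mu>\<^sub>2" "sets \<mu>\<^sub>2 = sets borel"
    and eq: "\<And>\<pi>. \<pi> \<in> \<G> \<Longrightarrow> fourier_transform \<mu>\<^sub>1 \<pi> = fourier_transform \<mu>\<^sub>2 \<pi>"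
  shows "\<mu>\<^sub>1 = \<mu>\<^sub>2"
proof (rule prob_measure_eqI_continuous[OF cpt \<mu>1 \<mu>2])
  have "fourier_transform \<mu>\<^sub>1 \<rho> = fourier_transform \<mu>\<^sub>2 \<rho>" if \<rho>: "irreducible_unitary_rep \<rho>" for \<rho>
  proof -
    let ?d = "rep_dim \<rho>"
    obtain \<pi> where \<pi>: "\<pi> \<in> \<G>" "unitarily_equivalent \<rho> \<pi>"
      using dual \<rho> unfolding is_unitary_dual_def by blast
    have un: "unitary_rep \<rho>" "unitary_rep \<pi>"
      using \<rho> \<pi>(1) dual by (auto simp: is_unitary_dual_def irreducible_unitary_rep_def)
    obtain U where U: "rep_dim \<pi> = ?d" "unitary_mat ?d U" "\<And>g. U * \<rho> g = \<pi> g * U"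
      using unitarily_equivalentE[OF \<pi>(2)] by metis
    have Uc: "U \<in> carrier_mat ?d ?d" "mat_adjoint U \<in> carrier_mat ?d ?d" "mat_adjoint U * U = 1\<^sub>m ?d"
      using U(2) by (auto simp: unitary_mat_def)
    have "fourier_transform \<mu> \<rho> = mat_adjoint U * (fourier_transform \<mu> \<pi> * U)"
      if \<mu>: "prob_space \<mu>" "sets \<mu> = sets borel" for \<mu>
    proof -
      have "mat_adjoint U * (fourier_transform \<mu> \<pi> * U) = mat_adjoint U * (U * fourier_transform \<mu> \<rho>)"
        by (simp only: fourier_transform_equivalent[OF cpt \<mu> un U])
      also have "\<dots> = mat_adjoint U * U * fourier_transform \<mu> \<rho>"
        by (rule assoc_mult_mat[OF Uc(2,1) fourier_transform_carrier, symmetric])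
      also have "\<dots> = fourier_transform \<mu> \<rho>"
        unfolding Uc(3) by (rule left_mult_one_mat[OF fourier_transform_carrier])
      finally show ?thesis ..
    qed
    from this[OF \<mu>1] this[OF \<mu>2] show ?thesis by (simp only: eq[OF \<pi>(1)])
  qed
  then show "(\<integral>x. f x \<partial>\<mu>\<^sub>1) = (\<integral>x. f x \<partial>\<mu>\<^sub>2)" if "cont f" for f :: "'g \<Rightarrow> real"
    by (rule integral_eq_if_fourier_transform_eq[OF cpt \<mu>1 \<mu>2 _ that])
qed

theorem theorem6p4:
  fixes \<A> :: "'g::{topological_group_add, t2_space, second_countable_topology} chart set"
    and n :: nat
    and \<G> :: "('g \<Rightarrow> complex mat) set"
    and \<mu> :: "'g measure"
  assumes "compact_Lie_group n \<A>"
    and "is_unitary_dual \<G>"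
    and "\<mu> \<in> regular_prob_measures"
  shows "convolution_regular \<mu> \<longleftrightarrow>
         lo_ng_positive \<G> (\<lambda>\<pi>. moore_penrose_inverse (fourier_transform \<mu> \<pi>))"
proof
  have cpt: "compact (UNIV :: 'g set)" using assms(1) by (simp add: compact_Lie_group_def)
  note dual = assms(2) and \<mu> = regular_prob_measuresD[OF assms(3)]
  have un: "unitary_rep \<pi>" if "\<pi> \<in> \<G>" for \<pi>
    using that dual by (auto simp: is_unitary_dual_def irreducible_unitary_rep_def)
  have contractive: "frob_sq (fourier_transform \<nu> \<pi> * V) \<le> frob_sq V"
    if "prob_space \<nu>" "sets \<nu> = sets borel" "\<pi> \<in> \<G>" "V \<in> carrier_mat (rep_dim \<pi>) (rep_dim \<pi>)" for \<nu> \<pi> V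
    using lo_ng_positive_contractive[OF dual lo_ng_positive_fourier_transform[OF cpt that(1,2) un]
        fourier_transform_trivial_rep[OF that(1)] that(3,4)] .
  {
    assume "convolution_regular \<mu>"
    then obtain \<nu> where \<nu>_reg: "\<nu> \<in> regular_prob_measures"
      and conv: "group_convolution (group_convolution \<mu> \<nu>) \<mu> = \<mu>"
      by (auto simp: convolution_regular_def)
    note \<nu> = regular_prob_measuresD[OF \<nu>_reg]
    \<comment> \<open>The transform \<open>B\<close> of \<open>\<nu>\<close> is known to satisfy
      only \<open>A B A = A\<close>. Passing to \<open>B A B\<close> adds the equation
      \<open>X A X = X\<close> without changing the products \<open>A X = A B\<close> and
      \<open>X A = B A\<close>.\<close>
    define X where "X \<pi> = fourier_transform \<nu> \<pi> * (fourier_transform \<mu> \<pi> * fourier_transform \<nu> \<pi>)" for \<pi>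
    have MP: "moore_penrose_inverse (fourier_transform \<mu> \<pi>) = X \<pi>" if \<pi>: "\<pi> \<in> \<G>" for \<pi>
    proof -
      let ?d = "rep_dim \<pi>" and ?A = "fourier_transform \<mu> \<pi>" and ?B = "fourier_transform \<nu> \<pi>"
      note assoc = assoc_mult_mat[of _ ?d ?d _ ?d _ ?d]
      have c: "?A \<in> carrier_mat ?d ?d" "?B \<in> carrier_mat ?d ?d" by (rule fourier_transform_carrier)+
      \<comment> \<open>The transform reverses the order of convolution factors, but the triple
        product is palindromic.\<close>
      have ABA: "?A * (?B * ?A) = ?A"
        using fourier_transform_convolution[OF cpt group_convolution_prob[OF \<mu> \<nu>] \<mu> un[OF \<pi>]]
          fourier_transform_convolution[OF cpt \<mu> \<nu> un[OF \<pi>]] by (simp add: conv)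
      have X: "X \<pi> \<in> carrier_mat ?d ?d"
        unfolding X_def by (rule mult_carrier_mat[OF c(2) mult_carrier_mat[OF c]])
      have AX: "?A * X \<pi> = ?A * ?B"
      proof -
        have "?A * X \<pi> = ?A * (?B * ?A) * ?B" using c by (simp add: X_def assoc)
        then show ?thesis by (simp only: ABA)
      qed
      have XA: "X \<pi> * ?A = ?B * ?A"
      proof -
        have "X \<pi> * ?A = ?B * (?A * (?B * ?A))" using c by (simp add: X_def assoc)
        then show ?thesis by (simp only: ABA)
      qed
      have AB: "?A * ?B \<in> carrier_mat ?d ?d" "?B * ?A \<in> carrier_mat ?d ?d" using c by simp_all
      have "?A * ?B * (?A * ?B) = ?A * (?B * ?A) * ?B" using c by (simp add: assoc)
      then have idem1: "?A * ?B * (?A * ?B) = ?A * ?B" by (simp only: ABA)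
      have "?B * ?A * (?B * ?A) = ?B * (?A * (?B * ?A))" using c by (simp add: assoc)
      then have idem2: "?B * ?A * (?B * ?A) = ?B * ?A" by (simp only: ABA)
      have contr1: "frob_sq (?A * ?B * V) \<le> frob_sq V" if V: "V \<in> carrier_mat ?d ?d" for V
        using contractive[OF \<mu> \<pi> mult_carrier_mat[OF c(2) V]] contractive[OF \<nu> \<pi> V] c V
        by (simp add: assoc)
      have contr2: "frob_sq (?B * ?A * V) \<le> frob_sq V" if V: "V \<in> carrier_mat ?d ?d" for V
        using contractive[OF \<nu> \<pi> mult_carrier_mat[OF c(1) V]] contractive[OF \<mu> \<pi> V] c V
        by (simp add: assoc)
      have P: "orthogonal_projection_mat (?A * X \<pi>)" "orthogonal_projection_mat (X \<pi> * ?A)"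
        unfolding AX XA
        by (rule contractive_idempotent_orthogonal_projection[OF AB(1) idem1 contr1])
          (simp, rule contractive_idempotent_orthogonal_projection[OF AB(2) idem2 contr2], simp)
      have "?A * X \<pi> * ?A = ?A" unfolding AX using c by (simp add: assoc ABA)
      moreover have "X \<pi> * ?A * X \<pi> = X \<pi>"
      proof -
        have "X \<pi> * ?A * X \<pi> = ?B * (?A * X \<pi>)" unfolding XA using c X by (simp add: assoc)
        also have "\<dots> = X \<pi>" unfolding AX by (simp add: X_def)
        finally show ?thesis .
      qed
      ultimately have "is_moore_penrose_inverse ?A (X \<pi>)"
        unfolding is_moore_penrose_inverse_def using P X c by auto
      then show ?thesis by (rule moore_penrose_inverse_eq[OF c(1)])
    qed
    have "lo_ng_positive \<G> X"
      unfolding X_def[abs_def]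
      by (intro lo_ng_positive_mult[OF un] lo_ng_positive_fourier_transform[OF cpt _ _ un] \<mu> \<nu>)
    then show "lo_ng_positive \<G> (\<lambda>\<pi>. moore_penrose_inverse (fourier_transform \<mu> \<pi>))"
      using lo_ng_positive_cong[of \<G> "\<lambda>\<pi>. moore_penrose_inverse (fourier_transform \<mu> \<pi>)" X] MP by blast
  next
    assume LN: "lo_ng_positive \<G> (\<lambda>\<pi>. moore_penrose_inverse (fourier_transform \<mu> \<pi>))"
    define \<nu> where "\<nu> = reflected_measure \<mu>"
    have \<nu>_reg: "\<nu> \<in> regular_prob_measures" unfolding \<nu>_def by (rule reflected_measure_regular[OF assms(3)])
    note \<nu> = regular_prob_measuresD[OF \<nu>_reg]
    note \<mu>\<nu> = group_convolution_prob[OF \<mu> \<nu>]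
    \<comment> \<open>The contraction property requires the value 1 at the trivial representation;
      there the transform of a probability measure is 1, and so is its inverse.\<close>
    have "is_moore_penrose_inverse (1\<^sub>m 1) (1\<^sub>m 1)"
      by (simp add: is_moore_penrose_inverse_def orthogonal_projection_mat_def)
    then have one: "moore_penrose_inverse (fourier_transform \<mu> trivial_rep) = 1\<^sub>m 1"
      unfolding fourier_transform_trivial_rep[OF \<mu>(1)] by (intro moore_penrose_inverse_eq[of _ 1]) simp_all
    have "group_convolution (group_convolution \<mu> \<nu>) \<mu> = \<mu>"
    proof (rule fourier_transform_injective[OF cpt dual group_convolution_prob[OF \<mu>\<nu> \<mu>] \<mu>])
      fix \<pi> assume \<pi>: "\<pi> \<in> \<G>"
      let ?A = "fourier_transform \<mu> \<pi>"
      have A: "?A \<in> carrier_mat (rep_dim \<pi>) (rep_dim \<pi>)" by (rule fourier_transform_carrier)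
      have adj: "fourier_transform \<nu> \<pi> = mat_adjoint ?A"
        unfolding \<nu>_def by (rule fourier_transform_reflected[OF \<mu>(2) un[OF \<pi>]])
      have "fourier_transform (group_convolution (group_convolution \<mu> \<nu>) \<mu>) \<pi> = ?A * (mat_adjoint ?A * ?A)"
        by (simp only: fourier_transform_convolution[OF cpt \<mu>\<nu> \<mu> un[OF \<pi>]]
            fourier_transform_convolution[OF cpt \<mu> \<nu> un[OF \<pi>]] adj)
      also have "\<dots> = ?A * mat_adjoint ?A * ?A"
        by (rule assoc_mult_mat[symmetric]) (use A in auto)
      also have "\<dots> = ?A"
      proof (rule partial_isometry_if_contractive[OF A moore_penrose_inverse_is_inverse[OF A]])
        fix V :: "complex mat" assume V: "V \<in> carrier_mat (rep_dim \<pi>) (rep_dim \<pi>)"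
        show "frob_sq (moore_penrose_inverse ?A * V) \<le> frob_sq V"
          using lo_ng_positive_contractive[OF dual LN one \<pi> V] .
        show "frob_sq (mat_adjoint ?A * V) \<le> frob_sq V"
          using contractive[OF \<nu> \<pi> V] by (simp only: adj)
      qed
      finally show "fourier_transform (group_convolution (group_convolution \<mu> \<nu>) \<mu>) \<pi> = ?A" .
    qed
    then show "convolution_regular \<mu>" using \<nu>_reg unfolding convolution_regular_def by blast
  }
qed

end
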